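(* Let $L$ be a Leibniz algebra over the field of real numbers with radical $R$. Then the conjugacy classes under $I^*(L)$ of Cartan subalgebras of $L$ are in one-to-one correspondence with the conjugacy classes under $I^*(L/R)$ of Cartan subalgebras of $L/R$. Two Cartan subalgebras $H_1,H_2$ of $L$ are conjugate under $I^*(L)$ if and only if $(H_1+R)/R$ and $(H_2+R)/R$ are conjugate under $I^*(L/R)$.
   Context: Leibniz algebras are finite-dimensional left Leibniz algebras: the product satisfies $x(yz)=(xy)z+y(xz)$, i.e. every left multiplication $L_x: y\mapsto xy$ is a derivation. The radical $R$ of $L$ is its largest solvable ideal. For a real Leibniz algebra $L$ and $x\in L$, the series $\exp(L_x)=\sum_{r=0}^{\infty}\frac{1}{r!}L_x^r$ converges and is an automorphism of $L$; $I^*(L)$ is the group of automorphisms of $L$ generated by all $\exp(L_x)$, $x\in L$. Two subalgebras $U,V$ are conjugate under $I^*(L)$ if $\beta(U)=V$ for some $\beta\in I^*(L)$ (and similarly for $L/R$). A Cartan subalgebra of $L$ is a nilpotent subalgebra $C$ with $C=\mathcal{N}_L(C)$, where $\mathcal{N}_L(C)=\{x\in L: xC\subseteq C \text{ and } Cx\subseteq C\}$ is the normalizer of $C$ in $L$. *)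

theory Defs
  imports "HOL-Algebra.Algebra" "HOL-Algebra.Algebraic_Closure_Type" Complex_Main
begin

abbreviation real_ring :: "real ring"
  where "real_ring \<equiv> ring_of_type_algebra"

text \<open>
  Algebras are records of type \<^typ>\<open>(real, 'a) module\<close> whose field \<^const>\<open>monoid.mult\<close> is the
  (non-associative) product. The field \<^const>\<open>monoid.one\<close> that this record type inherits from rings
  carries no meaning and is never used.
\<close>

locale real_leibniz_algebra = module real_ring L for L (structure) +
  assumes finite_dimensional:
      "\<exists>B. finite B \<and> B \<subseteq> carrier L \<and> (\<lambda>W. submodule W real_ring L) hull B = carrier L"
    and mult_closed:
      "\<lbrakk>x \<in> carrier L; y \<in> carrier L\<rbrakk> \<Longrightarrow> x \<otimes> y \<in> carrier L"
    and mult_add_left: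
      "\<lbrakk>x \<in> carrier L; y \<in> carrier L; z \<in> carrier L\<rbrakk> \<Longrightarrow> (x \<oplus> y) \<otimes> z = x \<otimes> z \<oplus> y \<otimes> z"
    and mult_add_right:
      "\<lbrakk>x \<in> carrier L; y \<in> carrier L; z \<in> carrier L\<rbrakk> \<Longrightarrow> x \<otimes> (y \<oplus> z) = x \<otimes> y \<oplus> x \<otimes> z"
    and mult_smult_left:
      "\<lbrakk>x \<in> carrier L; y \<in> carrier L\<rbrakk> \<Longrightarrow> (a \<odot> x) \<otimes> y = a \<odot> (x \<otimes> y)"
    and mult_smult_right:
      "\<lbrakk>x \<in> carrier L; y \<in> carrier L\<rbrakk> \<Longrightarrow> x \<otimes> (a \<odot> y) = a \<odot> (x \<otimes> y)"
    and left_leibniz: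
      "\<lbrakk>x \<in> carrier L; y \<in> carrier L; z \<in> carrier L\<rbrakk> \<Longrightarrow>
        x \<otimes> (y \<otimes> z) = (x \<otimes> y) \<otimes> z \<oplus> y \<otimes> (x \<otimes> z)"

definition subalgebra_of :: "(real, 'a, 'm) module_scheme \<Rightarrow> 'a set \<Rightarrow> bool"
  where "subalgebra_of L U \<longleftrightarrow>
    submodule U real_ring L \<and> (\<forall>x\<in>U. \<forall>y\<in>U. x \<otimes>\<^bsub>L\<^esub> y \<in> U)"

definition ideal_of :: "(real, 'a, 'm) module_scheme \<Rightarrow> 'a set \<Rightarrow> bool"
  where "ideal_of L U \<longleftrightarrow>
    submodule U real_ring L \<and> (\<forall>x\<in>carrier L. \<forall>u\<in>U. x \<otimes>\<^bsub>L\<^esub> u \<in> U \<and> u \<otimes>\<^bsub>L\<^esub> x \<in> U)"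

definition product_space :: "(real, 'a, 'm) module_scheme \<Rightarrow> 'a set \<Rightarrow> 'a set \<Rightarrow> 'a set"
  where "product_space L U V =
    (\<lambda>W. submodule W real_ring L) hull {u \<otimes>\<^bsub>L\<^esub> v | u v. u \<in> U \<and> v \<in> V}"

primrec derived_series :: "(real, 'a, 'm) module_scheme \<Rightarrow> 'a set \<Rightarrow> nat \<Rightarrow> 'a set"
  where "derived_series L U 0 = U"
  | "derived_series L U (Suc n) =
      product_space L (derived_series L U n) (derived_series L U n)"

text \<open>
  In a left Leibniz algebra the lower central series is built by multiplying on the left:
  every product of \<open>n\<close> factors, however bracketed, is a combination of products
  \<open>x\<^sub>1 (x\<^sub>2 (\<dots> x\<^sub>n))\<close>. Multiplying on the right instead gives a strictly weaker notion
  of nilpotency.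
\<close>

primrec lower_central_series :: "(real, 'a, 'm) module_scheme \<Rightarrow> 'a set \<Rightarrow> nat \<Rightarrow> 'a set"
  where "lower_central_series L U 0 = U"
  | "lower_central_series L U (Suc n) = product_space L U (lower_central_series L U n)"

definition solvable_in :: "(real, 'a, 'm) module_scheme \<Rightarrow> 'a set \<Rightarrow> bool"
  where "solvable_in L U \<longleftrightarrow> (\<exists>n. derived_series L U n = {\<zero>\<^bsub>L\<^esub>})"

definition nilpotent_in :: "(real, 'a, 'm) module_scheme \<Rightarrow> 'a set \<Rightarrow> bool"
  where "nilpotent_in L U \<longleftrightarrow> (\<exists>n. lower_central_series L U n = {\<zero>\<^bsub>L\<^esub>})"

definition is_radical :: "(real, 'a, 'm) module_scheme \<Rightarrow> 'a set \<Rightarrow> bool"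
  where "is_radical L R \<longleftrightarrow>
    ideal_of L R \<and> solvable_in L R \<and> (\<forall>U. ideal_of L U \<and> solvable_in L U \<longrightarrow> U \<subseteq> R)"

definition normalizer_of :: "(real, 'a, 'm) module_scheme \<Rightarrow> 'a set \<Rightarrow> 'a set"
  where "normalizer_of L C =
    {x \<in> carrier L. \<forall>c\<in>C. x \<otimes>\<^bsub>L\<^esub> c \<in> C \<and> c \<otimes>\<^bsub>L\<^esub> x \<in> C}"

definition cartan_subalgebra :: "(real, 'a, 'm) module_scheme \<Rightarrow> 'a set \<Rightarrow> bool"
  where "cartan_subalgebra L C \<longleftrightarrow>
    subalgebra_of L C \<and> nilpotent_in L C \<and> C = normalizer_of L C"

text \<open>
  The quotient by an ideal has the cosets of the ideal as elements. The scalar multiple of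
  a coset is written, like \<^const>\<open>rcoset_mult\<close>, without choosing a representative.
\<close>

definition quotient_algebra ::
    "(real, 'a, 'm) module_scheme \<Rightarrow> 'a set \<Rightarrow> (real, 'a set) module"
  where "quotient_algebra L I =
    \<lparr>carrier = a_rcosets\<^bsub>L\<^esub> I, monoid.mult = rcoset_mult L I, one = undefined,
     ring.zero = I, add = set_add L,
     module.smult = (\<lambda>a S. \<Union>x\<in>S. I +>\<^bsub>L\<^esub> (a \<odot>\<^bsub>L\<^esub> x))\<rparr>"

definition image_in_quotient :: "(real, 'a, 'm) module_scheme \<Rightarrow> 'a set \<Rightarrow> 'a set \<Rightarrow> 'a set set"
  where "image_in_quotient L I U = (\<lambda>x. I +>\<^bsub>L\<^esub> x) ` (U <+>\<^bsub>L\<^esub> I)"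

definition linear_functional :: "(real, 'a, 'm) module_scheme \<Rightarrow> ('a \<Rightarrow> real) \<Rightarrow> bool"
  where "linear_functional L \<phi> \<longleftrightarrow>
    (\<forall>x\<in>carrier L. \<forall>y\<in>carrier L. \<phi> (x \<oplus>\<^bsub>L\<^esub> y) = \<phi> x + \<phi> y) \<and>
    (\<forall>a. \<forall>x\<in>carrier L. \<phi> (a \<odot>\<^bsub>L\<^esub> x) = a * \<phi> x)"

text \<open>
  Convergence of series in the canonical topology of a finite-dimensional real vector
  space, that is, convergence of the coordinates. Using all linear functionals avoids
  the choice of a basis. Linear functionals separate points, so the sum is unique.
\<close>

definition series_sums :: "(real, 'a, 'm) module_scheme \<Rightarrow> (nat \<Rightarrow> 'a) \<Rightarrow> 'a \<Rightarrow> bool"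
  where "series_sums L f s \<longleftrightarrow>
    s \<in> carrier L \<and> (\<forall>\<phi>. linear_functional L \<phi> \<longrightarrow> (\<lambda>r. \<phi> (f r)) sums \<phi> s)"

definition exp_left_mult :: "(real, 'a, 'm) module_scheme \<Rightarrow> 'a \<Rightarrow> 'a \<Rightarrow> 'a"
  where "exp_left_mult L x = (\<lambda>y\<in>carrier L.
    THE s. series_sums L (\<lambda>r. (1 / fact r) \<odot>\<^bsub>L\<^esub> (((\<lambda>z. x \<otimes>\<^bsub>L\<^esub> z) ^^ r) y)) s)"

definition algebra_automorphisms :: "(real, 'a, 'm) module_scheme \<Rightarrow> ('a \<Rightarrow> 'a) set"
  where "algebra_automorphisms L = {f \<in> Bij (carrier L).
    (\<forall>x\<in>carrier L. \<forall>y\<in>carrier L. f (x \<oplus>\<^bsub>L\<^esub> y) = f x \<oplus>\<^bsub>L\<^esub> f y) \<and>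
    (\<forall>a. \<forall>x\<in>carrier L. f (a \<odot>\<^bsub>L\<^esub> x) = a \<odot>\<^bsub>L\<^esub> f x) \<and>
    (\<forall>x\<in>carrier L. \<forall>y\<in>carrier L. f (x \<otimes>\<^bsub>L\<^esub> y) = f x \<otimes>\<^bsub>L\<^esub> f y)}"

definition automorphism_group :: "(real, 'a, 'm) module_scheme \<Rightarrow> ('a \<Rightarrow> 'a) monoid"
  where "automorphism_group L =
    BijGroup (carrier L) \<lparr>carrier := algebra_automorphisms L\<rparr>"

definition I_star :: "(real, 'a, 'm) module_scheme \<Rightarrow> ('a \<Rightarrow> 'a) set"
  where "I_star L = generate (automorphism_group L) (exp_left_mult L ` carrier L)"

definition conjugate_in :: "(real, 'a, 'm) module_scheme \<Rightarrow> 'a set \<Rightarrow> 'a set \<Rightarrow> bool"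
  where "conjugate_in L U V \<longleftrightarrow> (\<exists>\<beta>\<in>I_star L. \<beta> ` U = V)"

definition cartan_conj_rel :: "(real, 'a, 'm) module_scheme \<Rightarrow> ('a set \<times> 'a set) set"
  where "cartan_conj_rel L =
    {(H, K). cartan_subalgebra L H \<and> cartan_subalgebra L K \<and> conjugate_in L H K}"

definition cartan_conj_classes :: "(real, 'a, 'm) module_scheme \<Rightarrow> 'a set set set"
  where "cartan_conj_classes L = {H. cartan_subalgebra L H} // cartan_conj_rel L"

end

theory Submission
  imports Defs
begin

text \<open>
  For \<open>h\<close> in \<open>L\<close> let \<open>h\<close> act by left multiplication, a derivation. A nilpotent subalgebra \<open>H\<close> is a
  Cartan subalgebra iff it contains every \<open>x\<close> on which all of its elements act nilpotently; with the
  Fitting decomposition this shows that images of Cartan subalgebras in quotients are Cartan.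

  Existence and conjugacy above a solvable ideal \<open>I\<close> are both proved by descending along chief
  factors \<open>I/J\<close> of a subalgebra \<open>M\<close> that is nilpotent modulo \<open>I\<close>; working modulo \<open>J\<close> inside \<open>L\<close>
  avoids iterated quotients. Since \<open>I/J\<close> is abelian and irreducible, each element of \<open>M\<close> acts on it
  either nilpotently or invertibly. If all act nilpotently, \<open>M\<close> is already nilpotent modulo \<open>J\<close>.
  If \<open>h\<close> acts invertibly, the elements of \<open>M\<close> on which \<open>h\<close> is nilpotent modulo \<open>J\<close> form a
  self-normalizing complement to \<open>I/J\<close>, and two such complements, for \<open>h\<close> and \<open>k\<close> with
  \<open>h - k\<close> in \<open>I\<close>, coincide or are conjugate by \<open>exp (L\<^sub>b)\<close> with \<open>h b \<equiv> h - k\<close>. Finally, conjugating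
  automorphisms lift from \<open>L/R\<close> to \<open>L\<close> because \<open>exp\<close> commutes with the projection.
\<close>

section \<open>Subspaces and their rank\<close>

text \<open>The obstacle throughout is the asymmetry of the product: left multiplications are
  derivations, right multiplications need not be, and \<open>x x\<close> may be nonzero, so an
  element need not be killed by any power of its own left multiplication. Two facts restore enough
  symmetry: \<open>x y + y x\<close> always annihilates from the left, and on a chief factor the
  right action of \<open>M\<close> is either zero or the negative of the left one. Nilpotency and
  irreducibility can therefore be studied with left multiplications alone. Solvability makes a chief
  factor \<open>I/J\<close> abelian. Elements of \<open>M\<close> that agree modulo \<open>I\<close>
  then act alike on \<open>I/J\<close>, and the second-order terms of the exponential fall into
  \<open>J\<close>. The inductions keep \<open>M\<close> or shrink it to the complement, and pass
  from \<open>I\<close> to \<open>J\<close>; the rank of the ideal drops either way. The carrier has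
  no topology. Sums of series are tested by linear functionals, a dual basis supplies the limits,
  and subspaces are closed because each is an intersection of kernels of functionals.\<close>

lemma real_ring_simps [simp]:
  "carrier real_ring = UNIV"
  "x \<otimes>\<^bsub>real_ring\<^esub> y = x * y" "x \<oplus>\<^bsub>real_ring\<^esub> y = x + y"
  "\<one>\<^bsub>real_ring\<^esub> = 1" "\<zero>\<^bsub>real_ring\<^esub> = 0"
  by (simp_all add: ring_of_type_algebra_def)

context real_leibniz_algebra
begin

abbreviation subsp :: "'a set \<Rightarrow> bool" where "subsp W \<equiv> submodule W real_ring L"

lemma scale_closed [simp, intro]: "x \<in> carrier L \<Longrightarrow> a \<odot> x \<in> carrier L"
  by simp

lemma scale_add: "x \<in> carrier L \<Longrightarrow> (a + b) \<odot> x = a \<odot> x \<oplus> b \<odot> x"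
  using smult_l_distr[of a b x] by simp

lemma scale_add_right: "x \<in> carrier L \<Longrightarrow> y \<in> carrier L \<Longrightarrow> a \<odot> (x \<oplus> y) = a \<odot> x \<oplus> a \<odot> y"
  using smult_r_distr[of a x y] by simp

lemma scale_assoc: "x \<in> carrier L \<Longrightarrow> a \<odot> (b \<odot> x) = (a * b) \<odot> x"
  using smult_assoc1[of a b x] by simp

lemma scale_one [simp]: "x \<in> carrier L \<Longrightarrow> (1::real) \<odot> x = x"
  using smult_one[of x] by simp

lemma scale_zero [simp]: "x \<in> carrier L \<Longrightarrow> (0::real) \<odot> x = \<zero>"
  using smult_l_null[of x] by simp

lemma scale_zero_right [simp]: "(a::real) \<odot> \<zero> = \<zero>"
  using smult_r_null[of a] by simp

lemma neg_eq_scale: "x \<in> carrier L \<Longrightarrow> \<ominus> x = (-1::real) \<odot> x"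
  using scale_add[of x 1 "-1"] by (simp add: M.add.inv_equality M.add.m_comm)

lemmas mult_closed [simp, intro]

lemma subspI:
  assumes "W \<subseteq> carrier L" "\<zero> \<in> W" "\<And>x y. x \<in> W \<Longrightarrow> y \<in> W \<Longrightarrow> x \<oplus> y \<in> W"
    "\<And>a x. x \<in> W \<Longrightarrow> a \<odot> x \<in> W"
  shows "subsp W"
  using assms by (intro submoduleI) (auto simp: subset_iff neg_eq_scale)

lemma subsp_carrier: "subsp W \<Longrightarrow> W \<subseteq> carrier L"
  and subsp_add: "subsp W \<Longrightarrow> x \<in> W \<Longrightarrow> y \<in> W \<Longrightarrow> x \<oplus> y \<in> W"
  and subsp_scale: "subsp W \<Longrightarrow> x \<in> W \<Longrightarrow> a \<odot> x \<in> W"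
  and subsp_neg: "subsp W \<Longrightarrow> x \<in> W \<Longrightarrow> \<ominus> x \<in> W"
  using submoduleE[of W] by auto

lemma subsp_in_carrier: "subsp W \<Longrightarrow> x \<in> W \<Longrightarrow> x \<in> carrier L"
  using subsp_carrier by blast

lemma subsp_zero: "subsp W \<Longrightarrow> \<zero> \<in> W"
  using submoduleE(2)[of W] subsp_scale[of W _ 0] subsp_carrier[of W]
  by (metis all_not_in_conv scale_zero subset_iff)

lemma subsp_diff: "subsp W \<Longrightarrow> x \<in> W \<Longrightarrow> y \<in> W \<Longrightarrow> x \<ominus> y \<in> W"
  by (simp add: a_minus_def subsp_add subsp_neg)

lemma subsp_add_cancel_left:
  assumes "subsp W" "x \<in> W" "y \<in> carrier L" "x \<oplus> y \<in> W"
  shows "y \<in> W"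
proof -
  have "\<ominus> x \<oplus> (x \<oplus> y) = y"
    using assms by (simp add: M.r_neg1 subsp_in_carrier)
  then show ?thesis using assms by (metis subsp_add subsp_neg)
qed

lemma subsp_whole: "subsp (carrier L)"
  by (rule carrier_is_submodule)

lemma subsp_zero_set: "subsp {\<zero>}"
  by (rule subspI) auto

lemma subsp_Int: "subsp V \<Longrightarrow> subsp W \<Longrightarrow> subsp (V \<inter> W)"
  by (rule subspI) (auto simp: subsp_zero subsp_add subsp_scale subsp_in_carrier)

lemma subsp_hull: "A \<subseteq> carrier L \<Longrightarrow> subsp (subsp hull A)"
proof (rule subspI)
  assume A: "A \<subseteq> carrier L"
  show "subsp hull A \<subseteq> carrier L" by (rule hull_minimal) (use A subsp_whole in auto)
qed (auto simp: hull_def intro: subsp_zero subsp_add subsp_scale)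

lemma set_addI: "x \<in> V \<Longrightarrow> y \<in> W \<Longrightarrow> x \<oplus> y \<in> V <+>\<^bsub>L\<^esub> W"
  by (auto simp: set_add_def')

lemma set_addE:
  assumes "z \<in> V <+>\<^bsub>L\<^esub> W" obtains x y where "x \<in> V" "y \<in> W" "z = x \<oplus> y"
  using assms by (auto simp: set_add_def')

lemma add_swap:
  "\<lbrakk>a \<in> carrier L; b \<in> carrier L; c \<in> carrier L; d \<in> carrier L\<rbrakk> \<Longrightarrow>
    (a \<oplus> b) \<oplus> (c \<oplus> d) = (a \<oplus> c) \<oplus> (b \<oplus> d)"
  by (simp add: M.add.m_ac)

lemma subsp_set_add: assumes "subsp V" "subsp W" shows "subsp (V <+>\<^bsub>L\<^esub> W)"
proof (rule subspI)
  show "\<zero> \<in> V <+>\<^bsub>L\<^esub> W" using set_addI[OF subsp_zero subsp_zero, OF assms] by simp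
  fix x y assume "x \<in> V <+>\<^bsub>L\<^esub> W" "y \<in> V <+>\<^bsub>L\<^esub> W"
  then obtain a b c d where *: "a \<in> V" "b \<in> W" "x = a \<oplus> b" "c \<in> V" "d \<in> W" "y = c \<oplus> d"
    by (auto elim!: set_addE)
  then have "x \<oplus> y = (a \<oplus> c) \<oplus> (b \<oplus> d)"
    using add_swap[of a b c d] subsp_carrier[OF assms(1)] subsp_carrier[OF assms(2)] by auto
  then show "x \<oplus> y \<in> V <+>\<^bsub>L\<^esub> W" using * assms by (simp add: set_addI subsp_add)
next
  fix r x assume "x \<in> V <+>\<^bsub>L\<^esub> W"
  then show "r \<odot> x \<in> V <+>\<^bsub>L\<^esub> W"
    using assms by (auto elim!: set_addE simp: scale_add_right set_addI subsp_scale
        subsp_in_carrier[OF assms(1)] subsp_in_carrier[OF assms(2)])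
qed (auto elim!: set_addE intro!: M.a_closed intro: subsp_in_carrier[OF assms(1)] subsp_in_carrier[OF assms(2)])

lemma set_add_upper1:
  assumes "V \<subseteq> carrier L" "subsp W"
  shows "V \<subseteq> V <+>\<^bsub>L\<^esub> W"
proof
  fix x assume "x \<in> V"
  then show "x \<in> V <+>\<^bsub>L\<^esub> W"
    using set_addI[OF _ subsp_zero[OF assms(2)], of x V] assms(1) by auto
qed

lemma set_add_upper2:
  assumes "W \<subseteq> carrier L" "subsp V"
  shows "W \<subseteq> V <+>\<^bsub>L\<^esub> W"
proof
  fix x assume "x \<in> W"
  then show "x \<in> V <+>\<^bsub>L\<^esub> W"
    using set_addI[OF subsp_zero[OF assms(2)], of x W] assms(1) by auto
qed

lemma set_add_least: "subsp U \<Longrightarrow> V \<subseteq> U \<Longrightarrow> W \<subseteq> U \<Longrightarrow> V <+>\<^bsub>L\<^esub> W \<subseteq> U"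
  by (auto elim!: set_addE intro: subsp_add)

lemma subsp_line: "x \<in> carrier L \<Longrightarrow> subsp (range (\<lambda>a. a \<odot> x))"
proof (rule subspI)
  fix y z assume "x \<in> carrier L" "y \<in> range (\<lambda>a. a \<odot> x)" "z \<in> range (\<lambda>a. a \<odot> x)"
  then show "y \<oplus> z \<in> range (\<lambda>a. a \<odot> x)" by (auto simp: scale_add[symmetric])
qed (auto simp: scale_assoc intro: range_eqI[of _ _ 0])

text \<open>The rank of \<open>U\<close> grows by one with each new spanning vector \<open>b\<close> for which
  \<open>U\<close> meets \<open>b + span B\<close> up to scaling.\<close>

lemma rank_on_hull:
  assumes "finite B" "B \<subseteq> carrier L"
  shows "\<exists>d::'a set \<Rightarrow> nat. \<forall>U V. subsp U \<longrightarrow> subsp V \<longrightarrow> U \<subset> V \<longrightarrow> V \<subseteq> subsp hull B \<longrightarrow> d U < d V"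
  using assms
proof (induction B)
  case empty
  have "subsp hull {} \<subseteq> {\<zero>}" by (rule hull_minimal) (auto simp: subsp_zero_set)
  then have "\<not> (subsp U \<and> U \<subset> V \<and> V \<subseteq> subsp hull {})" for U V :: "'a set"
    using subsp_zero[of U] by blast
  then show ?case by blast
next
  case (insert b B)
  define S where "S = subsp hull B"
  obtain d :: "'a set \<Rightarrow> nat" where
    d: "\<And>U V. subsp U \<Longrightarrow> subsp V \<Longrightarrow> U \<subset> V \<Longrightarrow> V \<subseteq> S \<Longrightarrow> d U < d V"
    using insert.IH insert.prems unfolding S_def by blast
  have b: "b \<in> carrier L" and S: "subsp S" using insert by (auto simp: S_def subsp_hull)
  have span: "subsp hull (insert b B) \<subseteq> range (\<lambda>a. a \<odot> b) <+>\<^bsub>L\<^esub> S"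
  proof (rule hull_minimal)
    have "b \<in> range (\<lambda>a. a \<odot> b)" by (rule range_eqI[of _ _ 1]) (simp add: b)
    then show "insert b B \<subseteq> range (\<lambda>a. a \<odot> b) <+>\<^bsub>L\<^esub> S"
      using set_add_upper1[OF subsp_carrier[OF subsp_line[OF b]] S]
        set_add_upper2[OF subsp_carrier[OF S] subsp_line[OF b]] hull_subset[of B subsp]
      by (auto simp: S_def)
    show "subsp (range (\<lambda>a. a \<odot> b) <+>\<^bsub>L\<^esub> S)" by (intro subsp_set_add subsp_line b S)
  qed
  define e where "e U = d (U \<inter> S) + (if U \<subseteq> S then 0 else 1)" for U
  have "e U < e V" if U: "subsp U" and V: "subsp V" and "U \<subset> V" and "V \<subseteq> subsp hull (insert b B)"
    for U V
  proof (cases "U \<inter> S \<subset> V \<inter> S")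
    case True
    then have "d (U \<inter> S) < d (V \<inter> S)" by (intro d subsp_Int U V S) auto
    moreover have "U \<subseteq> S" if "V \<subseteq> S" using that \<open>U \<subset> V\<close> by blast
    ultimately show ?thesis by (auto simp: e_def)
  next
    case False
    then have eq: "U \<inter> S = V \<inter> S" using \<open>U \<subset> V\<close> by blast
    \<comment> \<open>Otherwise some \<open>u\<close> in \<open>U\<close> has a nonzero
      \<open>b\<close>-component. Subtracting multiples of \<open>u\<close> pushes every
      \<open>v\<close> of \<open>V\<close> into \<open>V \<inter> S = U \<inter> S\<close>, which
      forces \<open>V = U\<close>.\<close>
    have "U \<subseteq> S \<and> \<not> V \<subseteq> S"
    proof (rule ccontr)
      assume "\<not> (U \<subseteq> S \<and> \<not> V \<subseteq> S)"
      then obtain u where u: "u \<in> U" "u \<notin> S" using eq \<open>U \<subset> V\<close> by blast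
      obtain \<alpha> s where us: "u = \<alpha> \<odot> b \<oplus> s" "s \<in> S"
        using u \<open>U \<subset> V\<close> \<open>V \<subseteq> subsp hull (insert b B)\<close> span by (blast elim: set_addE)
      have "\<alpha> \<noteq> 0" using us u b subsp_in_carrier[OF S, of s] by (cases "\<alpha> = 0") auto
      have "V \<subseteq> U"
      proof
        fix v assume v: "v \<in> V"
        then obtain \<beta> t where vt: "v = \<beta> \<odot> b \<oplus> t" "t \<in> S"
          using \<open>V \<subseteq> subsp hull (insert b B)\<close> span by (blast elim: set_addE)
        define w where "w = v \<oplus> (- \<beta> / \<alpha>) \<odot> u"
        have cl: "s \<in> carrier L" "t \<in> carrier L" "u \<in> carrier L" "v \<in> carrier L"
          using us vt S u U v V by (auto intro: subsp_in_carrier)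
        have "w = (\<beta> \<odot> b \<oplus> t) \<oplus> ((- \<beta>) \<odot> b \<oplus> (- \<beta> / \<alpha>) \<odot> s)"
          using \<open>\<alpha> \<noteq> 0\<close> cl b by (simp add: w_def us(1) vt(1) scale_add_right scale_assoc)
        also have "\<dots> = (\<beta> \<odot> b \<oplus> (- \<beta>) \<odot> b) \<oplus> (t \<oplus> (- \<beta> / \<alpha>) \<odot> s)"
          using cl b by (intro add_swap) auto
        also have "\<dots> = t \<oplus> (- \<beta> / \<alpha>) \<odot> s"
          using cl b by (simp add: scale_add[symmetric])
        finally have "w \<in> S" using us vt S by (simp add: subsp_add subsp_scale)
        moreover have "w \<in> V" using u v V \<open>U \<subset> V\<close> by (auto simp: w_def intro!: subsp_add subsp_scale)
        ultimately have "w \<in> U" using eq by blast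
        moreover have "v = w \<oplus> (\<beta> / \<alpha>) \<odot> u"
          using cl by (simp add: w_def M.a_assoc scale_add[symmetric])
        ultimately show "v \<in> U" using u U by (simp add: subsp_add subsp_scale)
      qed
      then show False using \<open>U \<subset> V\<close> by blast
    qed
    then show ?thesis by (simp add: e_def eq)
  qed
  then show ?case by blast
qed

text \<open>Any function that increases strictly along proper inclusions of subspaces serves as an
  induction measure and yields minimal and maximal subspaces, so one is chosen instead of
  constructing the dimension.\<close>

definition rank :: "'a set \<Rightarrow> nat" where
  "rank = (SOME d. \<forall>U V. subsp U \<longrightarrow> subsp V \<longrightarrow> U \<subset> V \<longrightarrow> d U < d V)"

lemma rank_less: "subsp U \<Longrightarrow> subsp V \<Longrightarrow> U \<subset> V \<Longrightarrow> rank U < rank V"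
proof -
  obtain B where B: "finite B" "B \<subseteq> carrier L" "subsp hull B = carrier L"
    using finite_dimensional by blast
  have "\<exists>d::'a set \<Rightarrow> nat. \<forall>U V. subsp U \<longrightarrow> subsp V \<longrightarrow> U \<subset> V \<longrightarrow> d U < d V"
    using rank_on_hull[OF B(1,2)] subsp_carrier unfolding B(3) by meson
  then have "\<forall>U V. subsp U \<longrightarrow> subsp V \<longrightarrow> U \<subset> V \<longrightarrow> rank U < rank V"
    unfolding rank_def by (rule someI_ex)
  then show "subsp U \<Longrightarrow> subsp V \<Longrightarrow> U \<subset> V \<Longrightarrow> rank U < rank V" by blast
qed

lemma minimal_subsp:
  assumes "P W0" and "\<And>W. P W \<Longrightarrow> subsp W"
  obtains W where "P W" "\<And>V. P V \<Longrightarrow> V \<subseteq> W \<Longrightarrow> V = W"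
proof -
  obtain W where W: "P W" "\<And>V. P V \<Longrightarrow> rank W \<le> rank V"
    using ex_has_least_nat[of P W0 rank] assms(1) by blast
  then show thesis using that[of W] rank_less assms(2) by (meson leD psubsetI)
qed

lemma maximal_subsp:
  assumes "P W0" and "\<And>W. P W \<Longrightarrow> subsp W"
  obtains W where "P W" "\<And>V. P V \<Longrightarrow> W \<subseteq> V \<Longrightarrow> V = W"
proof -
  have bound: "rank W \<le> rank (carrier L)" if "P W" for W
    using rank_less[of W "carrier L"] subsp_whole assms(2)[OF that] subsp_carrier[of W] by fastforce
  obtain W where W: "P W" "\<And>V. P V \<Longrightarrow> rank V \<le> rank W"
    using ex_has_greatest_nat[of P W0 rank "rank (carrier L) + 1"] assms(1) bound
    by (metis less_Suc_eq_le Suc_eq_plus1)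
  then show thesis using that[of W] rank_less assms(2) by (metis leD psubsetI)
qed

end

section \<open>Linear functionals and exponentials of operators\<close>

text \<open>A dual basis turns a bilinear expression in two vector series into a finite sum over
  \<open>b\<close> of products of real series; the usual Cauchy product then applies for each
  \<open>b\<close>.\<close>

lemma Cauchy_product_sum_sums:
  fixes f g :: "'b \<Rightarrow> nat \<Rightarrow> real"
  assumes "\<And>b. b \<in> B \<Longrightarrow> summable (\<lambda>r. \<bar>f b r\<bar>)" "\<And>b. b \<in> B \<Longrightarrow> summable (\<lambda>r. \<bar>g b r\<bar>)"
  shows "(\<lambda>n. \<Sum>i\<le>n. \<Sum>b\<in>B. f b i * g b (n - i)) sums (\<Sum>b\<in>B. suminf (f b) * suminf (g b))"
proof -
  have "(\<lambda>n. \<Sum>b\<in>B. \<Sum>i\<le>n. f b i * g b (n - i)) sums (\<Sum>b\<in>B. suminf (f b) * suminf (g b))"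
    using assms by (intro sums_sum Cauchy_product_sums) simp_all
  then show ?thesis by (subst sum.swap)
qed

lemma Suc_mult_divide_fact:
  fixes a c :: real
  shows "real (Suc i) * (a / (fact (Suc i) * c)) = a / (fact i * c)"
    and "real (Suc i) * (a / (c * fact (Suc i))) = a / (c * fact i)"
  by (simp_all del: of_nat_Suc)

context real_leibniz_algebra
begin

abbreviation lin :: "('a \<Rightarrow> real) \<Rightarrow> bool" where "lin \<phi> \<equiv> linear_functional L \<phi>"

lemma lin_add: "lin \<phi> \<Longrightarrow> x \<in> carrier L \<Longrightarrow> y \<in> carrier L \<Longrightarrow> \<phi> (x \<oplus> y) = \<phi> x + \<phi> y"
  and lin_scale: "lin \<phi> \<Longrightarrow> x \<in> carrier L \<Longrightarrow> \<phi> (a \<odot> x) = a * \<phi> x"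
  by (auto simp: linear_functional_def)

lemma lin_zero: "lin \<phi> \<Longrightarrow> \<phi> \<zero> = 0"
  using lin_scale[of \<phi> \<zero> 0] by simp

lemma lin_neg: "lin \<phi> \<Longrightarrow> x \<in> carrier L \<Longrightarrow> \<phi> (\<ominus> x) = - \<phi> x"
  by (simp add: neg_eq_scale lin_scale)

lemma lin_diff: "lin \<phi> \<Longrightarrow> x \<in> carrier L \<Longrightarrow> y \<in> carrier L \<Longrightarrow> \<phi> (x \<ominus> y) = \<phi> x - \<phi> y"
  by (simp add: a_minus_def lin_neg lin_add)

lemmas lin_simps = lin_add lin_scale lin_zero lin_neg lin_diff

text \<open>A subspace that is maximal among those avoiding \<open>x\<close> is a hyperplane complementary
  to the line through \<open>x\<close>.\<close>

lemma separating_functional: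
  assumes J: "subsp J" and x: "x \<in> carrier L" "x \<notin> J"
  obtains \<phi> where "lin \<phi>" "\<And>y. y \<in> J \<Longrightarrow> \<phi> y = 0" "\<phi> x = 1"
proof -
  obtain W where W: "subsp W" "J \<subseteq> W" "x \<notin> W"
    and max: "\<And>V. subsp V \<Longrightarrow> J \<subseteq> V \<Longrightarrow> x \<notin> V \<Longrightarrow> W \<subseteq> V \<Longrightarrow> V = W"
    using maximal_subsp[of "\<lambda>W. subsp W \<and> J \<subseteq> W \<and> x \<notin> W" J] J x by (metis subset_refl)
  note Wc = subsp_in_carrier[OF W(1)]
  \<comment> \<open>Modulo \<open>W\<close> every \<open>y\<close> is a multiple of
    \<open>x\<close>: if \<open>y\<close> is not in \<open>W\<close>, maximality puts
    \<open>x\<close> into the span of \<open>y\<close> and \<open>W\<close>, with a nonzero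
    coefficient at \<open>y\<close>.\<close>
  have ex: "\<exists>t. y \<oplus> (- t) \<odot> x \<in> W" if y: "y \<in> carrier L" for y
  proof (cases "y \<in> W")
    case True
    then show ?thesis using x y by (intro exI[of _ 0]) simp
  next
    case False
    define V where "V = range (\<lambda>a. a \<odot> y) <+>\<^bsub>L\<^esub> W"
    have V: "subsp V" unfolding V_def by (intro subsp_set_add subsp_line y W)
    have WV: "W \<subseteq> V" unfolding V_def
      by (rule set_add_upper2) (auto simp: subsp_line y subsp_carrier W)
    have "y \<in> V" unfolding V_def
      using set_add_upper1[OF subsp_carrier[OF subsp_line[OF y]] W(1)] y
      by (metis rangeI scale_one subsetD)
    then have "x \<in> V" using max[OF V] WV W(2) False by blast
    then obtain a w where aw: "x = a \<odot> y \<oplus> w" "w \<in> W" by (auto simp: V_def elim!: set_addE)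
    have "a \<noteq> 0" using aw W(3) y Wc[of w] by (cases "a = 0") auto
    have "y \<oplus> (- (1 / a)) \<odot> x = (y \<oplus> (-1) \<odot> y) \<oplus> (- 1 / a) \<odot> w"
      using aw y Wc \<open>a \<noteq> 0\<close> by (simp add: scale_add_right scale_assoc M.a_assoc)
    also have "y \<oplus> (-1) \<odot> y = \<zero>" using y by (simp add: neg_eq_scale[symmetric] M.r_neg)
    finally have "y \<oplus> (- (1 / a)) \<odot> x \<in> W" using aw Wc W by (simp add: subsp_scale)
    then show ?thesis by blast
  qed
  have uniq: "s = t" if "y \<in> carrier L" "y \<oplus> (- s) \<odot> x \<in> W" "y \<oplus> (- t) \<odot> x \<in> W" for y s t
  proof (rule ccontr)
    assume "s \<noteq> t"
    have "(y \<oplus> (- s) \<odot> x) \<oplus> (-1) \<odot> (y \<oplus> (- t) \<odot> x) = (y \<oplus> (- s) \<odot> x) \<oplus> ((-1) \<odot> y \<oplus> t \<odot> x)"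
      using that x by (simp add: scale_add_right scale_assoc)
    also have "\<dots> = (y \<oplus> (-1) \<odot> y) \<oplus> ((- s) \<odot> x \<oplus> t \<odot> x)"
      using that x by (intro add_swap) auto
    also have "\<dots> = (t - s) \<odot> x"
      using that x by (simp add: neg_eq_scale[symmetric] M.r_neg scale_add[symmetric])
    finally have "(t - s) \<odot> x \<in> W" using subsp_add[OF W(1)] subsp_scale[OF W(1)] that by metis
    then have "(1 / (t - s)) \<odot> ((t - s) \<odot> x) \<in> W" using subsp_scale[OF W(1)] by blast
    then show False using \<open>s \<noteq> t\<close> x W(3) by (simp add: scale_assoc)
  qed
  define \<phi> where "\<phi> y = (THE t. y \<oplus> (- t) \<odot> x \<in> W)" for y
  have \<phi>: "\<phi> y = t" if "y \<in> carrier L" "y \<oplus> (- t) \<odot> x \<in> W" for y t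
    unfolding \<phi>_def using that uniq by blast
  have \<phi>W: "y \<oplus> (- \<phi> y) \<odot> x \<in> W" if "y \<in> carrier L" for y
    using ex[OF that] \<phi>[OF that] by metis
  have "lin \<phi>" unfolding linear_functional_def
  proof (intro conjI ballI allI)
    fix y z assume yz: "y \<in> carrier L" "z \<in> carrier L"
    have "(y \<oplus> z) \<oplus> ((- \<phi> y) \<odot> x \<oplus> (- \<phi> z) \<odot> x) = (y \<oplus> (- \<phi> y) \<odot> x) \<oplus> (z \<oplus> (- \<phi> z) \<odot> x)"
      using yz x by (intro add_swap) auto
    also have "\<dots> \<in> W" by (rule subsp_add[OF W(1) \<phi>W[OF yz(1)] \<phi>W[OF yz(2)]])
    finally have "(y \<oplus> z) \<oplus> (- (\<phi> y + \<phi> z)) \<odot> x \<in> W"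
      using x scale_add[of x "- \<phi> y" "- \<phi> z"] by simp
    then show "\<phi> (y \<oplus> z) = \<phi> y + \<phi> z" using \<phi> yz by simp
  next
    fix a y assume y: "y \<in> carrier L"
    have "a \<odot> (y \<oplus> (- \<phi> y) \<odot> x) \<in> W" using \<phi>W[OF y] W by (intro subsp_scale) auto
    then have "a \<odot> y \<oplus> (- (a * \<phi> y)) \<odot> x \<in> W" using y x by (simp add: scale_add_right scale_assoc)
    then show "\<phi> (a \<odot> y) = a * \<phi> y" using \<phi> y by simp
  qed
  moreover have "\<phi> y = 0" if "y \<in> J" for y
    using that W(2) Wc x by (intro \<phi>) auto
  moreover have "\<phi> x = 1"
    using x subsp_zero[OF W(1)] by (intro \<phi>) (auto simp: neg_eq_scale[symmetric] M.r_neg)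
  ultimately show thesis using that by blast
qed

text \<open>A nonzero \<open>x - y\<close> avoids the zero subspace and is separated from it.
  Besides its role in uniqueness of limits, this reduces longer vector identities to real
  arithmetic.\<close>

lemma vec_eqI:
  assumes "x \<in> carrier L" "y \<in> carrier L" "\<And>\<phi>. lin \<phi> \<Longrightarrow> \<phi> x = \<phi> y"
  shows "x = y"
proof (rule ccontr)
  assume "x \<noteq> y"
  moreover have "x = (x \<ominus> y) \<oplus> y"
    using assms by (simp add: a_minus_def M.a_assoc M.l_neg)
  ultimately have "x \<ominus> y \<notin> {\<zero>}" using assms by auto
  then obtain \<phi> where "lin \<phi>" "\<phi> (x \<ominus> y) = 1"
    using separating_functional[OF subsp_zero_set, of "x \<ominus> y"] assms by blast
  then show False using assms(3)[OF \<open>lin \<phi>\<close>] lin_diff[OF \<open>lin \<phi>\<close> assms(1,2)] by simp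
qed

text \<open>Separation exhibits \<open>J\<close> as the common zero set of the functionals vanishing
  on it. This is the closedness that lets membership in \<open>J\<close> pass to sums of
  series.\<close>

lemma in_subspI:
  assumes "subsp J" "x \<in> carrier L"
    and "\<And>\<phi>. lin \<phi> \<Longrightarrow> (\<And>y. y \<in> J \<Longrightarrow> \<phi> y = 0) \<Longrightarrow> \<phi> x = 0"
  shows "x \<in> J"
proof (rule ccontr)
  assume "x \<notin> J"
  then obtain \<phi> where "lin \<phi>" "\<And>y. y \<in> J \<Longrightarrow> \<phi> y = 0" "\<phi> x = 1"
    using separating_functional[OF assms(1,2)] by blast
  then show False using assms(3) by fastforce
qed

lemma vec_with_coordinates:
  assumes "finite B" "B \<subseteq> carrier L"
  shows "\<exists>s\<in>carrier L. \<forall>\<phi>. lin \<phi> \<longrightarrow> \<phi> s = (\<Sum>b\<in>B. c b * \<phi> b)"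
  using assms
proof (induction B)
  case empty
  then show ?case by (intro bexI[of _ \<zero>]) (auto simp: lin_zero)
next
  case (insert b B)
  then obtain s where "s \<in> carrier L" "\<And>\<phi>. lin \<phi> \<Longrightarrow> \<phi> s = (\<Sum>b\<in>B. c b * \<phi> b)" by auto
  then show ?case using insert by (intro bexI[of _ "c b \<odot> b \<oplus> s"]) (auto simp: lin_simps)
qed

text \<open>In a spanning set of least size no element lies in the span of the others, so each
  \<open>b\<close> has a functional equal to 1 at \<open>b\<close> and vanishing on the rest. The
  expansion is stated after applying a functional because every later use is about real
  series.\<close>

lemma dual_basis:
  obtains B \<kappa> where "finite B" "B \<subseteq> carrier L" "\<And>b. b \<in> B \<Longrightarrow> lin (\<kappa> b)"
    "\<And>\<phi> y. lin \<phi> \<Longrightarrow> y \<in> carrier L \<Longrightarrow> \<phi> y = (\<Sum>b\<in>B. \<kappa> b y * \<phi> b)"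
proof -
  define P where "P B \<longleftrightarrow> finite B \<and> B \<subseteq> carrier L \<and> subsp hull B = carrier L" for B :: "'a set"
  obtain B\<^sub>0 where "P B\<^sub>0" using finite_dimensional unfolding P_def by blast
  then obtain B where "P B" and min: "\<And>A. P A \<Longrightarrow> card B \<le> card A"
    using ex_has_least_nat[of P B\<^sub>0 card] by blast
  then have B: "finite B" "B \<subseteq> carrier L" "subsp hull B = carrier L" by (auto simp: P_def)
  have "\<exists>\<phi>. lin \<phi> \<and> (\<forall>y\<in>B. \<phi> y = (if y = b then 1 else 0))" if b: "b \<in> B" for b
  proof -
    define S where "S = subsp hull (B - {b})"
    have S: "subsp S" unfolding S_def using B by (intro subsp_hull) auto
    have BS: "B - {b} \<subseteq> S" unfolding S_def by (rule hull_subset)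
    have "b \<notin> S"
    proof
      assume "b \<in> S"
      then have "subsp hull B \<subseteq> S" using BS S by (intro hull_minimal) auto
      then have "P (B - {b})" using B subsp_carrier[OF S] unfolding P_def S_def by blast
      then show False using min[of "B - {b}"] B b by (meson card_Diff1_less not_le)
    qed
    then obtain \<phi> where "lin \<phi>" "\<And>y. y \<in> S \<Longrightarrow> \<phi> y = 0" "\<phi> b = 1"
      using b B(2) \<open>b \<notin> S\<close> by (rule_tac separating_functional[OF S, of b]) auto
    then show ?thesis using BS by (intro exI[of _ \<phi>]) auto
  qed
  then have "\<forall>b\<in>B. \<exists>\<phi>. lin \<phi> \<and> (\<forall>y\<in>B. \<phi> y = (if y = b then 1 else 0))" by blast
  from bchoice[OF this] obtain \<kappa> where \<kappa>: "\<And>b. b \<in> B \<Longrightarrow> lin (\<kappa> b)"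
      "\<And>b y. b \<in> B \<Longrightarrow> y \<in> B \<Longrightarrow> \<kappa> b y = (if y = b then 1 else 0)"
    by blast
  \<comment> \<open>The vectors that have coordinates in \<open>B\<close> form a subspace containing
    \<open>B\<close>, hence all of \<open>L\<close>; evaluating \<open>\<kappa> b\<close> then
    identifies the coordinates.\<close>
  define S where "S = {y \<in> carrier L. \<exists>c. \<forall>\<phi>. lin \<phi> \<longrightarrow> \<phi> y = (\<Sum>b\<in>B. c b * \<phi> b)}"
  have SI: "y \<in> S" if "y \<in> carrier L" "\<And>\<phi>. lin \<phi> \<Longrightarrow> \<phi> y = (\<Sum>b\<in>B. c b * \<phi> b)" for y c
    unfolding S_def using that by (intro CollectI conjI exI[of _ c]) auto
  have SE: "\<exists>c. \<forall>\<phi>. lin \<phi> \<longrightarrow> \<phi> y = (\<Sum>b\<in>B. c b * \<phi> b)" "y \<in> carrier L" if "y \<in> S" for y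
    using that by (auto simp: S_def)
  have "subsp hull B \<subseteq> S"
  proof (rule hull_minimal)
    show "B \<subseteq> S"
    proof
      fix y assume y: "y \<in> B"
      have "\<phi> y = (\<Sum>b\<in>B. (if b = y then 1 else 0) * \<phi> b)" for \<phi> :: "'a \<Rightarrow> real"
      proof -
        have "(\<Sum>b\<in>B. (if b = y then 1 else 0) * \<phi> b) = (\<Sum>b\<in>B. if b = y then \<phi> b else 0)"
          by (intro sum.cong) auto
        then show ?thesis using y B by simp
      qed
      then show "y \<in> S" using y B by (intro SI[of y "\<lambda>b. if b = y then 1 else 0"]) auto
    qed
    show "subsp S"
    proof (rule subspI)
      show "\<zero> \<in> S" by (rule SI[of _ "\<lambda>_. 0"]) (auto simp: lin_zero)
    next
      fix x y assume xy: "x \<in> S" "y \<in> S"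
      obtain c d where c: "\<forall>\<phi>. lin \<phi> \<longrightarrow> \<phi> x = (\<Sum>b\<in>B. c b * \<phi> b)"
        and d: "\<forall>\<phi>. lin \<phi> \<longrightarrow> \<phi> y = (\<Sum>b\<in>B. d b * \<phi> b)"
        using SE(1)[OF xy(1)] SE(1)[OF xy(2)] by (elim exE)
      show "x \<oplus> y \<in> S"
      proof (rule SI)
        fix \<phi> assume \<phi>: "lin \<phi>"
        show "\<phi> (x \<oplus> y) = (\<Sum>b\<in>B. (c b + d b) * \<phi> b)"
          unfolding lin_add[OF \<phi> SE(2)[OF xy(1)] SE(2)[OF xy(2)]] c[rule_format, OF \<phi>] d[rule_format, OF \<phi>]
          by (simp add: sum.distrib distrib_right)
      qed (use SE(2) xy in auto)
    next
      fix a x assume x: "x \<in> S"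
      obtain c where c: "\<forall>\<phi>. lin \<phi> \<longrightarrow> \<phi> x = (\<Sum>b\<in>B. c b * \<phi> b)"
        using SE(1)[OF x] by (elim exE)
      show "a \<odot> x \<in> S"
      proof (rule SI)
        fix \<phi> assume \<phi>: "lin \<phi>"
        show "\<phi> (a \<odot> x) = (\<Sum>b\<in>B. (a * c b) * \<phi> b)"
          unfolding lin_scale[OF \<phi> SE(2)[OF x]] c[rule_format, OF \<phi>]
          by (simp add: sum_distrib_left ac_simps)
      qed (use SE(2) x in auto)
    qed (auto simp: S_def)
  qed
  have "\<phi> y = (\<Sum>b\<in>B. \<kappa> b y * \<phi> b)" if \<phi>: "lin \<phi>" and y: "y \<in> carrier L" for \<phi> y
  proof -
    have "y \<in> S" using y \<open>subsp hull B \<subseteq> S\<close> B(3) by auto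
    obtain c where c: "\<forall>\<phi>. lin \<phi> \<longrightarrow> \<phi> y = (\<Sum>b\<in>B. c b * \<phi> b)"
      using SE(1)[OF \<open>y \<in> S\<close>] by (elim exE)
    have "\<kappa> b y = c b" if "b \<in> B" for b
    proof -
      have "\<kappa> b y = (\<Sum>b'\<in>B. c b' * \<kappa> b b')" using c[rule_format, OF \<kappa>(1)[OF that]] .
      also have "\<dots> = (\<Sum>b'\<in>B. if b' = b then c b' else 0)"
        using \<kappa>(2)[OF that] by (intro sum.cong) auto
      finally show ?thesis using that B by simp
    qed
    then show ?thesis using c[rule_format, OF \<phi>] by simp
  qed
  then show thesis using that B \<kappa> by blast
qed

section \<open>Linear operators and their exponentials\<close>

definition linop :: "('a \<Rightarrow> 'a) \<Rightarrow> bool" where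
  "linop D \<longleftrightarrow> (\<forall>x\<in>carrier L. D x \<in> carrier L) \<and>
    (\<forall>x\<in>carrier L. \<forall>y\<in>carrier L. D (x \<oplus> y) = D x \<oplus> D y) \<and>
    (\<forall>a. \<forall>x\<in>carrier L. D (a \<odot> x) = a \<odot> D x)"

lemma linopD:
  assumes "linop D"
  shows "x \<in> carrier L \<Longrightarrow> D x \<in> carrier L"
    and "x \<in> carrier L \<Longrightarrow> y \<in> carrier L \<Longrightarrow> D (x \<oplus> y) = D x \<oplus> D y"
    and "x \<in> carrier L \<Longrightarrow> D (a \<odot> x) = a \<odot> D x"
  using assms by (auto simp: linop_def)

lemma linop_funpow: "linop D \<Longrightarrow> linop (D ^^ n)"
  by (induction n) (auto simp: linop_def)

lemma linop_left_mult: "x \<in> carrier L \<Longrightarrow> linop (\<lambda>z. x \<otimes> z)"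
  by (simp add: linop_def mult_add_right mult_smult_right)

lemma lin_linop: "linop D \<Longrightarrow> lin \<phi> \<Longrightarrow> lin (\<lambda>x. \<phi> (D x))"
  by (simp add: linear_functional_def linop_def)

lemma lin_left_mult: "x \<in> carrier L \<Longrightarrow> lin \<phi> \<Longrightarrow> lin (\<lambda>z. \<phi> (x \<otimes> z))"
  by (rule lin_linop[OF linop_left_mult])

lemma lin_right_mult: "z \<in> carrier L \<Longrightarrow> lin \<phi> \<Longrightarrow> lin (\<lambda>x. \<phi> (x \<otimes> z))"
  by (simp add: linear_functional_def mult_add_left mult_smult_left)

text \<open>\<open>N\<close> is the l1 norm of the coordinates and \<open>C\<close> bounds
  \<open>D\<close> with respect to it, so iterates grow at most geometrically. \<open>C\<close>
  depends on \<open>D\<close> only, while \<open>K\<close> absorbs \<open>\<phi>\<close> and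
  \<open>y\<close>.\<close>

lemma linop_power_bound:
  assumes D: "linop D"
  obtains C where "\<And>\<phi> y. lin \<phi> \<Longrightarrow> y \<in> carrier L \<Longrightarrow> \<exists>K. \<forall>r. \<bar>\<phi> ((D ^^ r) y)\<bar> \<le> K * C ^ r"
proof -
  obtain B \<kappa> where B: "finite B" "B \<subseteq> carrier L" "\<And>b. b \<in> B \<Longrightarrow> lin (\<kappa> b)"
    and frame: "\<And>\<phi> y. lin \<phi> \<Longrightarrow> y \<in> carrier L \<Longrightarrow> \<phi> y = (\<Sum>b\<in>B. \<kappa> b y * \<phi> b)"
    using dual_basis by blast
  define N where "N y = (\<Sum>b\<in>B. \<bar>\<kappa> b y\<bar>)" for y
  define C where "C = (\<Sum>c\<in>B. \<Sum>b\<in>B. \<bar>\<kappa> c (D b)\<bar>)"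
  have C: "0 \<le> C" unfolding C_def by (intro sum_nonneg) auto
  have bound: "\<bar>\<phi> y\<bar> \<le> N y * (\<Sum>b\<in>B. \<bar>\<phi> b\<bar>)" if "lin \<phi>" "y \<in> carrier L" for \<phi> y
  proof -
    have "\<bar>\<phi> y\<bar> \<le> (\<Sum>b\<in>B. \<bar>\<kappa> b y\<bar> * \<bar>\<phi> b\<bar>)"
      unfolding frame[OF that] by (rule order_trans[OF sum_abs]) (simp add: abs_mult)
    also have "\<dots> \<le> (\<Sum>b\<in>B. N y * \<bar>\<phi> b\<bar>)"
      unfolding N_def using B by (intro sum_mono mult_right_mono member_le_sum) auto
    finally show ?thesis by (simp add: sum_distrib_left)
  qed
  have step: "N (D y) \<le> C * N y" if "y \<in> carrier L" for y
  proof -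
    have "N (D y) \<le> (\<Sum>c\<in>B. N y * (\<Sum>b\<in>B. \<bar>\<kappa> c (D b)\<bar>))"
      unfolding N_def[of "D y"] using bound[OF lin_linop[OF D B(3)] that] by (intro sum_mono) auto
    then show ?thesis by (simp add: C_def sum_distrib_left mult.commute)
  qed
  have pow: "N ((D ^^ r) y) \<le> C ^ r * N y" if "y \<in> carrier L" for r y
  proof (induction r)
    case (Suc r)
    have "N ((D ^^ Suc r) y) \<le> C * N ((D ^^ r) y)"
      using step[of "(D ^^ r) y"] linopD(1)[OF linop_funpow[OF D] that] by simp
    also have "\<dots> \<le> C * (C ^ r * N y)" using Suc C by (rule mult_left_mono)
    finally show ?case by (simp add: mult.assoc)
  qed simp
  have "\<bar>\<phi> ((D ^^ r) y)\<bar> \<le> N y * (\<Sum>b\<in>B. \<bar>\<phi> b\<bar>) * C ^ r" if "lin \<phi>" "y \<in> carrier L" for \<phi> y r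
  proof -
    have "\<bar>\<phi> ((D ^^ r) y)\<bar> \<le> N ((D ^^ r) y) * (\<Sum>b\<in>B. \<bar>\<phi> b\<bar>)"
      by (intro bound that linopD(1)[OF linop_funpow[OF D]])
    also have "\<dots> \<le> (C ^ r * N y) * (\<Sum>b\<in>B. \<bar>\<phi> b\<bar>)"
      by (intro mult_right_mono pow that sum_nonneg) auto
    finally show ?thesis by (simp add: mult_ac)
  qed
  then show thesis using that by blast
qed

lemma summable_exp_series:
  assumes "linop D" "lin \<phi>" "y \<in> carrier L"
  shows "summable (\<lambda>r. \<bar>\<phi> ((D ^^ r) y) / fact r\<bar>)"
proof -
  obtain C K where K: "\<And>r. \<bar>\<phi> ((D ^^ r) y)\<bar> \<le> K * C ^ r"
    using linop_power_bound[OF assms(1)] assms(2,3) by meson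
  have "summable (\<lambda>r. K * (inverse (fact r) * C ^ r))"
    by (intro summable_mult summable_exp)
  then show ?thesis
  proof (rule summable_comparison_test'[of _ 0])
    fix r show "norm \<bar>\<phi> ((D ^^ r) y) / fact r\<bar> \<le> K * (inverse (fact r) * C ^ r)"
      using divide_right_mono[OF K, of "fact r" r] by (simp add: abs_divide field_simps)
  qed
qed

definition exp_op :: "('a \<Rightarrow> 'a) \<Rightarrow> 'a \<Rightarrow> 'a" where
  "exp_op D y = (THE s. series_sums L (\<lambda>r. (1 / fact r) \<odot> ((D ^^ r) y)) s)"

lemma series_sums_unique: "series_sums L f s \<Longrightarrow> series_sums L f t \<Longrightarrow> s = t"
  unfolding series_sums_def by (blast intro: vec_eqI sums_unique2)

text \<open>The coordinate series converge by comparison with a real exponential. Their limits are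
  the coordinates of a vector \<open>s\<close>, and any functional is a finite combination of
  coordinates.\<close>

lemma exp_op_series_sums:
  assumes D: "linop D" and y: "y \<in> carrier L"
  shows "series_sums L (\<lambda>r. (1 / fact r) \<odot> ((D ^^ r) y)) (exp_op D y)"
proof -
  obtain B \<kappa> where B: "finite B" "B \<subseteq> carrier L" "\<And>b. b \<in> B \<Longrightarrow> lin (\<kappa> b)"
    and frame: "\<And>\<phi> y. lin \<phi> \<Longrightarrow> y \<in> carrier L \<Longrightarrow> \<phi> y = (\<Sum>b\<in>B. \<kappa> b y * \<phi> b)"
    using dual_basis by blast
  have Dy: "(D ^^ r) y \<in> carrier L" for r by (rule linopD(1)[OF linop_funpow[OF D] y])
  define c where "c b = suminf (\<lambda>r. \<kappa> b ((D ^^ r) y) / fact r)" for b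
  have c: "(\<lambda>r. \<kappa> b ((D ^^ r) y) / fact r) sums c b" if "b \<in> B" for b
    unfolding c_def
    by (rule summable_sums[OF summable_rabs_cancel[OF summable_exp_series[OF D B(3)[OF that] y]]])
  obtain s where s: "s \<in> carrier L" "\<And>\<phi>. lin \<phi> \<Longrightarrow> \<phi> s = (\<Sum>b\<in>B. c b * \<phi> b)"
    using vec_with_coordinates[OF B(1,2)] by blast
  have "series_sums L (\<lambda>r. (1 / fact r) \<odot> ((D ^^ r) y)) s"
    unfolding series_sums_def
  proof (intro conjI allI impI s(1))
    fix \<phi> assume \<phi>: "lin \<phi>"
    have "(\<lambda>r. \<Sum>b\<in>B. \<kappa> b ((D ^^ r) y) / fact r * \<phi> b) sums (\<Sum>b\<in>B. c b * \<phi> b)"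
      by (intro sums_sum sums_mult2 c)
    then show "(\<lambda>r. \<phi> ((1 / fact r) \<odot> ((D ^^ r) y))) sums \<phi> s"
      by (simp add: s(2)[OF \<phi>] lin_scale[OF \<phi> Dy] frame[OF \<phi> Dy] sum_divide_distrib)
  qed
  then show ?thesis unfolding exp_op_def
    by (rule theI) (rule series_sums_unique[OF _ \<open>series_sums L _ s\<close>])
qed

lemma exp_op_closed: "linop D \<Longrightarrow> y \<in> carrier L \<Longrightarrow> exp_op D y \<in> carrier L"
  using exp_op_series_sums by (auto simp: series_sums_def)

lemma exp_op_sums:
  assumes D: "linop D" and y: "y \<in> carrier L" and \<phi>: "lin \<phi>"
  shows "(\<lambda>r. \<phi> ((D ^^ r) y) / fact r) sums \<phi> (exp_op D y)"
  using exp_op_series_sums[OF D y] \<phi> linopD(1)[OF linop_funpow[OF D] y]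
  by (simp add: series_sums_def lin_scale)

lemma exp_op_linop: assumes D: "linop D" shows "linop (exp_op D)"
  unfolding linop_def
proof (intro conjI ballI allI)
  note cl = exp_op_closed[OF D] linopD(1)[OF linop_funpow[OF D]]
  fix x y assume xy: "x \<in> carrier L" "y \<in> carrier L"
  show "exp_op D (x \<oplus> y) = exp_op D x \<oplus> exp_op D y"
  proof (rule vec_eqI)
    fix \<phi> assume \<phi>: "lin \<phi>"
    have "(\<lambda>r. \<phi> ((D ^^ r) (x \<oplus> y)) / fact r) sums \<phi> (exp_op D x \<oplus> exp_op D y)"
      using sums_add[OF exp_op_sums[OF D xy(1) \<phi>] exp_op_sums[OF D xy(2) \<phi>]]
      by (simp add: linopD(2)[OF linop_funpow[OF D] xy] lin_add[OF \<phi>] cl xy add_divide_distrib)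
    then show "\<phi> (exp_op D (x \<oplus> y)) = \<phi> (exp_op D x \<oplus> exp_op D y)"
      using exp_op_sums[OF D _ \<phi>] xy sums_unique2 by blast
  qed (use xy cl in auto)
next
  note cl = exp_op_closed[OF D] linopD(1)[OF linop_funpow[OF D]]
  fix a x assume x: "x \<in> carrier L"
  show "exp_op D (a \<odot> x) = a \<odot> exp_op D x"
  proof (rule vec_eqI)
    fix \<phi> assume \<phi>: "lin \<phi>"
    have "(\<lambda>r. \<phi> ((D ^^ r) (a \<odot> x)) / fact r) sums \<phi> (a \<odot> exp_op D x)"
      using sums_mult[OF exp_op_sums[OF D x \<phi>], of a]
      by (simp add: linopD(3)[OF linop_funpow[OF D] x] lin_scale[OF \<phi>] cl x)
    then show "\<phi> (exp_op D (a \<odot> x)) = \<phi> (a \<odot> exp_op D x)"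
      using exp_op_sums[OF D _ \<phi>] x sums_unique2 by blast
  qed (use x cl in auto)
qed (use exp_op_closed[OF D] in auto)

text \<open>The general Leibniz rule: with divided powers \<open>D^n / n!\<close> the binomial
  coefficients disappear, which is the shape of a Cauchy product. Applying \<open>\<phi>\<close>
  keeps all sums in the reals.\<close>

lemma funpow_derivation:
  assumes D: "linop D"
    and der: "\<And>x y. x \<in> carrier L \<Longrightarrow> y \<in> carrier L \<Longrightarrow> D (x \<otimes> y) = D x \<otimes> y \<oplus> x \<otimes> D y"
    and \<phi>: "lin \<phi>"
  shows "x \<in> carrier L \<Longrightarrow> y \<in> carrier L \<Longrightarrow> \<phi> ((D ^^ n) (x \<otimes> y)) / fact n =
    (\<Sum>i\<le>n. \<phi> ((D ^^ i) x \<otimes> (D ^^ (n - i)) y) / (fact i * fact (n - i)))"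
proof (induction n arbitrary: x y)
  case 0
  then show ?case by simp
next
  case (Suc n)
  note cl = linopD(1)[OF D] linopD(1)[OF linop_funpow[OF D]]
  define F where "F i j = \<phi> ((D ^^ i) x \<otimes> (D ^^ j) y) / (fact i * fact j)" for i j
  have DS: "(D ^^ i) (D z) = (D ^^ Suc i) z" for i z by (simp add: funpow_swap1)
  have "(D ^^ Suc n) (x \<otimes> y) = (D ^^ n) (D x \<otimes> y) \<oplus> (D ^^ n) (x \<otimes> D y)"
    using Suc.prems der cl by (simp only: DS[symmetric]) (simp add: linopD(2)[OF linop_funpow[OF D]])
  then have "\<phi> ((D ^^ Suc n) (x \<otimes> y)) / fact n =
      \<phi> ((D ^^ n) (D x \<otimes> y)) / fact n + \<phi> ((D ^^ n) (x \<otimes> D y)) / fact n"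
    using Suc.prems cl \<phi> by (simp add: lin_add add_divide_distrib del: funpow.simps)
  also have "\<phi> ((D ^^ n) (D x \<otimes> y)) / fact n = (\<Sum>i\<le>n. real (Suc i) * F (Suc i) (n - i))"
    unfolding Suc.IH[OF cl(1)[OF Suc.prems(1)] Suc.prems(2)] DS F_def
    by (intro sum.cong refl) (rule Suc_mult_divide_fact(1)[symmetric])
  \<comment> \<open>The index shift adds the term \<open>i = 0\<close>, whose weight is zero. In the
    other sum the term \<open>i = Suc n\<close> is added below, again with weight zero.\<close>
  also have "\<dots> = (\<Sum>i\<le>Suc n. real i * F i (Suc n - i))"
    by (subst sum.atMost_Suc_shift) simp
  also have "\<phi> ((D ^^ n) (x \<otimes> D y)) / fact n = (\<Sum>i\<le>n. real (Suc n - i) * F i (Suc n - i))"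
    unfolding Suc.IH[OF Suc.prems(1) cl(1)[OF Suc.prems(2)]] DS F_def
  proof (intro sum.cong refl)
    fix i assume "i \<in> {..n}"
    then have "Suc n - i = Suc (n - i)" by (simp add: Suc_diff_le)
    then show "\<phi> ((D ^^ i) x \<otimes> (D ^^ Suc (n - i)) y) / (fact i * fact (n - i)) =
        real (Suc n - i) * (\<phi> ((D ^^ i) x \<otimes> (D ^^ (Suc n - i)) y) / (fact i * fact (Suc n - i)))"
      by (simp only: Suc_mult_divide_fact(2))
  qed
  also have "\<dots> = (\<Sum>i\<le>Suc n. real (Suc n - i) * F i (Suc n - i))"
    by simp
  \<comment> \<open>The weights \<open>i\<close> and \<open>Suc n - i\<close> add up to
    \<open>Suc n\<close>, the factor that separates \<open>fact n\<close> from
    \<open>fact (Suc n)\<close>.\<close>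
  also have "(\<Sum>i\<le>Suc n. real i * F i (Suc n - i)) + \<dots> = (\<Sum>i\<le>Suc n. real (Suc n) * F i (Suc n - i))"
    unfolding sum.distrib[symmetric]
    by (intro sum.cong) (simp_all add: of_nat_diff algebra_simps del: of_nat_Suc)
  finally have "\<phi> ((D ^^ Suc n) (x \<otimes> y)) / fact n = real (Suc n) * (\<Sum>i\<le>Suc n. F i (Suc n - i))"
    by (simp only: sum_distrib_left)
  then have "\<phi> ((D ^^ Suc n) (x \<otimes> y)) / fact n / real (Suc n) = (\<Sum>i\<le>Suc n. F i (Suc n - i))"
    by (simp del: funpow.simps sum.atMost_Suc of_nat_Suc)
  then have "\<phi> ((D ^^ Suc n) (x \<otimes> y)) / fact (Suc n) = (\<Sum>i\<le>Suc n. F i (Suc n - i))"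
    by (simp add: ac_simps del: funpow.simps sum.atMost_Suc of_nat_Suc)
  then show ?case unfolding F_def .
qed

text \<open>Expanding the left factor in a dual basis writes \<open>\<phi> (u v)\<close> as a finite
  sum of products of scalars. The diagonals of the resulting Cauchy products are the terms given by
  the Leibniz rule.\<close>

lemma exp_op_mult:
  assumes D: "linop D"
    and der: "\<And>x y. x \<in> carrier L \<Longrightarrow> y \<in> carrier L \<Longrightarrow> D (x \<otimes> y) = D x \<otimes> y \<oplus> x \<otimes> D y"
    and x: "x \<in> carrier L" and y: "y \<in> carrier L"
  shows "exp_op D (x \<otimes> y) = exp_op D x \<otimes> exp_op D y"
proof (rule vec_eqI)
  note cl = exp_op_closed[OF D] linopD(1)[OF linop_funpow[OF D]]
  fix \<phi> assume \<phi>: "lin \<phi>"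
  obtain B \<kappa> where B: "finite B" "B \<subseteq> carrier L" "\<And>b. b \<in> B \<Longrightarrow> lin (\<kappa> b)"
    and frame: "\<And>\<phi> y. lin \<phi> \<Longrightarrow> y \<in> carrier L \<Longrightarrow> \<phi> y = (\<Sum>b\<in>B. \<kappa> b y * \<phi> b)"
    using dual_basis by blast
  have prod: "\<phi> (u \<otimes> v) = (\<Sum>b\<in>B. \<kappa> b u * \<phi> (b \<otimes> v))" if "u \<in> carrier L" "v \<in> carrier L" for u v
    using frame[OF lin_right_mult[OF that(2) \<phi>] that(1)] .
  define f where "f b r = \<kappa> b ((D ^^ r) x) / fact r" for b r
  define g where "g b r = \<phi> (b \<otimes> (D ^^ r) y) / fact r" for b r
  have lb: "lin (\<lambda>z. \<phi> (b \<otimes> z))" if "b \<in> B" for b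
    using that B(2) lin_left_mult[OF _ \<phi>] by blast
  have f: "suminf (f b) = \<kappa> b (exp_op D x)" "summable (\<lambda>r. \<bar>f b r\<bar>)" if "b \<in> B" for b
    unfolding f_def[abs_def]
    using sums_unique[OF exp_op_sums[OF D x B(3)[OF that]]] summable_exp_series[OF D B(3)[OF that] x]
    by simp_all
  have g: "suminf (g b) = \<phi> (b \<otimes> exp_op D y)" "summable (\<lambda>r. \<bar>g b r\<bar>)" if "b \<in> B" for b
    unfolding g_def[abs_def]
    using sums_unique[OF exp_op_sums[OF D y lb[OF that]]] summable_exp_series[OF D lb[OF that] y]
    by simp_all
  have 1: "(\<Sum>b\<in>B. suminf (f b) * suminf (g b)) = \<phi> (exp_op D x \<otimes> exp_op D y)"
    using f g x y cl by (subst prod) auto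
  have 2: "(\<Sum>i\<le>n. \<Sum>b\<in>B. f b i * g b (n - i)) = \<phi> ((D ^^ n) (x \<otimes> y)) / fact n" for n
  proof -
    have "\<phi> ((D ^^ n) (x \<otimes> y)) / fact n =
        (\<Sum>i\<le>n. \<phi> ((D ^^ i) x \<otimes> (D ^^ (n - i)) y) / (fact i * fact (n - i)))"
      by (rule funpow_derivation[OF D _ \<phi> x y]) (rule der)
    then show ?thesis
      by (simp add: f_def g_def prod cl x y sum_divide_distrib)
  qed
  have "(\<lambda>n. \<phi> ((D ^^ n) (x \<otimes> y)) / fact n) sums \<phi> (exp_op D x \<otimes> exp_op D y)"
    using Cauchy_product_sum_sums[of B f g, OF f(2) g(2)] unfolding 1 2 by blast
  then show "\<phi> (exp_op D (x \<otimes> y)) = \<phi> (exp_op D x \<otimes> exp_op D y)"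
    using exp_op_sums[OF D _ \<phi>, of "x \<otimes> y"] x y sums_unique2 by blast
qed (use x y exp_op_closed[OF D] in auto)

text \<open>The \<open>n\<close>-th diagonal of the Cauchy product is \<open>D^n / n!\<close> times
  the alternating sum of the binomial coefficients, which vanishes for \<open>n > 0\<close>.\<close>

lemma exp_op_inverse:
  assumes D: "linop D" and E: "linop E" and ED: "\<And>z. z \<in> carrier L \<Longrightarrow> E z = \<ominus> D z"
    and y: "y \<in> carrier L"
  shows "exp_op E (exp_op D y) = y"
proof (rule vec_eqI)
  note cl = exp_op_closed[OF D] linopD(1)[OF linop_funpow[OF D]] linopD(1)[OF linop_funpow[OF E]]
    linopD(1)[OF D]
  fix \<phi> assume \<phi>: "lin \<phi>"
  obtain B \<kappa> where B: "finite B" "B \<subseteq> carrier L" "\<And>b. b \<in> B \<Longrightarrow> lin (\<kappa> b)"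
    and frame: "\<And>\<phi> y. lin \<phi> \<Longrightarrow> y \<in> carrier L \<Longrightarrow> \<phi> y = (\<Sum>b\<in>B. \<kappa> b y * \<phi> b)"
    using dual_basis by blast
  have E_pow: "(E ^^ i) z = (-1) ^ i \<odot> (D ^^ i) z" if "z \<in> carrier L" for i z
  proof (induction i)
    case (Suc i)
    have "(E ^^ Suc i) z = \<ominus> ((-1) ^ i \<odot> (D ^^ Suc i) z)"
      using that by (simp add: Suc ED cl linopD(3)[OF D])
    then show ?case using that by (simp add: cl neg_eq_scale scale_assoc)
  qed (use that in simp)
  define f where "f b r = \<phi> ((E ^^ r) b) / fact r" for b r
  define g where "g b r = \<kappa> b ((D ^^ r) y) / fact r" for b r
  have f: "suminf (f b) = \<phi> (exp_op E b)" "summable (\<lambda>r. \<bar>f b r\<bar>)" if "b \<in> B" for b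
    unfolding f_def[abs_def]
    using sums_unique[OF exp_op_sums[OF E _ \<phi>, of b]] summable_exp_series[OF E \<phi>, of b] B(2) that
    by auto
  have g: "suminf (g b) = \<kappa> b (exp_op D y)" "summable (\<lambda>r. \<bar>g b r\<bar>)" if "b \<in> B" for b
    unfolding g_def[abs_def]
    using sums_unique[OF exp_op_sums[OF D y B(3)[OF that]]] summable_exp_series[OF D B(3)[OF that] y]
    by simp_all
  have 1: "(\<Sum>b\<in>B. suminf (f b) * suminf (g b)) = \<phi> (exp_op E (exp_op D y))"
    unfolding frame[OF lin_linop[OF exp_op_linop[OF E] \<phi>] cl(1)[OF y]]
    using f g by (intro sum.cong) simp_all
  have 2: "(\<Sum>i\<le>n. \<Sum>b\<in>B. f b i * g b (n - i)) = (if n = 0 then \<phi> y else 0)" for n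
  proof -
    have "(\<Sum>b\<in>B. f b i * g b (n - i)) = \<phi> ((D ^^ n) y) / fact n * ((-1) ^ i * real (n choose i))"
      if "i \<le> n" for i
    proof -
      have "(\<Sum>b\<in>B. \<kappa> b ((D ^^ (n - i)) y) * \<phi> ((E ^^ i) b)) = \<phi> ((E ^^ i) ((D ^^ (n - i)) y))"
        using frame[OF lin_linop[OF linop_funpow[OF E] \<phi>] cl(2)[OF y]] by simp
      also have "(E ^^ i) ((D ^^ (n - i)) y) = (-1) ^ i \<odot> (D ^^ n) y"
        using that E_pow[OF cl(2)[OF y], of i "n - i"] funpow_add[of i "n - i" D] by simp
      finally have "(\<Sum>b\<in>B. \<kappa> b ((D ^^ (n - i)) y) * \<phi> ((E ^^ i) b)) = (-1) ^ i * \<phi> ((D ^^ n) y)"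
        using y by (simp add: lin_scale[OF \<phi>] cl)
      moreover have "(\<Sum>b\<in>B. f b i * g b (n - i)) =
          (\<Sum>b\<in>B. \<kappa> b ((D ^^ (n - i)) y) * \<phi> ((E ^^ i) b)) / (fact i * fact (n - i))"
        unfolding sum_divide_distrib f_def g_def by (intro sum.cong) simp_all
      ultimately show ?thesis using that by (simp add: binomial_fact)
    qed
    then have "(\<Sum>i\<le>n. \<Sum>b\<in>B. f b i * g b (n - i)) =
        \<phi> ((D ^^ n) y) / fact n * (\<Sum>i\<le>n. (-1) ^ i * real (n choose i))"
      by (simp add: sum_distrib_left)
    then show ?thesis
      using choose_alternating_sum[of n, where 'a = real] by auto
  qed
  have "(\<lambda>n. if n = 0 then \<phi> y else 0) sums \<phi> (exp_op E (exp_op D y))"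
    using Cauchy_product_sum_sums[of B f g, OF f(2) g(2)] unfolding 1 2 by blast
  then show "\<phi> (exp_op E (exp_op D y)) = \<phi> y"
    using sums_single[of 0 "\<lambda>_. \<phi> y"] sums_unique2 by blast
qed (use y exp_op_closed D E in auto)

lemma exp_op_in_subsp:
  assumes J: "subsp J" and D: "linop D" and y: "y \<in> carrier L" and "\<And>r. (D ^^ r) y \<in> J"
  shows "exp_op D y \<in> J"
proof (rule in_subspI[OF J exp_op_closed[OF D y]])
  fix \<phi> assume "lin \<phi>" "\<And>z. z \<in> J \<Longrightarrow> \<phi> z = 0"
  then show "\<phi> (exp_op D y) = 0"
    using exp_op_sums[OF D y, of \<phi>] assms(4) sums_unique2[OF _ sums_zero] by simp
qed

text \<open>A functional vanishing on \<open>J\<close> sees only the terms \<open>r = 0\<close> and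
  \<open>r = 1\<close> of the series.\<close>

lemma exp_op_first_order:
  assumes J: "subsp J" and D: "linop D" and y: "y \<in> carrier L" and DJ: "\<And>r. (D ^^ (r + 2)) y \<in> J"
  shows "exp_op D y \<ominus> (y \<oplus> D y) \<in> J"
proof (rule in_subspI[OF J])
  note cl = exp_op_closed[OF D y] linopD(1)[OF D y]
  show "exp_op D y \<ominus> (y \<oplus> D y) \<in> carrier L" using y cl by simp
  fix \<phi> assume \<phi>: "lin \<phi>" "\<And>z. z \<in> J \<Longrightarrow> \<phi> z = 0"
  have "\<phi> ((D ^^ r) y) / fact r = 0" if "r \<notin> {..<2}" for r
  proof -
    have "r = (r - 2) + 2" using that by simp
    then show ?thesis using \<phi>(2)[OF DJ[of "r - 2"]] by simp
  qed
  then have "(\<lambda>r. \<phi> ((D ^^ r) y) / fact r) sums (\<Sum>r<2. \<phi> ((D ^^ r) y) / fact r)"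
    by (intro sums_finite) auto
  then have "\<phi> (exp_op D y) = (\<Sum>r<2. \<phi> ((D ^^ r) y) / fact r)"
    using exp_op_sums[OF D y \<phi>(1)] sums_unique2 by blast
  then show "\<phi> (exp_op D y \<ominus> (y \<oplus> D y)) = 0"
    using y cl \<phi>(1) by (simp add: lin_simps numeral_2_eq_2)
qed


section \<open>Nilpotent actions and Cartan subalgebras\<close>

lemma mult_zero [simp]:
  "x \<in> carrier L \<Longrightarrow> x \<otimes> \<zero> = \<zero>" "x \<in> carrier L \<Longrightarrow> \<zero> \<otimes> x = \<zero>"
  using mult_smult_right[of x \<zero> 0] mult_smult_left[of \<zero> x 0] by simp_all

lemma mult_diff_right:
  "\<lbrakk>x \<in> carrier L; y \<in> carrier L; z \<in> carrier L\<rbrakk> \<Longrightarrow> x \<otimes> (y \<ominus> z) = x \<otimes> y \<ominus> x \<otimes> z"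
  by (simp add: a_minus_def neg_eq_scale mult_add_right mult_smult_right)

lemma mult_diff_left:
  "\<lbrakk>x \<in> carrier L; y \<in> carrier L; z \<in> carrier L\<rbrakk> \<Longrightarrow> (x \<ominus> y) \<otimes> z = x \<otimes> z \<ominus> y \<otimes> z"
  by (simp add: a_minus_def neg_eq_scale mult_add_left mult_smult_left)

lemma diff_add_cancel: "x \<in> carrier L \<Longrightarrow> y \<in> carrier L \<Longrightarrow> (x \<ominus> y) \<oplus> y = x"
  by (simp add: a_minus_def M.a_assoc M.l_neg)

lemma subsp_diff_iff:
  assumes "subsp W" "y \<in> W" "x \<in> carrier L"
  shows "x \<ominus> y \<in> W \<longleftrightarrow> x \<in> W"
  using assms subsp_add[OF assms(1), of "x \<ominus> y" y] subsp_diff diff_add_cancel subsp_in_carrier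
  by metis

definition stable :: "'a set \<Rightarrow> 'a set \<Rightarrow> bool" where
  "stable A W \<longleftrightarrow> (\<forall>a\<in>A. \<forall>w\<in>W. a \<otimes> w \<in> W)"

lemma stableD: "stable A W \<Longrightarrow> a \<in> A \<Longrightarrow> w \<in> W \<Longrightarrow> a \<otimes> w \<in> W"
  by (simp add: stable_def)

lemma stable_Int: "stable A V \<Longrightarrow> stable A W \<Longrightarrow> stable A (V \<inter> W)"
  by (simp add: stable_def)

lemma stable_subset: "stable A V \<Longrightarrow> B \<subseteq> A \<Longrightarrow> stable B V"
  by (auto simp: stable_def)

lemma stable_carrier: "A \<subseteq> carrier L \<Longrightarrow> stable A (carrier L)"
  by (auto simp: stable_def)

lemma stable_set_add:
  assumes "A \<subseteq> carrier L" "V \<subseteq> carrier L" "W \<subseteq> carrier L" "stable A V" "stable A W"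
  shows "stable A (V <+>\<^bsub>L\<^esub> W)"
  unfolding stable_def
proof (intro ballI)
  fix a z assume "a \<in> A" "z \<in> V <+>\<^bsub>L\<^esub> W"
  then obtain v w where "v \<in> V" "w \<in> W" "z = v \<oplus> w" by (auto elim: set_addE)
  then have "a \<otimes> z = a \<otimes> v \<oplus> a \<otimes> w" using assms \<open>a \<in> A\<close> by (intro trans[OF _ mult_add_right]) auto
  then show "a \<otimes> z \<in> V <+>\<^bsub>L\<^esub> W"
    using assms \<open>a \<in> A\<close> \<open>v \<in> V\<close> \<open>w \<in> W\<close> by (simp add: set_addI stableD)
qed

section \<open>Iterated left multiplications and the Fitting argument\<close>

definition lpow :: "'a \<Rightarrow> nat \<Rightarrow> 'a \<Rightarrow> 'a" where "lpow h n = (\<lambda>z. h \<otimes> z) ^^ n"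

lemma lpow_0 [simp]: "lpow h 0 x = x" by (simp add: lpow_def)

lemma lpow_Suc: "lpow h (Suc n) x = h \<otimes> lpow h n x" by (simp add: lpow_def)

lemma lpow_Suc2: "lpow h (Suc n) x = lpow h n (h \<otimes> x)" by (simp add: lpow_def funpow_swap1)

lemma lpow_add: "lpow h (m + n) x = lpow h m (lpow h n x)" by (simp add: lpow_def funpow_add)

lemma lpow_linop: "h \<in> carrier L \<Longrightarrow> linop (lpow h n)"
  unfolding lpow_def by (intro linop_funpow linop_left_mult)

lemma lpow_closed [simp]: "h \<in> carrier L \<Longrightarrow> x \<in> carrier L \<Longrightarrow> lpow h n x \<in> carrier L"
  using linopD(1)[OF lpow_linop] .

lemma lpow_diff:
  "\<lbrakk>h \<in> carrier L; x \<in> carrier L; y \<in> carrier L\<rbrakk> \<Longrightarrow> lpow h n (x \<ominus> y) = lpow h n x \<ominus> lpow h n y"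
  using linopD[OF lpow_linop] by (simp add: a_minus_def neg_eq_scale)

lemma lpow_stable: "stable A W \<Longrightarrow> h \<in> A \<Longrightarrow> x \<in> W \<Longrightarrow> lpow h n x \<in> W"
  by (induction n) (auto simp: lpow_Suc stableD)

lemma lpow_mono: "stable A J \<Longrightarrow> h \<in> A \<Longrightarrow> lpow h m x \<in> J \<Longrightarrow> m \<le> n \<Longrightarrow> lpow h n x \<in> J"
  using lpow_stable[of A J h "lpow h m x" "n - m"] by (simp flip: lpow_add)

text \<open>Since left multiplication by \<open>h\<close> is a derivation, \<open>h\<^sup>p\<^sup>+\<^sup>q (x y)\<close> is a combination of products
  \<open>(h\<^sup>i x) (h\<^sup>j y)\<close> with \<open>i \<ge> p\<close> or \<open>j \<ge> q\<close>.\<close>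

lemma lpow_mult:
  assumes h: "h \<in> carrier L" and J: "subsp J" "stable {h} J"
    and A: "A \<subseteq> carrier L" "stable {h} A" and B: "B \<subseteq> carrier L" "stable {h} B"
    and SB: "\<And>s y. s \<in> S \<Longrightarrow> y \<in> B \<Longrightarrow> s \<otimes> y \<in> J" and AT: "\<And>x t. x \<in> A \<Longrightarrow> t \<in> T \<Longrightarrow> x \<otimes> t \<in> J"
    and "x \<in> A" "y \<in> B" "lpow h p x \<in> S" "lpow h q y \<in> T"
  shows "lpow h (p + q) (x \<otimes> y) \<in> J"
proof -
  have "lpow h n (x \<otimes> y) \<in> J" if "n = p + q" "x \<in> A" "y \<in> B" "lpow h p x \<in> S" "lpow h q y \<in> T" for n p q x y
    using that
  proof (induction n arbitrary: p q x y)
    case 0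
    then show ?case using SB by simp
  next
    case (Suc n)
    show ?case
    proof (cases "p = 0 \<or> q = 0")
      case True
      then have "x \<otimes> y \<in> J" using Suc.prems SB AT by auto
      then show ?thesis using J(2) by (intro lpow_stable) auto
    next
      case False
      then obtain p' q' where pq: "p = Suc p'" "q = Suc q'" by (meson not0_implies_Suc)
      have xy: "x \<in> carrier L" "y \<in> carrier L" using Suc.prems A B by auto
      have hx: "h \<otimes> x \<in> A" "h \<otimes> y \<in> B" using Suc.prems A B by (auto intro: stableD)
      have "lpow h n ((h \<otimes> x) \<otimes> y) \<in> J"
        using Suc.prems pq hx by (intro Suc.IH[of p' q]) (auto simp: lpow_Suc2)
      moreover have "lpow h n (x \<otimes> (h \<otimes> y)) \<in> J"
        using Suc.prems pq hx by (intro Suc.IH[of p q']) (auto simp: lpow_Suc2)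
      moreover have "lpow h (Suc n) (x \<otimes> y) = lpow h n ((h \<otimes> x) \<otimes> y) \<oplus> lpow h n (x \<otimes> (h \<otimes> y))"
        unfolding lpow_Suc2 left_leibniz[OF h xy] using h xy
        by (intro linopD(2)[OF lpow_linop[OF h]] mult_closed)
      ultimately show ?thesis using J(1) by (simp add: subsp_add)
    qed
  qed
  then show ?thesis using assms by blast
qed

lemma subsp_image: assumes D: "linop D" and W: "subsp W" shows "subsp (D ` W)"
proof (rule subspI)
  note WC = subsp_in_carrier[OF W]
  show "D ` W \<subseteq> carrier L" using linopD(1)[OF D] WC by auto
  have "D \<zero> = \<zero>" using linopD(3)[OF D, of \<zero> 0] linopD(1)[OF D, of \<zero>] by simp
  then show "\<zero> \<in> D ` W" using subsp_zero[OF W] by force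
  show "x \<oplus> y \<in> D ` W" if xy: "x \<in> D ` W" "y \<in> D ` W" for x y
  proof -
    obtain u v where "u \<in> W" "v \<in> W" "x = D u" "y = D v" using xy by blast
    then show ?thesis using linopD(2)[OF D, of u v] WC subsp_add[OF W, of u v] by (metis imageI)
  qed
  show "a \<odot> x \<in> D ` W" if x: "x \<in> D ` W" for a x
  proof -
    obtain u where "u \<in> W" "x = D u" using x by blast
    then show ?thesis using linopD(3)[OF D, of u a] WC subsp_scale[OF W, of u a] by (metis imageI)
  qed
qed

text \<open>The images \<open>h\<^sup>k W\<close> stabilise.\<close>

lemma fitting:
  assumes h: "h \<in> carrier L" and W: "subsp W" "stable {h} W" and x: "x \<in> carrier L" "lpow h n x \<in> W"
  obtains w m where "w \<in> W" "lpow h m (x \<ominus> w) = \<zero>"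
proof -
  have img: "subsp (lpow h k ` W)" for k by (intro subsp_image lpow_linop h W)
  obtain U where "\<exists>k. U = lpow h k ` W" and min: "\<And>V. \<exists>k. V = lpow h k ` W \<Longrightarrow> V \<subseteq> U \<Longrightarrow> V = U"
    using minimal_subsp[of "\<lambda>U. \<exists>k. U = lpow h k ` W" "lpow h 0 ` W"] img by blast
  then obtain k where k: "U = lpow h k ` W" by blast
  have "lpow h (k + n) ` W \<subseteq> U"
    unfolding k lpow_add using lpow_stable[OF W(2)] by auto
  \<comment> \<open>By minimality \<open>h^(k+n) W\<close> is already all of \<open>h^k W\<close>,
    which contains \<open>h^(k+n) x\<close>. So \<open>x\<close> and some \<open>w\<close> in
    \<open>W\<close> agree under \<open>h^(k+n)\<close>.\<close>
  then have eq: "lpow h (k + n) ` W = U" using min by blast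
  have "lpow h (k + n) x \<in> U" using x k by (simp add: lpow_add)
  then obtain w where w: "w \<in> W" "lpow h (k + n) x = lpow h (k + n) w" unfolding eq[symmetric] by blast
  then have "lpow h (k + n) (x \<ominus> w) = \<zero>"
    using h x subsp_in_carrier[OF W(1) w(1)] by (simp add: lpow_diff) (simp add: M.r_neg a_minus_def)
  then show thesis using that w by blast
qed

section \<open>Nilpotent subalgebras and Engel-type arguments\<close>

abbreviation lcs :: "'a set \<Rightarrow> nat \<Rightarrow> 'a set" where "lcs \<equiv> lower_central_series L"
abbreviation subalg :: "'a set \<Rightarrow> bool" where "subalg \<equiv> subalgebra_of L"
abbreviation cartan :: "'a set \<Rightarrow> bool" where "cartan \<equiv> cartan_subalgebra L"

lemma subalgD:
  assumes "subalg U"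
  shows "subsp U" "stable U U" "U \<subseteq> carrier L" "x \<in> U \<Longrightarrow> y \<in> U \<Longrightarrow> x \<otimes> y \<in> U" "x \<in> U \<Longrightarrow> x \<in> carrier L"
  using assms subsp_carrier by (auto simp: subalgebra_of_def stable_def)

lemma product_space_subsp: "U \<subseteq> carrier L \<Longrightarrow> V \<subseteq> carrier L \<Longrightarrow> subsp (product_space L U V)"
  unfolding product_space_def by (rule subsp_hull) auto

lemma product_spaceI: "u \<in> U \<Longrightarrow> v \<in> V \<Longrightarrow> u \<otimes> v \<in> product_space L U V"
  unfolding product_space_def by (rule hull_inc) auto

lemma product_space_least:
  "subsp W \<Longrightarrow> (\<And>u v. u \<in> U \<Longrightarrow> v \<in> V \<Longrightarrow> u \<otimes> v \<in> W) \<Longrightarrow> product_space L U V \<subseteq> W"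
  unfolding product_space_def by (rule hull_minimal) auto

lemma lcs_subsp: "subsp U \<Longrightarrow> subsp (lcs U n)"
  by (induction n) (simp_all add: product_space_subsp subsp_carrier)

lemma lcs_mult: "u \<in> U \<Longrightarrow> v \<in> lcs U n \<Longrightarrow> u \<otimes> v \<in> lcs U (Suc n)"
  by (simp add: product_spaceI)

lemma lcs_least:
  assumes "U \<subseteq> F 0" "\<And>n. subsp (F n)" "\<And>n u v. u \<in> U \<Longrightarrow> v \<in> F n \<Longrightarrow> u \<otimes> v \<in> F (Suc n)"
  shows "lcs U n \<subseteq> F n"
proof (induction n)
  case (Suc n)
  have "product_space L U (lcs U n) \<subseteq> F (Suc n)"
    using Suc assms(3) by (intro product_space_least assms(2)) blast
  then show ?case by simp
qed (use assms in simp)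

lemma lcs_subset: "subalg U \<Longrightarrow> lcs U n \<subseteq> U"
  using lcs_least[of U "\<lambda>_. U" n] subalgD by auto

lemma lpow_in_lcs: "h \<in> U \<Longrightarrow> x \<in> U \<Longrightarrow> lpow h n x \<in> lcs U n"
  by (induction n) (auto simp: lpow_Suc product_spaceI)

lemma nilpotent_inI: "subsp U \<Longrightarrow> lcs U n \<subseteq> {\<zero>} \<Longrightarrow> nilpotent_in L U"
  unfolding nilpotent_in_def using subsp_zero[OF lcs_subsp] by blast

lemma nilpotent_lpow:
  assumes "nilpotent_in L H"
  obtains n where "\<And>h x. h \<in> H \<Longrightarrow> x \<in> H \<Longrightarrow> lpow h n x = \<zero>"
  using assms lpow_in_lcs unfolding nilpotent_in_def by fast

text \<open>Nilpotency of \<open>H\<close> kills \<open>k\<close> by a power of \<open>h\<close>,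
  another power kills \<open>v\<close>, and the Leibniz rule combines the two exponents.\<close>

lemma nil_space_stable:
  assumes H: "subalg H" "nilpotent_in L H" and hk: "h \<in> H" "k \<in> H"
    and v: "v \<in> carrier L" "lpow h q v = \<zero>"
  shows "\<exists>m. lpow h m (k \<otimes> v) = \<zero>"
proof -
  obtain p where p: "\<And>h x. h \<in> H \<Longrightarrow> x \<in> H \<Longrightarrow> lpow h p x = \<zero>"
    using nilpotent_lpow[OF H(2)] by blast
  have "lpow h (p + q) (k \<otimes> v) \<in> {\<zero>}"
    by (rule lpow_mult[of h _ H "carrier L" "{\<zero>}" "{\<zero>}"])
      (use hk v p subalgD[OF H(1)] in \<open>auto simp: subsp_zero_set stable_def\<close>)
  then show ?thesis by blast
qed

lemma nil_space_subsp:
  assumes "H \<subseteq> carrier L"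
  shows "subsp {v \<in> carrier L. \<forall>h\<in>H. \<exists>n. lpow h n v = \<zero>}" (is "subsp ?N")
proof (rule subspI)
  have lpz: "lpow h n \<zero> = \<zero>" if "h \<in> H" for h n
    using that assms by (induction n) (auto simp: lpow_Suc)
  show "\<zero> \<in> ?N" by (auto simp: lpz)
  show "x \<oplus> y \<in> ?N" if xy: "x \<in> ?N" "y \<in> ?N" for x y
  proof -
    have "\<exists>n. lpow h n (x \<oplus> y) = \<zero>" if h: "h \<in> H" for h
    proof -
      obtain m n where "lpow h m x = \<zero>" "lpow h n y = \<zero>" using xy h by blast
      then have "lpow h (m + n) y = \<zero>" "lpow h (n + m) x = \<zero>"
        using h by (simp_all add: lpow_add lpz)
      then have "lpow h (m + n) (x \<oplus> y) = \<zero>"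
        using xy h assms linopD(2)[OF lpow_linop, of h x y] by (auto simp: add.commute)
      then show ?thesis by blast
    qed
    then show ?thesis using xy by auto
  qed
  show "a \<odot> x \<in> ?N" if "x \<in> ?N" for a x
  proof -
    have "\<exists>n. lpow h n (a \<odot> x) = \<zero>" if h: "h \<in> H" for h
    proof -
      obtain n where "lpow h n x = \<zero>" using \<open>x \<in> ?N\<close> h by blast
      then have "lpow h n (a \<odot> x) = \<zero>"
        using \<open>x \<in> ?N\<close> h assms linopD(3)[OF lpow_linop, of h x n a] by auto
      then show ?thesis by blast
    qed
    then show ?thesis using \<open>x \<in> ?N\<close> by auto
  qed
qed auto

text \<open>A simultaneous Fitting decomposition for the whole of \<open>H\<close>, in the only form
  required: a vector that \<open>H\<close> sends into \<open>W\<close> can be corrected by an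
  element of \<open>W\<close> so that every \<open>h\<close> is nilpotent on it. Elements that act
  non-nilpotently are treated one at a time, each passing to its null space, where the rank is
  smaller.\<close>

lemma nil_complement:
  assumes H: "subalg H" "nilpotent_in L H"
  shows "\<lbrakk>subsp V; stable H V; subsp W; stable H W; W \<subseteq> V; x \<in> V; \<And>h. h \<in> H \<Longrightarrow> h \<otimes> x \<in> W\<rbrakk> \<Longrightarrow>
    \<exists>w\<in>W. \<forall>h\<in>H. \<exists>n. lpow h n (x \<ominus> w) = \<zero>"
proof (induction "rank V" arbitrary: V W x rule: less_induct)
  case less
  note V = less.prems(1,2) and W = less.prems(3,4,5) and x = less.prems(6,7)
  note Hc = subalgD(3,5)[OF H(1)]
  show ?case
  proof (cases "\<forall>h\<in>H. \<forall>v\<in>V. \<exists>n. lpow h n v = \<zero>")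
    case True
    moreover have "x \<ominus> \<zero> = x" using subsp_in_carrier[OF V(1) x(1)] by (simp add: a_minus_def)
    ultimately show ?thesis using x(1) subsp_zero[OF W(1)] by (intro bexI[of _ \<zero>]) auto
  next
    case False
    then obtain h v where h: "h \<in> H" and v: "v \<in> V" "\<And>n. lpow h n v \<noteq> \<zero>" by blast
    \<comment> \<open>The Fitting null space of the single element \<open>h\<close>, phrased over
      \<open>{h}\<close> so that \<open>nil_space_subsp\<close> applies. It is stable under all of
      \<open>H\<close> because \<open>H\<close> is nilpotent.\<close>
    define N where "N = {v \<in> carrier L. \<forall>h'\<in>{h}. \<exists>n. lpow h' n v = \<zero>}"
    have N: "subsp N" unfolding N_def using h Hc by (intro nil_space_subsp) auto
    have stN: "stable H N"
      using nil_space_stable[OF H h] Hc by (auto simp: stable_def N_def)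
    have "V \<inter> N \<subset> V" using v by (auto simp: N_def)
    then have rk: "rank (V \<inter> N) < rank V" by (intro rank_less subsp_Int V N)
    have xc: "x \<in> carrier L" using subsp_in_carrier[OF V(1) x(1)] .
    have "lpow h 1 x \<in> W" using x(2)[OF h] by (simp add: lpow_Suc)
    \<comment> \<open>Since \<open>h x\<close> is in \<open>W\<close>, the Fitting argument with
      exponent 1 moves \<open>x\<close> into the null space of \<open>h\<close> by an element of
      \<open>W\<close>.\<close>
    then obtain w m where w: "w \<in> W" "lpow h m (x \<ominus> w) = \<zero>"
      using fitting[of h W x 1] h Hc W xc stable_subset[OF W(2), of "{h}"] by blast
    have wc: "w \<in> carrier L" using subsp_in_carrier[OF W(1) w(1)] .
    have y: "x \<ominus> w \<in> V \<inter> N"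
      using w W x V xc wc by (auto simp: N_def intro!: subsp_diff)
    have "k \<otimes> (x \<ominus> w) \<in> W \<inter> N" if "k \<in> H" for k
    proof
      show "k \<otimes> (x \<ominus> w) \<in> W"
        using that x(2)[OF that] w W Hc xc wc stableD[OF W(2) that w(1)]
        by (simp add: mult_diff_right subsp_diff)
      show "k \<otimes> (x \<ominus> w) \<in> N" using stableD[OF stN that] y by blast
    qed
    then obtain w' where w': "w' \<in> W \<inter> N" "\<forall>h\<in>H. \<exists>n. lpow h n (x \<ominus> w \<ominus> w') = \<zero>"
      using less.hyps[OF rk, of "W \<inter> N" "x \<ominus> w"] V W N stN y by (auto simp: subsp_Int stable_Int)
    have "w' \<in> carrier L" using w' subsp_in_carrier[OF W(1)] by blast
    then have "x \<ominus> w \<ominus> w' = x \<ominus> (w \<oplus> w')"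
      using xc wc by (simp add: a_minus_def M.minus_add M.a_assoc)
    then show ?thesis using w w' subsp_add[OF W(1)] by auto
  qed
qed

text \<open>Engel's theorem on an irreducible factor \<open>W/J\<close>, by descent along the lower
  central series of \<open>M\<close>. If the term \<open>n + 1\<close> maps \<open>W\<close> into
  \<open>J\<close>, then each \<open>s\<close> in the term \<open>n\<close> has an
  \<open>M\<close>-stable kernel \<open>K\<close> on \<open>W/J\<close>, nonzero by nilpotency of
  \<open>s\<close>, hence everything. The descent ends at \<open>lcs M 0 = M\<close>.\<close>

lemma irreducible_nil_action:
  assumes M: "subalg M" and W: "subsp W" and J: "subsp J" "J \<subseteq> W" "stable M J"
    and min: "\<And>K. \<lbrakk>subsp K; J \<subseteq> K; K \<subseteq> W; stable M K\<rbrakk> \<Longrightarrow> K = J \<or> K = W"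
    and stW: "stable M W"
    and nil: "\<And>m w. m \<in> M \<Longrightarrow> w \<in> W \<Longrightarrow> \<exists>k. lpow m k w \<in> J"
  shows "(\<And>s w. s \<in> lcs M n \<Longrightarrow> w \<in> W \<Longrightarrow> s \<otimes> w \<in> J) \<Longrightarrow> m \<in> M \<Longrightarrow> w \<in> W \<Longrightarrow> m \<otimes> w \<in> J"
proof (induction n)
  case 0
  then show ?case by simp
next
  case (Suc n)
  note Mc = subalgD(3,5)[OF M] and Wc = subsp_in_carrier[OF W]
  have "s \<otimes> w \<in> J" if s: "s \<in> lcs M n" and "w \<in> W" for s w
  proof -
    have sM: "s \<in> M" using s lcs_subset[OF M] by blast
    define K where "K = {w \<in> W. s \<otimes> w \<in> J}"
    have "subsp K"
    proof (rule subspI)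
      show "K \<subseteq> carrier L" using subsp_carrier[OF W] by (auto simp: K_def)
      show "\<zero> \<in> K" using sM Mc by (simp add: K_def subsp_zero W J)
      show "x \<oplus> y \<in> K" if "x \<in> K" "y \<in> K" for x y
        using that sM Mc Wc W J by (auto simp: K_def mult_add_right subsp_add)
      show "a \<odot> x \<in> K" if "x \<in> K" for a x
        using that sM Mc Wc W J by (auto simp: K_def mult_smult_right subsp_scale)
    qed
    moreover have "J \<subseteq> K" using J sM by (auto simp: K_def stable_def)
    \<comment> \<open>\<open>s (m v) = m (s v) - (m s) v\<close>, and \<open>m s\<close> lies in the
      next term of the series, which already maps \<open>W\<close> into \<open>J\<close>.\<close>
    moreover have "stable M K" unfolding stable_def
    proof (intro ballI)
      fix m v assume m: "m \<in> M" and v: "v \<in> K"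
      have c: "m \<in> carrier L" "v \<in> carrier L" "s \<in> carrier L" using m v sM Mc Wc by (auto simp: K_def)
      have "(m \<otimes> s) \<otimes> v \<in> J" using Suc.prems(1) lcs_mult[OF m s] v by (auto simp: K_def)
      moreover have "m \<otimes> (s \<otimes> v) \<in> J" using v m J by (auto simp: K_def stable_def)
      ultimately have "s \<otimes> (m \<otimes> v) \<in> J"
        using left_leibniz[OF c(1,3,2)] subsp_add_cancel_left[OF J(1), of "(m \<otimes> s) \<otimes> v" "s \<otimes> (m \<otimes> v)"] c
        by simp
      then show "m \<otimes> v \<in> K" using v m stW by (auto simp: K_def stable_def)
    qed
    moreover have "K \<noteq> J" if "J \<noteq> W"
    proof -
      obtain w where w: "w \<in> W" "w \<notin> J" using \<open>J \<noteq> W\<close> J by blast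
      \<comment> \<open>The last power of \<open>s\<close> that keeps \<open>w\<close> outside
        \<open>J\<close> gives an element of \<open>K\<close> outside \<open>J\<close>.\<close>
      define k where "k = (LEAST k. lpow s k w \<in> J)"
      have k: "lpow s k w \<in> J" unfolding k_def using nil[OF sM w(1)] by (rule LeastI_ex)
      then obtain j where j: "k = Suc j" using w by (cases k) auto
      then have "lpow s j w \<notin> J" using not_less_Least[of j "\<lambda>k. lpow s k w \<in> J"] by (auto simp: k_def)
      moreover have "lpow s j w \<in> K"
        using k j lpow_stable[OF stW sM w(1)] by (simp add: K_def lpow_Suc)
      ultimately show ?thesis by blast
    qed
    ultimately have "K = W" using min[of K] unfolding K_def by blast
    then show ?thesis using \<open>w \<in> W\<close> by (auto simp: K_def)
  qed
  then show ?case using Suc.IH Suc.prems by blast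
qed

text \<open>A minimal stable \<open>W\<close> strictly above \<open>J\<close> makes
  \<open>W/J\<close> irreducible. The descent starts where the lower central series of
  \<open>H\<close> vanishes, and then every element of \<open>W\<close> outside \<open>J\<close>
  works.\<close>

lemma engel_nilpotent:
  assumes H: "subalg H" "nilpotent_in L H" and U: "subsp U" "stable H U"
    and J: "subsp J" "stable H J" "J \<subset> U"
    and nil: "\<And>h u. h \<in> H \<Longrightarrow> u \<in> U \<Longrightarrow> \<exists>k. lpow h k u \<in> J"
  obtains x where "x \<in> U" "x \<notin> J" "\<And>h. h \<in> H \<Longrightarrow> h \<otimes> x \<in> J"
proof -
  define P where "P W \<longleftrightarrow> subsp W \<and> stable H W \<and> J \<subset> W \<and> W \<subseteq> U" for W
  obtain W where W: "P W" and min: "\<And>V. P V \<Longrightarrow> V \<subseteq> W \<Longrightarrow> V = W"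
    using minimal_subsp[of P U] U J by (auto simp: P_def)
  obtain n where n: "lcs H n = {\<zero>}" using H(2) by (auto simp: nilpotent_in_def)
  have "h \<otimes> w \<in> J" if "h \<in> H" "w \<in> W" for h w
  proof (rule irreducible_nil_action[of H W J n])
    show "K = J \<or> K = W" if "subsp K" "J \<subseteq> K" "K \<subseteq> W" "stable H K" for K
      using min[of K] W that unfolding P_def by blast
    show "s \<otimes> w \<in> J" if "s \<in> lcs H n" "w \<in> W" for s w
      using that n W subsp_zero[OF J(1)] subsp_in_carrier[of W] by (auto simp: P_def)
    show "\<exists>k. lpow m k w \<in> J" if "m \<in> H" "w \<in> W" for m w
      using that nil W by (auto simp: P_def)
  qed (use H J W that in \<open>auto simp: P_def\<close>)
  then show thesis using W that unfolding P_def by blast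
qed

section \<open>The left centre and the nil criterion for Cartan subalgebras\<close>

definition lcentre :: "'a set" where
  "lcentre = {z \<in> carrier L. \<forall>x\<in>carrier L. z \<otimes> x = \<zero>}"

lemma lcentre_subsp: "subsp lcentre"
  by (rule subspI) (auto simp: lcentre_def mult_add_left mult_smult_left)

lemma lcentre_stable: "stable (carrier L) lcentre"
  unfolding stable_def
proof (intro ballI)
  fix x z assume x: "x \<in> carrier L" and z: "z \<in> lcentre"
  have zc: "z \<in> carrier L" using z by (simp add: lcentre_def)
  have "(x \<otimes> z) \<otimes> w = \<zero>" if w: "w \<in> carrier L" for w
    using left_leibniz[OF x zc w] z x w zc by (simp add: lcentre_def)
  then show "x \<otimes> z \<in> lcentre" using x zc by (simp add: lcentre_def)
qed

text \<open>Expanding \<open>x (y w)\<close> and \<open>y (x w)\<close> by the Leibniz identity and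
  adding leaves \<open>(x y + y x) w = 0\<close>. Modulo the left centre the product is therefore
  antisymmetric.\<close>

lemma symmetric_mult_lcentre:
  assumes x: "x \<in> carrier L" and y: "y \<in> carrier L"
  shows "x \<otimes> y \<oplus> y \<otimes> x \<in> lcentre"
proof -
  have "(x \<otimes> y \<oplus> y \<otimes> x) \<otimes> w = \<zero>" if w: "w \<in> carrier L" for w
  proof (rule vec_eqI)
    fix \<phi> assume \<phi>: "lin \<phi>"
    have "\<phi> (x \<otimes> (y \<otimes> w)) = \<phi> ((x \<otimes> y) \<otimes> w) + \<phi> (y \<otimes> (x \<otimes> w))"
      using x y w lin_add[OF \<phi>] by (subst left_leibniz[OF x y w]) simp
    moreover have "\<phi> (y \<otimes> (x \<otimes> w)) = \<phi> ((y \<otimes> x) \<otimes> w) + \<phi> (x \<otimes> (y \<otimes> w))"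
      using x y w lin_add[OF \<phi>] by (subst left_leibniz[OF y x w]) simp
    ultimately show "\<phi> ((x \<otimes> y \<oplus> y \<otimes> x) \<otimes> w) = \<phi> \<zero>"
      using x y w \<phi> by (simp add: mult_add_left lin_simps)
  qed (use x y w in auto)
  then show ?thesis using x y by (simp add: lcentre_def)
qed

lemma cartanD:
  assumes "cartan H"
  shows "subalg H" "nilpotent_in L H" "subsp H" "stable H H" "H \<subseteq> carrier L" "x \<in> H \<Longrightarrow> x \<in> carrier L"
    "\<lbrakk>x \<in> carrier L; \<And>h. h \<in> H \<Longrightarrow> h \<otimes> x \<in> H; \<And>h. h \<in> H \<Longrightarrow> x \<otimes> h \<in> H\<rbrakk> \<Longrightarrow> x \<in> H"
  using assms subalgD[of H] by (auto simp: cartan_subalgebra_def normalizer_of_def)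

lemma cartanI:
  assumes "subalg H" "nilpotent_in L H"
    "\<And>x. \<lbrakk>x \<in> carrier L; \<And>h. h \<in> H \<Longrightarrow> h \<otimes> x \<in> H; \<And>h. h \<in> H \<Longrightarrow> x \<otimes> h \<in> H\<rbrakk> \<Longrightarrow> x \<in> H"
  shows "cartan H"
  unfolding cartan_subalgebra_def normalizer_of_def
  using assms(1,2) assms(3) subalgD[OF assms(1)] by blast

text \<open>The normalizer condition is two-sided; elements \<open>x h + h x\<close> lie in the left centre, so
  the left centre has to be absorbed first.\<close>

lemma cartan_nil_space:
  assumes H: "cartan H" and x: "x \<in> carrier L" "\<And>h. h \<in> H \<Longrightarrow> \<exists>n. lpow h n x = \<zero>"
  shows "x \<in> H"
proof -
  note Hc = cartanD(5,6)[OF H]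
  define N where "N = {v \<in> carrier L. \<forall>h\<in>H. \<exists>n. lpow h n v = \<zero>}"
  have N: "subsp N" unfolding N_def by (rule nil_space_subsp[OF Hc(1)])
  have stN: "stable H N"
    using nil_space_stable[OF cartanD(1,2)[OF H]] Hc by (auto simp: stable_def N_def)
  obtain n\<^sub>0 where "\<And>h x. h \<in> H \<Longrightarrow> x \<in> H \<Longrightarrow> lpow h n\<^sub>0 x = \<zero>"
    using nilpotent_lpow[OF cartanD(2)[OF H]] by blast
  then have HN: "H \<subseteq> N" using Hc by (auto simp: N_def)
  \<comment> \<open>Closure of \<open>N\<close> under products comes from the Leibniz rule; it keeps
    \<open>h y + y h\<close> inside \<open>N\<close> below.\<close>
  have NN: "u \<otimes> v \<in> N" if u: "u \<in> N" and v: "v \<in> N" for u v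
  proof -
    have "\<exists>n. lpow h n (u \<otimes> v) = \<zero>" if h: "h \<in> H" for h
    proof -
      obtain p q where "lpow h p u = \<zero>" "lpow h q v = \<zero>" using u v h unfolding N_def by blast
      then have "lpow h (p + q) (u \<otimes> v) \<in> {\<zero>}"
        by (intro lpow_mult[of h _ N N "{\<zero>}" "{\<zero>}"])
          (use h Hc u v subsp_carrier[OF N] subsp_in_carrier[OF N] stN in
            \<open>auto simp: subsp_zero_set stable_def\<close>)
      then show ?thesis by blast
    qed
    then show ?thesis using u v by (simp add: N_def)
  qed
  have nilN: "\<exists>k. lpow h k v = \<zero>" if "h \<in> H" "v \<in> N" for h v
    using that by (auto simp: N_def)
  have Z: "subsp (lcentre \<inter> N)" "stable H (lcentre \<inter> N)"
    using stable_subset[OF lcentre_stable Hc(1)] by (auto intro!: subsp_Int stable_Int lcentre_subsp N stN)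
  have ZH: "lcentre \<inter> N \<subseteq> H"
  proof (rule ccontr)
    assume "\<not> lcentre \<inter> N \<subseteq> H"
    then have "lcentre \<inter> N \<inter> H \<subset> lcentre \<inter> N" by blast
    then obtain z where z: "z \<in> lcentre \<inter> N" "z \<notin> lcentre \<inter> N \<inter> H"
      and Hz: "\<And>h. h \<in> H \<Longrightarrow> h \<otimes> z \<in> lcentre \<inter> N \<inter> H"
      using engel_nilpotent[OF cartanD(1,2)[OF H] Z subsp_Int[OF Z(1) cartanD(3)[OF H]]
          stable_Int[OF Z(2) cartanD(4)[OF H]]] nilN subsp_zero[OF cartanD(3)[OF H]]
          subsp_zero[OF Z(1)]
      by (metis IntI Int_iff)
    have zc: "z \<in> carrier L" using z by (simp add: lcentre_def)
    \<comment> \<open>\<open>z h = 0\<close> because \<open>z\<close> is in the left centre, so the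
      right half of the normalizer condition is automatic.\<close>
    have "z \<otimes> h \<in> H" if "h \<in> H" for h
      using z that Hc subsp_zero[OF cartanD(3)[OF H]] by (auto simp: lcentre_def)
    then have "z \<in> H" using Hz cartanD(7)[OF H zc] by blast
    then show False using z by blast
  qed
  have "N \<subseteq> H"
  proof (rule ccontr)
    assume "\<not> N \<subseteq> H"
    then have "H \<subset> N" using HN by blast
    then obtain y where y: "y \<in> N" "y \<notin> H" and Hy: "\<And>h. h \<in> H \<Longrightarrow> h \<otimes> y \<in> H"
      using engel_nilpotent[OF cartanD(1,2)[OF H] N stN cartanD(3,4)[OF H]] nilN
        subsp_zero[OF cartanD(3)[OF H]] by metis
    have yc: "y \<in> carrier L" using y by (simp add: N_def)
    have "y \<otimes> h \<in> H" if h: "h \<in> H" for h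
    proof -
      \<comment> \<open>As \<open>lcentre \<inter> N\<close> is already inside \<open>H\<close>,
        this converts \<open>h y\<close> in \<open>H\<close> into \<open>y h\<close> in
        \<open>H\<close>.\<close>
      have "h \<otimes> y \<oplus> y \<otimes> h \<in> lcentre \<inter> N"
      proof
        show "h \<otimes> y \<oplus> y \<otimes> h \<in> lcentre" by (rule symmetric_mult_lcentre[OF Hc(2)[OF h] yc])
        have "h \<in> N" using h HN by blast
        then show "h \<otimes> y \<oplus> y \<otimes> h \<in> N" using y by (intro subsp_add[OF N] NN)
      qed
      then have "h \<otimes> y \<oplus> y \<otimes> h \<in> H" using ZH by blast
      then show ?thesis
        by (rule subsp_add_cancel_left[OF cartanD(3)[OF H] Hy[OF h] mult_closed[OF yc Hc(2)[OF h]]])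
    qed
    then have "y \<in> H" using cartanD(7)[OF H yc Hy] by blast
    then show False using y by blast
  qed
  then show ?thesis using x by (auto simp: N_def)
qed

text \<open>\<open>nil_complement\<close> makes \<open>x\<close> congruent modulo \<open>W\<close>
  to a vector on which all of \<open>H\<close> acts nilpotently, and such a vector lies in
  \<open>H\<close>. This is the one-sided substitute for the normalizer condition:
  \<open>L/W\<close> contains no nonzero vector killed by \<open>H\<close> from the left.\<close>

lemma cartan_absorb:
  assumes H: "cartan H" and W: "subsp W" "stable H W" "H \<subseteq> W"
    and x: "x \<in> carrier L" "\<And>h. h \<in> H \<Longrightarrow> h \<otimes> x \<in> W"
  shows "x \<in> W"
proof -
  obtain w where w: "w \<in> W" "\<forall>h\<in>H. \<exists>n. lpow h n (x \<ominus> w) = \<zero>"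
    using nil_complement[OF cartanD(1,2)[OF H] subsp_whole stable_carrier[OF cartanD(5)[OF H]] W(1,2)
        subsp_carrier[OF W(1)] x] by blast
  have wc: "w \<in> carrier L" using w W subsp_in_carrier by blast
  have "x \<ominus> w \<in> H" using w wc x by (intro cartan_nil_space[OF H]) auto
  then show ?thesis using subsp_diff_iff[OF W(1) w(1) x(1)] W(3) by blast
qed


section \<open>Chief factors and existence of Cartan subalgebras\<close>

lemma subsp_add_cancel_right:
  "subsp W \<Longrightarrow> y \<in> W \<Longrightarrow> x \<in> carrier L \<Longrightarrow> x \<oplus> y \<in> W \<Longrightarrow> x \<in> W"
  using subsp_add_cancel_left[of W y x] subsp_in_carrier[of W y] by (simp add: M.a_comm)

text \<open>A two-sided ideal relative to a subalgebra \<open>M\<close> of the fixed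
  \<open>L\<close>, so that ideals of changing subalgebras need no new algebra structure.\<close>

definition mideal :: "'a set \<Rightarrow> 'a set \<Rightarrow> bool" where
  "mideal M I \<longleftrightarrow> subsp I \<and> I \<subseteq> M \<and> (\<forall>m\<in>M. \<forall>a\<in>I. m \<otimes> a \<in> I \<and> a \<otimes> m \<in> I)"

lemma midealD:
  assumes "mideal M I"
  shows "subsp I" "I \<subseteq> M" "I \<subseteq> carrier L" "stable M I" "m \<in> M \<Longrightarrow> a \<in> I \<Longrightarrow> m \<otimes> a \<in> I"
    "m \<in> M \<Longrightarrow> a \<in> I \<Longrightarrow> a \<otimes> m \<in> I"
  using assms subsp_carrier by (auto simp: mideal_def stable_def)

lemma mideal_subset: "mideal M I \<Longrightarrow> N \<subseteq> M \<Longrightarrow> I \<subseteq> N \<Longrightarrow> mideal N I"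
  by (auto simp: mideal_def)

definition chief :: "'a set \<Rightarrow> 'a set \<Rightarrow> 'a set \<Rightarrow> bool" where
  "chief M I J \<longleftrightarrow> mideal M I \<and> mideal M J \<and> J \<subset> I \<and>
    (\<forall>K. mideal M K \<longrightarrow> J \<subseteq> K \<longrightarrow> K \<subseteq> I \<longrightarrow> K = J \<or> K = I)"

lemma chief_exists:
  assumes M: "subalg M" and I: "mideal M I" "I \<noteq> {\<zero>}"
  obtains J where "chief M I J"
proof -
  have "mideal M {\<zero>}"
    using subalgD[OF M] subsp_zero[OF subalgD(1)[OF M]] by (auto simp: mideal_def subsp_zero_set)
  moreover have "{\<zero>} \<subset> I" using I subsp_zero[OF midealD(1)[OF I(1)]] by blast
  ultimately obtain J where "mideal M J \<and> J \<subset> I"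
    and "\<And>K. mideal M K \<and> K \<subset> I \<Longrightarrow> J \<subseteq> K \<Longrightarrow> K = J"
    by (rule_tac maximal_subsp[of "\<lambda>K. mideal M K \<and> K \<subset> I" "{\<zero>}"]) (auto dest: midealD(1))
  then have "chief M I J" unfolding chief_def using I by blast
  then show thesis by (rule that)
qed

lemma derived_series_mono:
  assumes "V \<subseteq> U" "U \<subseteq> carrier L"
  shows "derived_series L V n \<subseteq> derived_series L U n \<and> derived_series L U n \<subseteq> carrier L"
proof (induction n)
  case (Suc n)
  then have "subsp (product_space L (derived_series L U n) (derived_series L U n))"
    by (intro product_space_subsp) auto
  moreover from this
  have "product_space L (derived_series L V n) (derived_series L V n) \<subseteq>
      product_space L (derived_series L U n) (derived_series L U n)"
    by (rule product_space_least) (use Suc in \<open>auto intro: product_spaceI\<close>)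
  ultimately show ?case using subsp_carrier by simp
qed (use assms in simp)

lemma derived_series_subsp: "subsp U \<Longrightarrow> subsp (derived_series L U n)"
  by (induction n) (simp_all add: product_space_subsp subsp_carrier)

lemma solvable_mono:
  assumes "solvable_in L U" "subsp V" "V \<subseteq> U" "U \<subseteq> carrier L"
  shows "solvable_in L V"
proof -
  obtain n where "derived_series L U n = {\<zero>}" using assms(1) by (auto simp: solvable_in_def)
  then have "derived_series L V n \<subseteq> {\<zero>}" using derived_series_mono[OF assms(3,4), of n] by simp
  then show ?thesis
    unfolding solvable_in_def using subsp_zero[OF derived_series_subsp[OF assms(2), of n]] by blast
qed

text \<open>Multiplication from the right obeys no derivation rule, but
  \<open>(a b) m = a (b m) - b (a m)\<close> still lies in the span of products of \<open>I\<close>.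
  The subspace \<open>T\<close> reduces the claim to the generators \<open>a b\<close>.\<close>

lemma product_space_mideal:
  assumes M: "subalg M" and I: "mideal M I"
  shows "mideal M (product_space L I I)" (is "mideal M ?P")
proof -
  note Mc = subalgD(5)[OF M] and Ic = subsetD[OF midealD(3)[OF I]]
  have P: "subsp ?P" by (intro product_space_subsp midealD[OF I])
  define T where "T = {v \<in> carrier L. \<forall>m\<in>M. m \<otimes> v \<in> ?P \<and> v \<otimes> m \<in> ?P}"
  have "subsp T"
  proof (rule subspI)
    show "\<zero> \<in> T" using Mc by (auto simp: T_def subsp_zero[OF P])
    show "u \<oplus> v \<in> T" if "u \<in> T" "v \<in> T" for u v
      using that Mc by (auto simp: T_def mult_add_left mult_add_right subsp_add[OF P])
    show "a \<odot> u \<in> T" if "u \<in> T" for a u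
      using that Mc by (auto simp: T_def mult_smult_left mult_smult_right subsp_scale[OF P])
  qed (auto simp: T_def)
  then have "?P \<subseteq> T"
  proof (rule product_space_least)
    fix a b assume ab: "a \<in> I" "b \<in> I"
    have "m \<otimes> (a \<otimes> b) \<in> ?P \<and> (a \<otimes> b) \<otimes> m \<in> ?P" if m: "m \<in> M" for m
    proof
      note c = Ic[OF ab(1)] Ic[OF ab(2)] Mc[OF m]
      show "m \<otimes> (a \<otimes> b) \<in> ?P"
        unfolding left_leibniz[OF c(3,1,2)]
        by (intro subsp_add[OF P] product_spaceI midealD(5)[OF I m] ab)
      have "(a \<otimes> b) \<otimes> m \<oplus> b \<otimes> (a \<otimes> m) \<in> ?P"
        unfolding left_leibniz[OF c, symmetric]
        by (intro product_spaceI midealD(6)[OF I m] ab)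
      moreover have "b \<otimes> (a \<otimes> m) \<in> ?P" by (intro product_spaceI midealD(6)[OF I m] ab)
      ultimately show "(a \<otimes> b) \<otimes> m \<in> ?P"
        by (rule_tac subsp_add_cancel_right[OF P _ mult_closed[OF mult_closed[OF c(1,2)] c(3)]])
    qed
    then show "a \<otimes> b \<in> T" using Ic ab by (auto simp: T_def)
  qed
  moreover have "?P \<subseteq> I"
    using midealD(2,5)[OF I] by (intro product_space_least midealD(1)[OF I]) auto
  ultimately show ?thesis
    using P midealD(2)[OF I] unfolding mideal_def T_def by blast
qed

lemma mideal_set_add:
  assumes M: "subalg M" and I: "mideal M I" and J: "mideal M J"
  shows "mideal M (I <+>\<^bsub>L\<^esub> J)"
  unfolding mideal_def
proof (intro conjI ballI)
  note c = subsetD[OF midealD(3)[OF I]] subsetD[OF midealD(3)[OF J]] subalgD(5)[OF M]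
  show "subsp (I <+>\<^bsub>L\<^esub> J)" by (intro subsp_set_add midealD(1)[OF I] midealD(1)[OF J])
  show "I <+>\<^bsub>L\<^esub> J \<subseteq> M" by (intro set_add_least subalgD(1)[OF M] midealD(2)[OF I] midealD(2)[OF J])
  fix m v assume m: "m \<in> M" and "v \<in> I <+>\<^bsub>L\<^esub> J"
  then obtain a b where ab: "a \<in> I" "b \<in> J" "v = a \<oplus> b" by (auto elim: set_addE)
  show "m \<otimes> v \<in> I <+>\<^bsub>L\<^esub> J"
    unfolding ab(3) mult_add_right[OF c(3)[OF m] c(1)[OF ab(1)] c(2)[OF ab(2)]]
    by (intro set_addI midealD(5)[OF I] midealD(5)[OF J] m ab)
  show "v \<otimes> m \<in> I <+>\<^bsub>L\<^esub> J"
    unfolding ab(3) mult_add_left[OF c(1)[OF ab(1)] c(2)[OF ab(2)] c(3)[OF m]]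
    by (intro set_addI midealD(6)[OF I] midealD(6)[OF J] m ab)
qed

text \<open>By irreducibility \<open>I I + J\<close> is \<open>J\<close> or \<open>I\<close>. If it
  were \<open>I\<close>, then \<open>I = D n + J\<close> for every term \<open>D n\<close> of the
  derived series, and solvability would give \<open>I = J\<close>.\<close>

lemma chief_abelian:
  assumes M: "subalg M" and ch: "chief M I J" and sol: "solvable_in L I" and ab: "a \<in> I" "b \<in> I"
  shows "a \<otimes> b \<in> J"
proof -
  have I: "mideal M I" and J: "mideal M J" "J \<subset> I" using ch by (auto simp: chief_def)
  note Ic = subsetD[OF midealD(3)[OF I]] and Jc = subsetD[OF midealD(3)[OF J(1)]]
  define P where "P = product_space L I I"
  have P: "mideal M P" unfolding P_def by (rule product_space_mideal[OF M I])
  have PI: "P \<subseteq> I"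
    unfolding P_def using midealD(2,5)[OF I] by (intro product_space_least midealD(1)[OF I]) auto
  have PJ: "mideal M (P <+>\<^bsub>L\<^esub> J)" by (rule mideal_set_add[OF M P J(1)])
  have up: "P \<subseteq> P <+>\<^bsub>L\<^esub> J" "J \<subseteq> P <+>\<^bsub>L\<^esub> J"
    by (intro set_add_upper1 set_add_upper2 midealD(1,3)[OF P] midealD(1,3)[OF J(1)])+
  have "P <+>\<^bsub>L\<^esub> J \<noteq> I"
  proof
    assume eq: "P <+>\<^bsub>L\<^esub> J = I"
    define D where "D = derived_series L I"
    have D: "subsp (D n)" for n unfolding D_def by (rule derived_series_subsp[OF midealD(1)[OF I]])
    have DI: "D n \<subseteq> I" for n
    proof (induction n)
      case (Suc n)
      then have "product_space L (D n) (D n) \<subseteq> I"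
        using midealD(2)[OF I]
        by (intro product_space_least midealD(1)[OF I] midealD(5)[OF I]) auto
      then show ?case by (simp add: D_def)
    qed (simp add: D_def)
    \<comment> \<open>Writing both factors of a product from \<open>I\<close> as elements of
      \<open>D n + J\<close> changes it only by elements of \<open>J\<close>, so \<open>P\<close>,
      and with it \<open>I = P + J\<close>, lies in \<open>D (Suc n) + J\<close>.\<close>
    have "I \<subseteq> D n <+>\<^bsub>L\<^esub> J" for n
    proof (induction n)
      case 0
      show ?case unfolding D_def by (simp add: set_add_upper1 midealD(1,3)[OF I] midealD(1)[OF J(1)])
    next
      case (Suc n)
      have DJ: "subsp (D (Suc n) <+>\<^bsub>L\<^esub> J)" by (intro subsp_set_add D midealD(1)[OF J(1)])
      have "P \<subseteq> D (Suc n) <+>\<^bsub>L\<^esub> J"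
        unfolding P_def
      proof (rule product_space_least[OF DJ])
        fix u v assume "u \<in> I" "v \<in> I"
        then have "u \<in> D n <+>\<^bsub>L\<^esub> J" "v \<in> D n <+>\<^bsub>L\<^esub> J" using Suc by auto
        then obtain d d' j j' where d: "d \<in> D n" "d' \<in> D n" and j: "j \<in> J" "j' \<in> J"
          and uv: "u = d \<oplus> j" "v = d' \<oplus> j'"
          by (auto elim!: set_addE)
        have c: "d \<in> carrier L" "d' \<in> carrier L" "j \<in> carrier L" "j' \<in> carrier L"
          using d j DI Ic Jc by auto
        have dM: "d \<in> M" "d' \<in> M" "j \<in> M" using d j DI midealD(2)[OF I] midealD(2)[OF J(1)] by auto
        have "d \<otimes> d' \<in> D (Suc n)" using d by (simp add: D_def product_spaceI)
        moreover have "d \<otimes> j' \<oplus> (j \<otimes> d' \<oplus> j \<otimes> j') \<in> J"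
          by (intro subsp_add[OF midealD(1)[OF J(1)]] midealD(5)[OF J(1)] midealD(6)[OF J(1)] dM j)
        moreover have "u \<otimes> v = d \<otimes> d' \<oplus> (d \<otimes> j' \<oplus> (j \<otimes> d' \<oplus> j \<otimes> j'))"
          using c by (simp add: uv mult_add_left mult_add_right M.a_ac)
        ultimately show "u \<otimes> v \<in> D (Suc n) <+>\<^bsub>L\<^esub> J" using set_addI by simp
      qed
      then have "P <+>\<^bsub>L\<^esub> J \<subseteq> D (Suc n) <+>\<^bsub>L\<^esub> J"
        using set_add_upper2[OF midealD(3)[OF J(1)] D, of "Suc n"] by (intro set_add_least DJ)
      then show ?case using eq by simp
    qed
    moreover obtain n where "D n = {\<zero>}" using sol by (auto simp: solvable_in_def D_def)
    ultimately have "I \<subseteq> {\<zero>} <+>\<^bsub>L\<^esub> J" by metis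
    also have "\<dots> \<subseteq> J"
      using subsp_zero[OF midealD(1)[OF J(1)]] by (intro set_add_least midealD(1)[OF J(1)]) auto
    finally show False using J(2) by blast
  qed
  then have "P <+>\<^bsub>L\<^esub> J = J"
    using ch PJ up(2) PI J(2) set_add_least[OF midealD(1)[OF I], of P J] unfolding chief_def by blast
  then show ?thesis using up(1) product_spaceI[OF ab] unfolding P_def by blast
qed

text \<open>Modulo \<open>J\<close>, the left centre of \<open>M\<close> either contains \<open>I\<close> or meets it trivially.\<close>

lemma chief_right_action:
  assumes M: "subalg M" and ch: "chief M I J"
  shows "(\<forall>a\<in>I. \<forall>m\<in>M. a \<otimes> m \<in> J) \<or> (\<forall>a\<in>I. \<forall>m\<in>M. m \<otimes> a \<oplus> a \<otimes> m \<in> J)"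
proof -
  have I: "mideal M I" and J: "mideal M J" "J \<subset> I" using ch by (auto simp: chief_def)
  note Ic = subsetD[OF midealD(3)[OF I]] and Mc = subalgD(5)[OF M] and J' = midealD[OF J(1)]
  define Z where "Z = {a \<in> I. \<forall>m\<in>M. a \<otimes> m \<in> J}"
  have "subsp Z"
  proof (rule subspI)
    show "\<zero> \<in> Z" using Mc by (auto simp: Z_def subsp_zero[OF J'(1)] subsp_zero[OF midealD(1)[OF I]])
    show "u \<oplus> v \<in> Z" if "u \<in> Z" "v \<in> Z" for u v
      using that Mc Ic by (auto simp: Z_def mult_add_left subsp_add[OF J'(1)] subsp_add[OF midealD(1)[OF I]])
    show "a \<odot> u \<in> Z" if "u \<in> Z" for a u
      using that Mc Ic by (auto simp: Z_def mult_smult_left subsp_scale[OF J'(1)] subsp_scale[OF midealD(1)[OF I]])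
  qed (use Ic in \<open>auto simp: Z_def\<close>)
  moreover have "m \<otimes> z \<in> Z \<and> z \<otimes> m \<in> Z" if m: "m \<in> M" and z: "z \<in> Z" for m z
  proof -
    have zI: "z \<in> I" and zJ: "\<And>m. m \<in> M \<Longrightarrow> z \<otimes> m \<in> J" using z by (auto simp: Z_def)
    have "(m \<otimes> z) \<otimes> k \<in> J" if k: "k \<in> M" for k
    proof -
      note c = Mc[OF m] Ic[OF zI] Mc[OF k]
      have "(m \<otimes> z) \<otimes> k \<oplus> z \<otimes> (m \<otimes> k) \<in> J"
        unfolding left_leibniz[OF c, symmetric] by (intro J'(5) m zJ k)
      then show ?thesis
        by (rule subsp_add_cancel_right[OF J'(1) zJ[OF subalgD(4)[OF M m k]] mult_closed[OF mult_closed[OF c(1,2)] c(3)]])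
    qed
    moreover have "(z \<otimes> m) \<otimes> k \<in> J" if k: "k \<in> M" for k
      by (intro J'(6) k zJ m)
    ultimately show ?thesis using midealD(5,6)[OF I m zI] by (auto simp: Z_def)
  qed
  ultimately have "mideal M Z" using midealD(2)[OF I] by (auto simp: mideal_def Z_def)
  moreover have "J \<subseteq> Z" using J J'(6) by (auto simp: Z_def)
  ultimately have "Z = J \<or> Z = I" using ch unfolding chief_def by (auto simp: Z_def)
  then show ?thesis
  proof
    assume Z: "Z = J"
    \<comment> \<open>Symmetrised products annihilate from the left, so those of \<open>I\<close>
      with \<open>M\<close> fall into \<open>Z\<close>, which is \<open>J\<close> in this
      case.\<close>
    have "m \<otimes> a \<oplus> a \<otimes> m \<in> Z" if a: "a \<in> I" and m: "m \<in> M" for a m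
    proof -
      have "m \<otimes> a \<oplus> a \<otimes> m \<in> lcentre" by (intro symmetric_mult_lcentre Ic Mc a m)
      then show ?thesis
        using midealD(5,6)[OF I m a] subsp_add[OF midealD(1)[OF I]] Mc subsp_zero[OF J'(1)]
        by (auto simp: Z_def lcentre_def)
    qed
    then show ?thesis using Z by blast
  qed (auto simp: Z_def)
qed

text \<open>Modulo \<open>J\<close> the right action of \<open>M\<close> on \<open>I\<close> is zero
  or minus the left action, so a left-stable subspace between \<open>J\<close> and \<open>I\<close>
  is two-sided. Irreducibility of the factor thus holds for left multiplications alone.\<close>

lemma chief_left_submodule:
  assumes M: "subalg M" and ch: "chief M I J"
    and K: "subsp K" "J \<subseteq> K" "K \<subseteq> I" "stable M K"
  shows "K = J \<or> K = I"
proof -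
  have I: "mideal M I" using ch by (auto simp: chief_def)
  note c = subsetD[OF midealD(3)[OF I]] subalgD(5)[OF M]
  have "a \<otimes> m \<in> K" if a: "a \<in> K" and m: "m \<in> M" for a m
  proof -
    have "a \<otimes> m \<in> J \<or> m \<otimes> a \<oplus> a \<otimes> m \<in> J"
      using chief_right_action[OF M ch] a m K(3) by blast
    then show ?thesis
    proof
      assume "m \<otimes> a \<oplus> a \<otimes> m \<in> J"
      then have "m \<otimes> a \<oplus> a \<otimes> m \<in> K" using K(2) by blast
      moreover have "a \<otimes> m \<in> carrier L" using K(3) c a m by blast
      ultimately show ?thesis by (rule_tac subsp_add_cancel_left[OF K(1) stableD[OF K(4) m a]])
    qed (use K in blast)
  qed
  then have "mideal M K" using K midealD(2)[OF I] by (auto simp: mideal_def stable_def)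
  then show ?thesis using ch K unfolding chief_def by blast
qed

text \<open>The preimage in \<open>V\<close> of the Fitting null component of \<open>h\<close> on
  \<open>V/J\<close>.\<close>

definition nilmod :: "'a \<Rightarrow> 'a set \<Rightarrow> 'a set \<Rightarrow> 'a set" where
  "nilmod h V J = {v \<in> V. \<exists>k. lpow h k v \<in> J}"

lemma nilmod_subsp:
  assumes h: "h \<in> carrier L" and V: "subsp V" and J: "subsp J" "stable {h} J"
  shows "subsp (nilmod h V J)"
proof (rule subspI)
  note Vc = subsp_in_carrier[OF V]
  show "nilmod h V J \<subseteq> carrier L" using Vc by (auto simp: nilmod_def)
  have "lpow h 0 \<zero> \<in> J" by (simp add: subsp_zero[OF J(1)])
  then show "\<zero> \<in> nilmod h V J" unfolding nilmod_def using subsp_zero[OF V] by blast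
  show "u \<oplus> v \<in> nilmod h V J" if u: "u \<in> nilmod h V J" and v: "v \<in> nilmod h V J" for u v
  proof -
    obtain m n where mn: "lpow h m u \<in> J" "lpow h n v \<in> J" using u v unfolding nilmod_def by blast
    have uv: "u \<in> V" "v \<in> V" using u v by (auto simp: nilmod_def)
    have "lpow h (m + n) u \<in> J" "lpow h (m + n) v \<in> J"
      using mn lpow_mono[OF J(2)] by auto
    then have "lpow h (m + n) (u \<oplus> v) \<in> J"
      using linopD(2)[OF lpow_linop[OF h]] Vc uv subsp_add[OF J(1)] by simp
    then show ?thesis using uv subsp_add[OF V] unfolding nilmod_def by blast
  qed
  show "a \<odot> u \<in> nilmod h V J" if u: "u \<in> nilmod h V J" for a u
  proof -
    obtain m where m: "lpow h m u \<in> J" "u \<in> V" using u unfolding nilmod_def by blast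
    then have "lpow h m (a \<odot> u) \<in> J"
      using linopD(3)[OF lpow_linop[OF h]] Vc subsp_scale[OF J(1)] by simp
    then show ?thesis using m subsp_scale[OF V] unfolding nilmod_def by blast
  qed
qed

lemma nilmod_upper: "J \<subseteq> V \<Longrightarrow> J \<subseteq> nilmod h V J"
  unfolding nilmod_def by (auto intro: exI[of _ 0])

lemma nilmod_Int: "W \<subseteq> V \<Longrightarrow> nilmod h V J \<inter> W = nilmod h W J"
  by (auto simp: nilmod_def)

lemma nilmod_stepI: "v \<in> V \<Longrightarrow> h \<otimes> v \<in> J \<Longrightarrow> v \<in> nilmod h V J"
  unfolding nilmod_def by (auto intro!: exI[of _ 1] simp: lpow_Suc)

text \<open>Telescoping: \<open>h u - h' u' = h (u - u') + (h - h') u'\<close>, where both summands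
  stay in \<open>J\<close>.\<close>

lemma lpow_cong:
  assumes h: "h \<in> carrier L" "h' \<in> carrier L" and V: "V \<subseteq> carrier L" "stable {h} V" "stable {h'} V"
    and J: "subsp J" "stable {h} J" and hh: "\<And>v. v \<in> V \<Longrightarrow> (h \<ominus> h') \<otimes> v \<in> J" and v: "v \<in> V"
  shows "lpow h n v \<ominus> lpow h' n v \<in> J"
proof (induction n)
  case 0
  have "v \<in> carrier L" using v V by auto
  then show ?case using subsp_zero[OF J(1)] by (simp add: a_minus_def M.r_neg)
next
  case (Suc n)
  define u u' where "u = lpow h n v" and "u' = lpow h' n v"
  have uV: "u \<in> V" "u' \<in> V" unfolding u_def u'_def using lpow_stable V v by auto
  then have c: "u \<in> carrier L" "u' \<in> carrier L" using V by auto
  have "h \<otimes> (u \<ominus> u') \<oplus> (h \<ominus> h') \<otimes> u' \<in> J"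
    using Suc unfolding u_def[symmetric] u'_def[symmetric]
    by (intro subsp_add[OF J(1) stableD[OF J(2)] hh] uV) auto
  moreover have "h \<otimes> (u \<ominus> u') \<oplus> (h \<ominus> h') \<otimes> u' = h \<otimes> u \<ominus> h' \<otimes> u'"
  proof (rule vec_eqI)
    fix \<phi> assume "lin \<phi>"
    then show "\<phi> (h \<otimes> (u \<ominus> u') \<oplus> (h \<ominus> h') \<otimes> u') = \<phi> (h \<otimes> u \<ominus> h' \<otimes> u')"
      using h c by (simp add: mult_diff_left mult_diff_right lin_simps)
  qed (use h c in auto)
  ultimately show ?case by (simp add: lpow_Suc u_def u'_def)
qed

lemma nilmod_cong:
  assumes "h \<in> carrier L" "h' \<in> carrier L" and "V \<subseteq> carrier L" "stable {h} V" "stable {h'} V"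
    and J: "subsp J" "stable {h} J" and "\<And>v. v \<in> V \<Longrightarrow> (h \<ominus> h') \<otimes> v \<in> J"
  shows "nilmod h V J = nilmod h' V J"
proof -
  have "lpow h n v \<in> J \<longleftrightarrow> lpow h' n v \<in> J" if v: "v \<in> V" for n v
  proof -
    have c: "lpow h n v \<in> carrier L" "lpow h' n v \<in> carrier L" using assms v by auto
    have d: "lpow h n v \<ominus> lpow h' n v \<in> J" by (rule lpow_cong[OF assms v])
    have "lpow h n v = (lpow h n v \<ominus> lpow h' n v) \<oplus> lpow h' n v" using diff_add_cancel[OF c] by simp
    then show ?thesis
      using subsp_add[OF J(1) d] subsp_add_cancel_left[OF J(1) d c(2)] by metis
  qed
  then show ?thesis unfolding nilmod_def by blast
qed

text \<open>The null component of \<open>h\<close> on \<open>I/J\<close> is stable under every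
  \<open>m\<close> in \<open>M\<close>: since \<open>M\<close> is nilpotent modulo \<open>I\<close>,
  \<open>h^n m\<close> lies in \<open>I\<close>, which acts as zero on the abelian factor, so the
  Leibniz rule applies. Irreducibility leaves only the two extremes.\<close>

lemma chief_nilmod:
  assumes M: "subalg M" and ch: "chief M I J" and sol: "solvable_in L I" and lcs: "lcs M n \<subseteq> I"
    and h: "h \<in> M"
  shows "nilmod h I J = J \<or> nilmod h I J = I"
proof (rule chief_left_submodule[OF M ch])
  have I: "mideal M I" and J: "mideal M J" "J \<subset> I" using ch by (auto simp: chief_def)
  note I' = midealD[OF I] and J' = midealD[OF J(1)] and M' = subalgD[OF M]
  have st: "stable {h} I" "stable {h} J" "stable {h} M"
    using stable_subset I'(4) J'(4) M'(2) h by auto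
  show "subsp (nilmod h I J)" by (intro nilmod_subsp M' h I' J' st)
  show "J \<subseteq> nilmod h I J" using J by (intro nilmod_upper) auto
  show "nilmod h I J \<subseteq> I" by (auto simp: nilmod_def)
  show "stable M (nilmod h I J)"
    unfolding stable_def
  proof (intro ballI)
    fix m v assume m: "m \<in> M" and v: "v \<in> nilmod h I J"
    obtain q where q: "lpow h q v \<in> J" and vI: "v \<in> I" using v by (auto simp: nilmod_def)
    have "lpow h (n + q) (m \<otimes> v) \<in> J"
    proof (rule lpow_mult[of h J M I I J])
      show "s \<otimes> b \<in> J" if "s \<in> I" "b \<in> I" for s b by (rule chief_abelian[OF M ch sol that])
      show "lpow h n m \<in> I" using lpow_in_lcs[OF h m] lcs by blast
    qed (use M' I' J' st h m vI q in auto)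
    then show "m \<otimes> v \<in> nilmod h I J" using I'(5)[OF m vI] unfolding nilmod_def by blast
  qed
qed

text \<open>\<open>h - k\<close> lies in \<open>I\<close>, which acts as zero on the abelian factor
  \<open>I/J\<close>. This permits exchanging \<open>h\<close> for any representative modulo
  \<open>I\<close>.\<close>

lemma chief_nilmod_cong:
  assumes M: "subalg M" and ch: "chief M I J" and sol: "solvable_in L I"
    and hk: "h \<in> M" "k \<in> M" "h \<ominus> k \<in> I"
  shows "nilmod h I J = nilmod k I J"
proof -
  have I: "mideal M I" and J: "mideal M J" using ch by (auto simp: chief_def)
  have "stable {h} I" "stable {k} I" "stable {h} J"
    using stable_subset[OF midealD(4)[OF I]] stable_subset[OF midealD(4)[OF J]] hk by auto
  then show ?thesis
    using chief_abelian[OF M ch sol hk(3)]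
    by (intro nilmod_cong subalgD(5)[OF M] hk midealD(3)[OF I] midealD(1)[OF J]) auto
qed

text \<open>The left half is the Engel descent, started at \<open>lcs M n\<close>, which is inside
  \<open>I\<close> and acts as zero. The right half follows from the dichotomy for right
  multiplications.\<close>

lemma chief_nil:
  assumes M: "subalg M" and ch: "chief M I J" and sol: "solvable_in L I" and lcs: "lcs M n \<subseteq> I"
    and nil: "\<And>h. h \<in> M \<Longrightarrow> nilmod h I J = I" and m: "m \<in> M" and a: "a \<in> I"
  shows "m \<otimes> a \<in> J" "a \<otimes> m \<in> J"
proof -
  have I: "mideal M I" and J: "mideal M J" "J \<subset> I" using ch by (auto simp: chief_def)
  note I' = midealD[OF I] and J' = midealD[OF J(1)] and M' = subalgD[OF M]
  show ma: "m \<otimes> a \<in> J"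
  proof (rule irreducible_nil_action[OF M I'(1) J'(1) _ J'(4) chief_left_submodule[OF M ch] I'(4)])
    show "\<exists>k. lpow m k w \<in> J" if "m \<in> M" "w \<in> I" for m w
      using nil[OF that(1)] that(2) by (auto simp: nilmod_def)
    show "s \<otimes> w \<in> J" if "s \<in> lcs M n" "w \<in> I" for s w
      using chief_abelian[OF M ch sol] that lcs by blast
  qed (use J m a in auto)
  have "a \<otimes> m \<in> J \<or> m \<otimes> a \<oplus> a \<otimes> m \<in> J" using chief_right_action[OF M ch] a m by blast
  then show "a \<otimes> m \<in> J"
  proof
    assume "m \<otimes> a \<oplus> a \<otimes> m \<in> J"
    then show ?thesis by (rule subsp_add_cancel_left[OF J'(1) ma mult_closed[OF subsetD[OF I'(3) a] M'(5)[OF m]]])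
  qed
qed

lemma lcs_mono:
  assumes "U \<subseteq> V" "subsp V"
  shows "lcs U n \<subseteq> lcs V n"
  by (rule lcs_least[of U "lcs V"]) (use assms lcs_subsp lcs_mult in auto)

lemma nilmod_subalg:
  assumes M: "subalg M" and J: "mideal M J" and h: "h \<in> M"
  shows "subalg (nilmod h M J)"
  unfolding subalgebra_of_def
proof (intro conjI ballI)
  note J' = midealD[OF J] and M' = subalgD[OF M]
  have st: "stable {h} J" "stable {h} M" using stable_subset J'(4) M'(2) h by auto
  show "subsp (nilmod h M J)" by (intro nilmod_subsp M' h J' st)
  fix u v assume uv: "u \<in> nilmod h M J" "v \<in> nilmod h M J"
  then obtain p q where "lpow h p u \<in> J" "lpow h q v \<in> J" unfolding nilmod_def by blast
  moreover have "u \<in> M" "v \<in> M" using uv by (auto simp: nilmod_def)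
  ultimately have "lpow h (p + q) (u \<otimes> v) \<in> J"
    by (intro lpow_mult[of h J M M J J]) (use h M' J' st in auto)
  then show "u \<otimes> v \<in> nilmod h M J"
    using \<open>u \<in> M\<close> \<open>v \<in> M\<close> M'(4) unfolding nilmod_def by blast
qed

text \<open>A power of \<open>h\<close> sends \<open>m\<close> into \<open>I\<close>, so the Fitting
  argument on \<open>I\<close> corrects \<open>m\<close> by some \<open>b\<close> in
  \<open>I\<close> to a vector killed by a power of \<open>h\<close>.\<close>

lemma nilmod_supplement:
  assumes M: "subalg M" and I: "mideal M I" and J: "subsp J" and h: "h \<in> M" and lcs: "lcs M n \<subseteq> I"
    and m: "m \<in> M"
  obtains y b where "y \<in> nilmod h M J" "b \<in> I" "m = y \<oplus> b"
proof -
  note I' = midealD[OF I] and M' = subalgD[OF M]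
  have "lpow h n m \<in> I" using lpow_in_lcs[OF h m] lcs by blast
  moreover have "stable {h} I" using stable_subset[OF I'(4)] h by auto
  ultimately obtain b k where b: "b \<in> I" "lpow h k (m \<ominus> b) = \<zero>"
    by (rule_tac fitting[OF M'(5)[OF h] I'(1) _ M'(5)[OF m]])
  have "m \<ominus> b \<in> M" using m b I'(2) by (intro subsp_diff M'(1)) auto
  moreover have "lpow h k (m \<ominus> b) \<in> J" using b subsp_zero[OF J] by simp
  ultimately have "m \<ominus> b \<in> nilmod h M J" unfolding nilmod_def by blast
  moreover have "m = (m \<ominus> b) \<oplus> b" using diff_add_cancel m b M'(5) I'(3) by auto
  ultimately show thesis using that b by blast
qed

text \<open>Self-normalization is asserted only inside \<open>M\<close>, because \<open>M\<close>
  shrinks along the induction: an element normalizing \<open>H\<close> is first shown to lie in the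
  smaller subalgebra, where the induction hypothesis takes over.\<close>

lemma cartan_exists_over_solvable:
  assumes "subalg M" "mideal M I" "solvable_in L I" "lcs M n \<subseteq> I"
  shows "\<exists>H. subalg H \<and> nilpotent_in L H \<and> H \<subseteq> M \<and> (\<forall>x\<in>M. \<exists>h\<in>H. \<exists>a\<in>I. x = h \<oplus> a) \<and>
    (\<forall>x\<in>M. (\<forall>h\<in>H. h \<otimes> x \<in> H \<and> x \<otimes> h \<in> H) \<longrightarrow> x \<in> H)"
  using assms
proof (induction "rank I" arbitrary: I M n rule: less_induct)
  case less
  note M = less.prems(1) and I = less.prems(2) and sol = less.prems(3) and lcs = less.prems(4)
  note M' = subalgD[OF M] and I' = midealD[OF I]
  show ?case
  proof (cases "I = {\<zero>}")
    case True
    then have "nilpotent_in L M" using nilpotent_inI[OF M'(1)] lcs by blast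
    then show ?thesis using M M' True by (intro exI[of _ M]) auto
  next
    case False
    then obtain J where ch: "chief M I J" using chief_exists[OF M I] by blast
    then have J: "mideal M J" "J \<subset> I" by (auto simp: chief_def)
    note J' = midealD[OF J(1)]
    have rk: "rank J < rank I" by (intro rank_less J' I' J)
    have solJ: "solvable_in L J" using solvable_mono[OF sol J'(1) _ I'(3)] J by blast
    show ?thesis
    proof (cases "\<forall>h\<in>M. nilmod h I J = I")
      case True
      \<comment> \<open>\<open>M\<close> maps \<open>I\<close> into \<open>J\<close>, so one further
        term of the series lies in \<open>J\<close> and \<open>M\<close> itself can be kept.\<close>
      have "lcs M (Suc n) \<subseteq> J"
        using chief_nil(1)[OF M ch sol lcs] True lcs
        by (simp, intro product_space_least J'(1)) auto
      from less.hyps[OF rk M J(1) solJ this] show ?thesis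
        using J(2) by (elim exE) (intro exI, blast)
    next
      case False
      then obtain h where h: "h \<in> M" "nilmod h I J = J" using chief_nilmod[OF M ch sol lcs] by blast
      define N where "N = nilmod h M J"
      have N: "subalg N" unfolding N_def by (rule nilmod_subalg[OF M J(1) h(1)])
      note N' = subalgD[OF N]
      have NM: "N \<subseteq> M" and JN: "J \<subseteq> N"
        unfolding N_def using nilmod_upper[OF J'(2)] by (auto simp: nilmod_def)
      have NI: "N \<inter> I = J" unfolding N_def nilmod_Int[OF I'(2)] by (rule h(2))
      have dec: "\<exists>y\<in>N. \<exists>b\<in>I. m = y \<oplus> b" if "m \<in> M" for m
        using nilmod_supplement[OF M I J'(1) h(1) lcs that] unfolding N_def by blast
      \<comment> \<open>This term lies both in \<open>N\<close> and in \<open>lcs M n\<close>, hence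
        in \<open>N \<inter> I = J\<close>.\<close>
      have lcsN: "lcs N n \<subseteq> J"
        using lcs_mono[OF NM M'(1), of n] lcs_subset[OF N, of n] lcs NI by blast
      obtain H where H: "subalg H" "nilpotent_in L H" "H \<subseteq> N"
        and Hdec: "\<And>x. x \<in> N \<Longrightarrow> \<exists>h\<in>H. \<exists>a\<in>J. x = h \<oplus> a"
        and Hnorm: "\<And>x. x \<in> N \<Longrightarrow> (\<And>h. h \<in> H \<Longrightarrow> h \<otimes> x \<in> H \<and> x \<otimes> h \<in> H) \<Longrightarrow> x \<in> H"
        using less.hyps[OF rk N mideal_subset[OF J(1) NM JN] solJ lcsN] by blast
      have "\<exists>h\<in>H. \<exists>a\<in>I. x = h \<oplus> a" if x: "x \<in> M" for x
      proof -
        obtain y b where yb: "y \<in> N" "b \<in> I" "x = y \<oplus> b" using dec[OF x] by blast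
        obtain k j where kj: "k \<in> H" "j \<in> J" "y = k \<oplus> j" using Hdec[OF yb(1)] by blast
        have "x = k \<oplus> (j \<oplus> b)" unfolding yb(3) kj(3)
          using kj yb subalgD(5)[OF H(1)] J'(3) I'(3) by (intro M.a_assoc) auto
        moreover have "j \<oplus> b \<in> I" using kj yb J by (intro subsp_add I') auto
        ultimately show ?thesis using kj by blast
      qed
      moreover have "x \<in> H" if x: "x \<in> M" and norm: "\<forall>h\<in>H. h \<otimes> x \<in> H \<and> x \<otimes> h \<in> H" for x
      proof -
        obtain y b where yb: "y \<in> N" "b \<in> I" "x = y \<oplus> b" using dec[OF x] by blast
        \<comment> \<open>\<open>h\<close> need not lie in its own null component \<open>N\<close>,
          since \<open>h h\<close> may be nonzero. Its component \<open>k\<close> in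
          \<open>N\<close> differs from it by an element of \<open>I\<close> and therefore still
          acts invertibly on \<open>I/J\<close>.\<close>
        obtain k a where ka: "k \<in> N" "a \<in> I" "h = k \<oplus> a" using dec[OF h(1)] by blast
        have c: "k \<in> carrier L" "a \<in> carrier L" "y \<in> carrier L" "b \<in> carrier L" "h \<in> carrier L"
          using yb ka N'(3) I'(3) h(1) M'(3) by blast+
        have "h \<ominus> k = a" using c by (simp add: ka(3) a_minus_def M.a_ac M.r_neg)
        then have "nilmod h I J = nilmod k I J"
          using chief_nilmod_cong[OF M ch sol h(1)] ka NM by blast
        then have kJ: "nilmod k I J = J" using h(2) by simp
        obtain k' j where k': "k' \<in> H" "j \<in> J" "k = k' \<oplus> j" using Hdec[OF ka(1)] by blast
        have "k' \<otimes> x \<in> N" using norm k' H(3) by blast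
        moreover have "j \<otimes> x \<in> N" using J'(6)[OF x k'(2)] JN by blast
        moreover have "k \<otimes> x = k' \<otimes> x \<oplus> j \<otimes> x"
          unfolding k'(3) using k' subalgD(5)[OF H(1)] J'(3) M'(5)[OF x] by (intro mult_add_left) auto
        ultimately have "k \<otimes> x \<in> N" using subsp_add[OF N'(1)] by simp
        then have "k \<otimes> y \<oplus> k \<otimes> b \<in> N" using c yb(3) mult_add_right by simp
        \<comment> \<open>So \<open>k b\<close> lies in \<open>N \<inter> I = J\<close>, and
          invertibility of \<open>k\<close> on \<open>I/J\<close> forces \<open>b\<close> into
          \<open>J\<close>.\<close>
        then have "k \<otimes> b \<in> N"
          by (rule subsp_add_cancel_left[OF N'(1) N'(4)[OF ka(1) yb(1)] mult_closed[OF c(1,4)]])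
        then have "k \<otimes> b \<in> J" using NI I'(5)[OF _ yb(2)] ka NM by blast
        then have "b \<in> J" using nilmod_stepI[OF yb(2)] kJ by blast
        then have "x \<in> N" using yb JN subsp_add[OF N'(1)] by blast
        then show ?thesis using Hnorm norm by blast
      qed
      ultimately show ?thesis using H NM by (intro exI[of _ H]) blast
    qed
  qed
qed


section \<open>Automorphisms and epimorphisms\<close>

lemma exp_left_mult_eq: "y \<in> carrier L \<Longrightarrow> exp_left_mult L x y = exp_op (\<lambda>z. x \<otimes> z) y"
  by (simp add: exp_left_mult_def exp_op_def)

lemma exp_left_mult_series_sums:
  "x \<in> carrier L \<Longrightarrow> y \<in> carrier L \<Longrightarrow>
    series_sums L (\<lambda>r. (1 / fact r) \<odot> (((\<lambda>z. x \<otimes> z) ^^ r) y)) (exp_left_mult L x y)"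
  by (simp add: exp_left_mult_eq exp_op_series_sums linop_left_mult)

lemma exp_left_mult_closed [simp]:
  "x \<in> carrier L \<Longrightarrow> y \<in> carrier L \<Longrightarrow> exp_left_mult L x y \<in> carrier L"
  by (simp add: exp_left_mult_eq exp_op_closed linop_left_mult)

lemma exp_left_mult_inverse:
  assumes x: "x \<in> carrier L" and y: "y \<in> carrier L"
  shows "exp_left_mult L (\<ominus> x) (exp_left_mult L x y) = y"
proof -
  have "\<ominus> x \<otimes> z = \<ominus> (x \<otimes> z)" if "z \<in> carrier L" for z
    using that x by (simp add: neg_eq_scale mult_smult_left)
  then have "exp_op (\<lambda>z. \<ominus> x \<otimes> z) (exp_op (\<lambda>z. x \<otimes> z) y) = y"
    by (intro exp_op_inverse linop_left_mult x y M.a_inv_closed)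
  then show ?thesis
    using x y exp_op_closed[OF linop_left_mult[OF x] y] by (simp add: exp_left_mult_eq)
qed

lemma exp_left_mult_automorphism:
  assumes x: "x \<in> carrier L"
  shows "exp_left_mult L x \<in> algebra_automorphisms L"
  unfolding algebra_automorphisms_def
proof (intro CollectI conjI ballI allI)
  note D = linop_left_mult[OF x]
  note E = linopD(2,3)[OF exp_op_linop[OF D]]
  have "bij_betw (exp_left_mult L x) (carrier L) (carrier L)"
  proof (rule bij_betw_byWitness[where f' = "exp_left_mult L (\<ominus> x)"])
    show "\<forall>y\<in>carrier L. exp_left_mult L (\<ominus> x) (exp_left_mult L x y) = y"
      using exp_left_mult_inverse[OF x] by blast
    show "\<forall>y\<in>carrier L. exp_left_mult L x (exp_left_mult L (\<ominus> x) y) = y"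
      using exp_left_mult_inverse[of "\<ominus> x"] x by simp
  qed (use x in auto)
  then show "exp_left_mult L x \<in> Bij (carrier L)"
    by (simp add: Bij_def exp_left_mult_def)
  fix y z assume yz: "y \<in> carrier L" "z \<in> carrier L"
  show "exp_left_mult L x (y \<oplus> z) = exp_left_mult L x y \<oplus> exp_left_mult L x z"
    using E(1) yz by (simp add: exp_left_mult_eq)
  have "exp_op (\<lambda>z. x \<otimes> z) (y \<otimes> z) = exp_op (\<lambda>z. x \<otimes> z) y \<otimes> exp_op (\<lambda>z. x \<otimes> z) z"
    by (rule exp_op_mult[OF D _ yz]) (rule left_leibniz[OF x])
  then show "exp_left_mult L x (y \<otimes> z) = exp_left_mult L x y \<otimes> exp_left_mult L x z"
    using yz by (simp add: exp_left_mult_eq)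
next
  fix a y assume "y \<in> carrier L"
  then show "exp_left_mult L x (a \<odot> y) = a \<odot> exp_left_mult L x y"
    using linopD(3)[OF exp_op_linop[OF linop_left_mult[OF x]]] by (simp add: exp_left_mult_eq)
qed

lemma automorphismD:
  assumes "f \<in> algebra_automorphisms L"
  shows "f \<in> Bij (carrier L)" "bij_betw f (carrier L) (carrier L)"
    "x \<in> carrier L \<Longrightarrow> f x \<in> carrier L"
    "x \<in> carrier L \<Longrightarrow> y \<in> carrier L \<Longrightarrow> f (x \<oplus> y) = f x \<oplus> f y"
    "x \<in> carrier L \<Longrightarrow> f (a \<odot> x) = a \<odot> f x"
    "x \<in> carrier L \<Longrightarrow> y \<in> carrier L \<Longrightarrow> f (x \<otimes> y) = f x \<otimes> f y"
  using assms bij_betwE[of f "carrier L" "carrier L"]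
  by (auto simp: algebra_automorphisms_def Bij_def)

lemma automorphisms_subgroup: "subgroup (algebra_automorphisms L) (BijGroup (carrier L))"
proof (rule group.subgroupI[OF group_BijGroup])
  show "algebra_automorphisms L \<subseteq> carrier (BijGroup (carrier L))"
    using automorphismD(1) by (auto simp: BijGroup_def)
  have "(\<lambda>x\<in>carrier L. x) \<in> algebra_automorphisms L"
    by (simp add: algebra_automorphisms_def id_Bij)
  then show "algebra_automorphisms L \<noteq> {}" by blast
next
  fix f assume f: "f \<in> algebra_automorphisms L"
  note f' = automorphismD[OF f]
  define g where "g = (\<lambda>x\<in>carrier L. inv_into (carrier L) f x)"
  have g: "g \<in> Bij (carrier L)" unfolding g_def by (rule restrict_inv_into_Bij[OF f'(1)])
  have gc: "g x \<in> carrier L" if "x \<in> carrier L" for x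
    using Bij_imp_funcset[OF g] that by auto
  have fg: "f (g x) = x" if "x \<in> carrier L" for x
    using that f'(2) by (simp add: g_def bij_betw_inv_into_right)
  have gf: "g (f x) = x" if "x \<in> carrier L" for x
    using that f'(2,3) by (simp add: g_def bij_betw_inv_into_left)
  have "inv\<^bsub>BijGroup (carrier L)\<^esub> f = g"
    unfolding g_def by (rule inv_BijGroup[OF f'(1)])
  moreover have "g \<in> algebra_automorphisms L"
    unfolding algebra_automorphisms_def
  proof (intro CollectI conjI ballI allI g)
    fix x y assume xy: "x \<in> carrier L" "y \<in> carrier L"
    show "g (x \<oplus> y) = g x \<oplus> g y" using gf[of "g x \<oplus> g y"] f'(4)[of "g x" "g y"] fg gc xy by simp
    show "g (x \<otimes> y) = g x \<otimes> g y" using gf[of "g x \<otimes> g y"] f'(6)[of "g x" "g y"] fg gc xy by simp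
  next
    fix a x assume x: "x \<in> carrier L"
    show "g (a \<odot> x) = a \<odot> g x" using gf[of "a \<odot> g x"] f'(5)[of "g x" a] fg gc x by simp
  qed
  ultimately show "inv\<^bsub>BijGroup (carrier L)\<^esub> f \<in> algebra_automorphisms L" by simp
next
  fix f g assume f: "f \<in> algebra_automorphisms L" and g: "g \<in> algebra_automorphisms L"
  note f' = automorphismD[OF f] and g' = automorphismD[OF g]
  have "compose (carrier L) f g \<in> algebra_automorphisms L"
    unfolding algebra_automorphisms_def
    using compose_Bij[OF f'(1) g'(1)] f' g' by (auto simp: compose_def)
  then show "f \<otimes>\<^bsub>BijGroup (carrier L)\<^esub> g \<in> algebra_automorphisms L"
    using f'(1) g'(1) by (simp add: BijGroup_def)
qed

lemma group_automorphism_group: "group (automorphism_group L)"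
  unfolding automorphism_group_def
  by (rule subgroup.subgroup_is_group[OF automorphisms_subgroup group_BijGroup])

lemma automorphism_group_mult:
  "\<lbrakk>f \<in> algebra_automorphisms L; g \<in> algebra_automorphisms L; x \<in> carrier L\<rbrakk> \<Longrightarrow>
    (f \<otimes>\<^bsub>automorphism_group L\<^esub> g) x = f (g x)"
  using automorphismD(1) by (simp add: automorphism_group_def BijGroup_def compose_def)

lemma automorphism_group_simps:
  "carrier (automorphism_group L) = algebra_automorphisms L"
  "\<one>\<^bsub>automorphism_group L\<^esub> = (\<lambda>x\<in>carrier L. x)"
  by (simp_all add: automorphism_group_def BijGroup_def)

lemma automorphism_group_inv:
  assumes f: "f \<in> algebra_automorphisms L" and x: "x \<in> carrier L"
  shows "(inv\<^bsub>automorphism_group L\<^esub> f) (f x) = x" "f ((inv\<^bsub>automorphism_group L\<^esub> f) x) = x"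
proof -
  interpret A: group "automorphism_group L" by (rule group_automorphism_group)
  have i: "inv\<^bsub>automorphism_group L\<^esub> f \<in> algebra_automorphisms L"
    using A.inv_closed[of f] f by (simp add: automorphism_group_simps)
  show "(inv\<^bsub>automorphism_group L\<^esub> f) (f x) = x"
    using A.l_inv[of f] automorphism_group_mult[OF i f x] f x by (simp add: automorphism_group_simps)
  show "f ((inv\<^bsub>automorphism_group L\<^esub> f) x) = x"
    using A.r_inv[of f] automorphism_group_mult[OF f i x] f x by (simp add: automorphism_group_simps)
qed

lemma exp_subset: "exp_left_mult L ` carrier L \<subseteq> carrier (automorphism_group L)"
  using exp_left_mult_automorphism by (auto simp: automorphism_group_simps)

lemma I_star_automorphism: "\<beta> \<in> I_star L \<Longrightarrow> \<beta> \<in> algebra_automorphisms L"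
  using group.generate_in_carrier[OF group_automorphism_group exp_subset]
  by (simp add: I_star_def automorphism_group_simps)

lemma I_star_exp: "x \<in> carrier L \<Longrightarrow> exp_left_mult L x \<in> I_star L"
  unfolding I_star_def by (intro generate.incl imageI)

lemma conjugate_refl: "U \<subseteq> carrier L \<Longrightarrow> conjugate_in L U U"
  unfolding conjugate_in_def I_star_def
  using generate.one[of "automorphism_group L" "exp_left_mult L ` carrier L"]
  by (intro bexI[of _ "\<one>\<^bsub>automorphism_group L\<^esub>"]) (auto simp: automorphism_group_simps image_def)

lemma conjugate_trans:
  assumes "U \<subseteq> carrier L" "conjugate_in L U V" "conjugate_in L V W"
  shows "conjugate_in L U W"
proof -
  obtain \<beta> \<gamma> where b: "\<beta> \<in> I_star L" "\<beta> ` U = V" and c: "\<gamma> \<in> I_star L" "\<gamma> ` V = W"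
    using assms by (auto simp: conjugate_in_def)
  have "\<gamma> \<otimes>\<^bsub>automorphism_group L\<^esub> \<beta> \<in> I_star L"
    using b c unfolding I_star_def by (blast intro: generate.eng)
  moreover have "(\<gamma> \<otimes>\<^bsub>automorphism_group L\<^esub> \<beta>) ` U = \<gamma> ` \<beta> ` U"
    unfolding image_image using assms(1) b c
    by (intro image_cong refl automorphism_group_mult I_star_automorphism) auto
  ultimately show ?thesis using b c unfolding conjugate_in_def by metis
qed

lemma conjugate_sym:
  assumes "U \<subseteq> carrier L" "conjugate_in L U V"
  shows "conjugate_in L V U"
proof -
  obtain \<beta> where b: "\<beta> \<in> I_star L" "\<beta> ` U = V" using assms by (auto simp: conjugate_in_def)
  have "inv\<^bsub>automorphism_group L\<^esub> \<beta> \<in> I_star L"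
    using b group.generate_m_inv_closed[OF group_automorphism_group exp_subset] by (simp add: I_star_def)
  moreover have "(inv\<^bsub>automorphism_group L\<^esub> \<beta>) ` \<beta> ` U = U"
    unfolding image_image using assms(1) automorphism_group_inv(1)[OF I_star_automorphism[OF b(1)]]
    by (auto simp: image_def subset_iff)
  ultimately show ?thesis using b unfolding conjugate_in_def by metis
qed

end

text \<open>Serves both the projection to the quotient by the radical and automorphisms of
  \<open>L\<close>, so one lemma on images of Cartan subalgebras covers the two situations.\<close>

locale leibniz_epi = A: real_leibniz_algebra L + B: real_leibniz_algebra Q
  for L :: "(real, 'a, 'm) module_scheme" (structure) and Q :: "(real, 'c, 'n) module_scheme" (structure) +
  fixes \<pi> :: "'a \<Rightarrow> 'c"
  assumes surj: "\<pi> ` carrier L = carrier Q"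
    and hom_add: "x \<in> carrier L \<Longrightarrow> y \<in> carrier L \<Longrightarrow> \<pi> (x \<oplus>\<^bsub>L\<^esub> y) = \<pi> x \<oplus>\<^bsub>Q\<^esub> \<pi> y"
    and hom_scale: "x \<in> carrier L \<Longrightarrow> \<pi> (a \<odot>\<^bsub>L\<^esub> x) = a \<odot>\<^bsub>Q\<^esub> \<pi> x"
    and hom_mult: "x \<in> carrier L \<Longrightarrow> y \<in> carrier L \<Longrightarrow> \<pi> (x \<otimes>\<^bsub>L\<^esub> y) = \<pi> x \<otimes>\<^bsub>Q\<^esub> \<pi> y"
begin

definition ker :: "'a set" where "ker = {x \<in> carrier L. \<pi> x = \<zero>\<^bsub>Q\<^esub>}"

lemma hom_closed: "x \<in> carrier L \<Longrightarrow> \<pi> x \<in> carrier Q"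
  using surj by blast

lemma hom_zero: "\<pi> \<zero>\<^bsub>L\<^esub> = \<zero>\<^bsub>Q\<^esub>"
  using hom_scale[of "\<zero>\<^bsub>L\<^esub>" 0] hom_closed[of "\<zero>\<^bsub>L\<^esub>"] by simp

lemma hom_diff: "x \<in> carrier L \<Longrightarrow> y \<in> carrier L \<Longrightarrow> \<pi> (x \<ominus>\<^bsub>L\<^esub> y) = \<pi> x \<ominus>\<^bsub>Q\<^esub> \<pi> y"
  by (simp add: a_minus_def A.neg_eq_scale B.neg_eq_scale hom_add hom_scale hom_closed)

lemma subsp_image: assumes W: "A.subsp W" shows "B.subsp (\<pi> ` W)"
proof (rule B.subspI)
  note c = A.subsp_in_carrier[OF W]
  show "\<pi> ` W \<subseteq> carrier Q" using c hom_closed by auto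
  show "\<zero>\<^bsub>Q\<^esub> \<in> \<pi> ` W" using A.subsp_zero[OF W] hom_zero by (metis imageI)
  show "x \<oplus>\<^bsub>Q\<^esub> y \<in> \<pi> ` W" if xy: "x \<in> \<pi> ` W" "y \<in> \<pi> ` W" for x y
  proof -
    obtain u v where uv: "u \<in> W" "v \<in> W" "x = \<pi> u" "y = \<pi> v" using xy by blast
    then have "x \<oplus>\<^bsub>Q\<^esub> y = \<pi> (u \<oplus>\<^bsub>L\<^esub> v)" using c hom_add by simp
    then show ?thesis using A.subsp_add[OF W uv(1,2)] by simp
  qed
  show "a \<odot>\<^bsub>Q\<^esub> x \<in> \<pi> ` W" if x: "x \<in> \<pi> ` W" for a x
  proof -
    obtain u where u: "u \<in> W" "x = \<pi> u" using x by blast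
    then have "a \<odot>\<^bsub>Q\<^esub> x = \<pi> (a \<odot>\<^bsub>L\<^esub> u)" using c hom_scale by simp
    then show ?thesis using A.subsp_scale[OF W u(1)] by simp
  qed
qed

lemma subsp_preimage: assumes V: "B.subsp V" shows "A.subsp {x \<in> carrier L. \<pi> x \<in> V}"
  by (rule A.subspI)
    (auto simp: hom_zero hom_add hom_scale B.subsp_zero[OF V] B.subsp_add[OF V] B.subsp_scale[OF V])

lemma subalg_image:
  assumes "A.subalg U" shows "B.subalg (\<pi> ` U)"
  unfolding subalgebra_of_def
proof (intro conjI ballI subsp_image A.subalgD(1)[OF assms])
  fix x y assume "x \<in> \<pi> ` U" "y \<in> \<pi> ` U"
  then obtain u v where uv: "u \<in> U" "v \<in> U" "x = \<pi> u" "y = \<pi> v" by blast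
  then have "x \<otimes>\<^bsub>Q\<^esub> y = \<pi> (u \<otimes>\<^bsub>L\<^esub> v)" using hom_mult A.subalgD(5)[OF assms] by simp
  then show "x \<otimes>\<^bsub>Q\<^esub> y \<in> \<pi> ` U" using A.subalgD(4)[OF assms uv(1,2)] by simp
qed

lemma ker_mideal:
  assumes "A.subalg M" "ker \<subseteq> M" shows "A.mideal M ker"
proof -
  have "A.subsp ker" using subsp_preimage[OF B.subsp_zero_set] by (simp add: ker_def)
  then show ?thesis
    using assms A.subalgD(5)[OF assms(1)]
    by (auto simp: A.mideal_def ker_def hom_mult hom_closed)
qed

lemma nilpotent_image:
  assumes U: "A.subsp U" and nil: "nilpotent_in L U" shows "nilpotent_in Q (\<pi> ` U)"
proof -
  obtain n where n: "A.lcs U n = {\<zero>\<^bsub>L\<^esub>}" using nil by (auto simp: nilpotent_in_def)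
  have "B.lcs (\<pi> ` U) n \<subseteq> \<pi> ` A.lcs U n"
  proof (rule B.lcs_least)
    show "B.subsp (\<pi> ` A.lcs U n)" for n by (intro subsp_image A.lcs_subsp U)
    fix n u v assume "u \<in> \<pi> ` U" "v \<in> \<pi> ` A.lcs U n"
    then obtain a b where ab: "a \<in> U" "b \<in> A.lcs U n" "u = \<pi> a" "v = \<pi> b" by blast
    then have "u \<otimes>\<^bsub>Q\<^esub> v = \<pi> (a \<otimes>\<^bsub>L\<^esub> b)"
      using hom_mult A.subsp_in_carrier[OF U] A.subsp_in_carrier[OF A.lcs_subsp[OF U]] by simp
    then show "u \<otimes>\<^bsub>Q\<^esub> v \<in> \<pi> ` A.lcs U (Suc n)" using A.lcs_mult[OF ab(1,2)] by blast
  qed simp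
  then show ?thesis using B.nilpotent_inI[OF subsp_image[OF U]] n hom_zero by simp
qed

text \<open>Lift a normalizing \<open>y\<close> to \<open>x\<close>. The preimage \<open>W\<close>
  of the image of \<open>H\<close> is \<open>H\<close>-stable and contains \<open>H\<close> and all
  \<open>h x\<close>, so \<open>cartan_absorb\<close> puts \<open>x\<close> into
  \<open>W\<close>.\<close>

lemma cartan_image:
  assumes H: "A.cartan H" shows "B.cartan (\<pi> ` H)"
proof (rule B.cartanI)
  note H' = A.cartanD[OF H]
  show "B.subalg (\<pi> ` H)" by (rule subalg_image[OF H'(1)])
  show "nilpotent_in Q (\<pi> ` H)" by (rule nilpotent_image[OF H'(3,2)])
  fix y assume y: "y \<in> carrier Q" "\<And>h. h \<in> \<pi> ` H \<Longrightarrow> h \<otimes>\<^bsub>Q\<^esub> y \<in> \<pi> ` H"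
  obtain x where x: "x \<in> carrier L" "y = \<pi> x" using y surj by blast
  define W where "W = {x \<in> carrier L. \<pi> x \<in> \<pi> ` H}"
  have "x \<in> W"
  proof (rule A.cartan_absorb[OF H])
    show "A.subsp W" unfolding W_def by (intro subsp_preimage subsp_image H')
    show "A.stable H W"
      using H'(6) B.subalgD(4)[OF subalg_image[OF H'(1)]] by (auto simp: A.stable_def W_def hom_mult)
    show "H \<subseteq> W" using H'(6) by (auto simp: W_def)
    show "h \<otimes>\<^bsub>L\<^esub> x \<in> W" if "h \<in> H" for h
      using that y(2)[of "\<pi> h"] x H'(6) by (auto simp: W_def hom_mult)
  qed (rule x)
  then show "y \<in> \<pi> ` H" using x by (simp add: W_def)
qed

text \<open>A functional on \<open>Q\<close> composed with \<open>\<pi>\<close> is a functional on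
  \<open>L\<close>; this takes the place of continuity of \<open>\<pi>\<close>. Uniqueness of sums
  then identifies the limits.\<close>

lemma exp_commute:
  assumes x: "x \<in> carrier L" and y: "y \<in> carrier L"
  shows "\<pi> (exp_left_mult L x y) = exp_left_mult Q (\<pi> x) (\<pi> y)"
proof (rule B.series_sums_unique)
  have pow: "((\<lambda>z. x \<otimes>\<^bsub>L\<^esub> z) ^^ r) y \<in> carrier L" for r
    using A.lpow_closed[OF x y] by (simp add: A.lpow_def)
  have pow_hom: "\<pi> (((\<lambda>z. x \<otimes>\<^bsub>L\<^esub> z) ^^ r) y) = ((\<lambda>z. \<pi> x \<otimes>\<^bsub>Q\<^esub> z) ^^ r) (\<pi> y)" for r
    by (induction r) (simp_all add: hom_mult x pow)
  show "series_sums Q (\<lambda>r. (1 / fact r) \<odot>\<^bsub>Q\<^esub> (((\<lambda>z. \<pi> x \<otimes>\<^bsub>Q\<^esub> z) ^^ r) (\<pi> y))) (\<pi> (exp_left_mult L x y))"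
    unfolding series_sums_def
  proof (intro conjI allI impI hom_closed A.exp_left_mult_closed x y)
    fix \<phi> assume \<phi>: "linear_functional Q \<phi>"
    have "linear_functional L (\<lambda>z. \<phi> (\<pi> z))"
      using \<phi> by (simp add: linear_functional_def hom_add hom_scale hom_closed)
    then have "(\<lambda>r. \<phi> (\<pi> ((1 / fact r) \<odot>\<^bsub>L\<^esub> (((\<lambda>z. x \<otimes>\<^bsub>L\<^esub> z) ^^ r) y)))) sums \<phi> (\<pi> (exp_left_mult L x y))"
      using A.exp_left_mult_series_sums[OF x y, unfolded series_sums_def, THEN conjunct2,
          THEN spec[of _ "\<lambda>z. \<phi> (\<pi> z)"]] by simp
    then show "(\<lambda>r. \<phi> ((1 / fact r) \<odot>\<^bsub>Q\<^esub> (((\<lambda>z. \<pi> x \<otimes>\<^bsub>Q\<^esub> z) ^^ r) (\<pi> y)))) sums \<phi> (\<pi> (exp_left_mult L x y))"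
      by (simp add: hom_scale pow pow_hom)
  qed
  show "series_sums Q (\<lambda>r. (1 / fact r) \<odot>\<^bsub>Q\<^esub> (((\<lambda>z. \<pi> x \<otimes>\<^bsub>Q\<^esub> z) ^^ r) (\<pi> y))) (exp_left_mult Q (\<pi> x) (\<pi> y))"
    by (rule B.exp_left_mult_series_sums[OF hom_closed hom_closed, OF x y])
qed

text \<open>A relation, not an induced map, so that pushing automorphisms down and lifting them up
  are the same kind of induction on words in the generators.\<close>

definition covers :: "('a \<Rightarrow> 'a) \<Rightarrow> ('c \<Rightarrow> 'c) \<Rightarrow> bool" where
  "covers \<beta> \<gamma> \<longleftrightarrow> (\<forall>x\<in>carrier L. \<pi> (\<beta> x) = \<gamma> (\<pi> x))"

lemma covers_one: "covers \<one>\<^bsub>automorphism_group L\<^esub> \<one>\<^bsub>automorphism_group Q\<^esub>"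
  by (simp add: covers_def A.automorphism_group_simps B.automorphism_group_simps hom_closed)

lemma covers_exp: "x \<in> carrier L \<Longrightarrow> covers (exp_left_mult L x) (exp_left_mult Q (\<pi> x))"
  by (simp add: covers_def exp_commute)

lemma covers_mult:
  assumes "\<beta> \<in> algebra_automorphisms L" "\<beta>' \<in> algebra_automorphisms L"
    "\<gamma> \<in> algebra_automorphisms Q" "\<gamma>' \<in> algebra_automorphisms Q" "covers \<beta> \<gamma>" "covers \<beta>' \<gamma>'"
  shows "covers (\<beta> \<otimes>\<^bsub>automorphism_group L\<^esub> \<beta>') (\<gamma> \<otimes>\<^bsub>automorphism_group Q\<^esub> \<gamma>')"
  using assms A.automorphismD(3)[OF assms(2)]
  by (simp add: covers_def A.automorphism_group_mult B.automorphism_group_mult hom_closed)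

lemma covers_inv:
  assumes b: "\<beta> \<in> algebra_automorphisms L" and c: "\<gamma> \<in> algebra_automorphisms Q" and "covers \<beta> \<gamma>"
  shows "covers (inv\<^bsub>automorphism_group L\<^esub> \<beta>) (inv\<^bsub>automorphism_group Q\<^esub> \<gamma>)"
  unfolding covers_def
proof
  fix x assume x: "x \<in> carrier L"
  define y where "y = (inv\<^bsub>automorphism_group L\<^esub> \<beta>) x"
  have "inv\<^bsub>automorphism_group L\<^esub> \<beta> \<in> algebra_automorphisms L"
    using group.inv_closed[OF A.group_automorphism_group, of \<beta>] b by (simp add: A.automorphism_group_simps)
  then have y: "y \<in> carrier L" unfolding y_def using A.automorphismD(3) x by blast
  have "\<pi> x = \<gamma> (\<pi> y)"
    using assms(3)[unfolded covers_def, rule_format, OF y] A.automorphism_group_inv(2)[OF b x]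
    by (simp add: y_def)
  then show "\<pi> y = (inv\<^bsub>automorphism_group Q\<^esub> \<gamma>) (\<pi> x)"
    using B.automorphism_group_inv(1)[OF c hom_closed[OF y]] by simp
qed

lemma I_star_push: "\<beta> \<in> I_star L \<Longrightarrow> \<exists>\<gamma>\<in>I_star Q. covers \<beta> \<gamma>"
  unfolding I_star_def
proof (induction rule: generate.induct)
  case one
  show ?case by (rule bexI, rule covers_one, rule generate.one)
next
  case (incl h)
  then obtain x where x: "x \<in> carrier L" and h: "h = exp_left_mult L x" by auto
  show ?case unfolding h
    by (rule bexI, rule covers_exp[OF x], rule generate.incl, rule imageI, rule hom_closed[OF x])
next
  case (inv h)
  then obtain x where x: "x \<in> carrier L" and h: "h = exp_left_mult L x" by auto
  have c: "covers (inv\<^bsub>automorphism_group L\<^esub> h) (inv\<^bsub>automorphism_group Q\<^esub> exp_left_mult Q (\<pi> x))"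
    unfolding h by (intro covers_inv covers_exp hom_closed A.exp_left_mult_automorphism
        B.exp_left_mult_automorphism x)
  show ?case by (rule bexI, rule c, rule generate.inv, rule imageI, rule hom_closed[OF x])
next
  case (eng f g)
  obtain f' g' where f': "covers f f'" "f' \<in> I_star Q" and g': "covers g g'" "g' \<in> I_star Q"
    using eng.IH unfolding I_star_def by (elim bexE)
  have fg: "f \<in> I_star L" "g \<in> I_star L" using eng.hyps by (simp_all add: I_star_def)
  have "covers (f \<otimes>\<^bsub>automorphism_group L\<^esub> g) (f' \<otimes>\<^bsub>automorphism_group Q\<^esub> g')"
    by (intro covers_mult A.I_star_automorphism B.I_star_automorphism f' g' fg)
  then show ?case
    by (rule bexI[OF _ generate.eng[OF f'(2)[unfolded I_star_def] g'(2)[unfolded I_star_def]]])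
qed

text \<open>Surjectivity supplies an \<open>x\<close> over each generator of the group of
  \<open>Q\<close>; its exponential covers that generator, and covering is compatible with products
  and inverses.\<close>

lemma I_star_lift: "\<gamma> \<in> I_star Q \<Longrightarrow> \<exists>\<beta>\<in>I_star L. covers \<beta> \<gamma>"
  unfolding I_star_def
proof (induction rule: generate.induct)
  case one
  show ?case by (rule bexI, rule covers_one, rule generate.one)
next
  case (incl h)
  then obtain x where x: "x \<in> carrier L" and h: "h = exp_left_mult Q (\<pi> x)"
    using surj by (metis imageE)
  show ?case unfolding h by (rule bexI, rule covers_exp[OF x], rule generate.incl, rule imageI[OF x])
next
  case (inv h)
  then obtain x where x: "x \<in> carrier L" and h: "h = exp_left_mult Q (\<pi> x)"
    using surj by (metis imageE)
  have c: "covers (inv\<^bsub>automorphism_group L\<^esub> exp_left_mult L x) (inv\<^bsub>automorphism_group Q\<^esub> h)"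
    unfolding h by (intro covers_inv covers_exp hom_closed A.exp_left_mult_automorphism
        B.exp_left_mult_automorphism x)
  show ?case by (rule bexI, rule c, rule generate.inv, rule imageI[OF x])
next
  case (eng f' g')
  obtain f g where f: "covers f f'" "f \<in> I_star L" and g: "covers g g'" "g \<in> I_star L"
    using eng.IH unfolding I_star_def by (elim bexE)
  have fg: "f' \<in> I_star Q" "g' \<in> I_star Q" using eng.hyps by (simp_all add: I_star_def)
  have "covers (f \<otimes>\<^bsub>automorphism_group L\<^esub> g) (f' \<otimes>\<^bsub>automorphism_group Q\<^esub> g')"
    by (intro covers_mult A.I_star_automorphism B.I_star_automorphism f g fg)
  then show ?case
    by (rule bexI[OF _ generate.eng[OF f(2)[unfolded I_star_def] g(2)[unfolded I_star_def]]])
qed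

lemma covers_image:
  assumes "covers \<beta> \<gamma>" "U \<subseteq> carrier L"
  shows "\<pi> ` \<beta> ` U = \<gamma> ` \<pi> ` U"
  using assms by (auto simp: covers_def image_image intro!: image_cong)

lemma conjugate_image:
  assumes "U \<subseteq> carrier L" "conjugate_in L U V" shows "conjugate_in Q (\<pi> ` U) (\<pi> ` V)"
proof -
  obtain \<beta> where b: "\<beta> \<in> I_star L" "\<beta> ` U = V" using assms(2) unfolding conjugate_in_def by blast
  then obtain \<gamma> where "\<gamma> \<in> I_star Q" "covers \<beta> \<gamma>" using I_star_push by blast
  then show ?thesis using covers_image[OF _ assms(1)] b unfolding conjugate_in_def by blast
qed

end

lemma (in real_leibniz_algebra) automorphism_epi:
  assumes "\<beta> \<in> algebra_automorphisms L" shows "leibniz_epi L L \<beta>"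
proof (intro leibniz_epi.intro leibniz_epi_axioms.intro)
  note b = automorphismD[OF assms]
  show "real_leibniz_algebra L" "real_leibniz_algebra L" by (rule real_leibniz_algebra_axioms)+
  show "\<beta> ` carrier L = carrier L" using b(2) by (rule bij_betw_imp_surj_on)
qed (simp_all add: automorphismD[OF assms])

context real_leibniz_algebra
begin

section \<open>Conjugacy above a solvable ideal\<close>

definition decomp :: "'a set \<Rightarrow> 'a set \<Rightarrow> 'a set \<Rightarrow> bool" where
  "decomp M H I \<longleftrightarrow> (\<forall>x\<in>M. \<exists>h\<in>H. \<exists>a\<in>I. x = h \<oplus> a)"

lemma decompE:
  assumes "decomp M H I" "x \<in> M"
  obtains h a where "h \<in> H" "a \<in> I" "x = h \<oplus> a"
  using assms by (auto simp: decomp_def)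

text \<open>\<open>M/I\<close> is an image of the nilpotent \<open>H\<close>, so its lower central
  series vanishes as soon as that of \<open>H\<close> does.\<close>

lemma lcs_over_nilpotent:
  assumes M: "subalg M" and I: "mideal M I" and H: "subalg H" "nilpotent_in L H" "H \<subseteq> M"
    and dec: "decomp M H I"
  obtains n where "lcs M n \<subseteq> I"
proof -
  note M' = subalgD[OF M] and I' = midealD[OF I] and H' = subalgD[OF H(1)]
  obtain n where n: "lcs H n = {\<zero>}" using H(2) by (auto simp: nilpotent_in_def)
  have F: "subsp (lcs H k <+>\<^bsub>L\<^esub> I)" for k by (intro subsp_set_add lcs_subsp H' I')
  have "lcs M n \<subseteq> lcs H n <+>\<^bsub>L\<^esub> I"
  proof (rule lcs_least[OF _ F])
    show "M \<subseteq> lcs H 0 <+>\<^bsub>L\<^esub> I" using dec by (auto simp: decomp_def intro: set_addI)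
    fix k u v assume u: "u \<in> M" and v: "v \<in> lcs H k <+>\<^bsub>L\<^esub> I"
    obtain h a where ha: "h \<in> H" "a \<in> I" "u = h \<oplus> a" using decompE[OF dec u] .
    obtain s b where sb: "s \<in> lcs H k" "b \<in> I" "v = s \<oplus> b" using set_addE[OF v] .
    have sH: "s \<in> H" using sb lcs_subset[OF H(1)] by blast
    have c: "h \<in> carrier L" "a \<in> carrier L" "s \<in> carrier L" "b \<in> carrier L"
      using H'(3) I'(3) ha(1,2) sb(2) sH by blast+
    have "u \<otimes> v = h \<otimes> s \<oplus> (h \<otimes> b \<oplus> (a \<otimes> s \<oplus> a \<otimes> b))"
      using c by (simp add: ha(3) sb(3) mult_add_left mult_add_right M.a_ac)
    moreover have "h \<otimes> b \<oplus> (a \<otimes> s \<oplus> a \<otimes> b) \<in> I"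
      using H(3) I'(2) ha sb sH by (intro subsp_add[OF I'(1)] I'(5,6)) auto
    ultimately show "u \<otimes> v \<in> lcs H (Suc k) <+>\<^bsub>L\<^esub> I"
      using set_addI[OF lcs_mult[OF ha(1) sb(1)]] by simp
  qed
  also have "\<dots> \<subseteq> I" unfolding n using subsp_zero[OF I'(1)] by (intro set_add_least I'(1)) auto
  finally show thesis by (rule that)
qed

text \<open>Every \<open>h\<close> in \<open>H\<close> sends \<open>I\<close> into \<open>J\<close>,
  hence into the \<open>H\<close>-stable subspace \<open>H + J\<close>; \<open>cartan_absorb\<close>
  then puts all of \<open>I\<close> into \<open>H + J\<close>.\<close>

lemma cartan_decomp_refine:
  assumes H: "cartan H" "H \<subseteq> M" and M: "subalg M" and I: "mideal M I" and J: "mideal M J" "J \<subseteq> I"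
    and MI: "\<And>m a. m \<in> M \<Longrightarrow> a \<in> I \<Longrightarrow> m \<otimes> a \<in> J" and dec: "decomp M H I"
  shows "decomp M H J"
  unfolding decomp_def
proof
  note H' = cartanD[OF H(1)] and I' = midealD[OF I] and J' = midealD[OF J(1)]
  have W: "subsp (H <+>\<^bsub>L\<^esub> J)" "stable H (H <+>\<^bsub>L\<^esub> J)" "H \<subseteq> H <+>\<^bsub>L\<^esub> J" "J \<subseteq> H <+>\<^bsub>L\<^esub> J"
    using stable_subset[OF J'(4) H(2)]
    by (intro subsp_set_add stable_set_add set_add_upper1 set_add_upper2 H' J'; assumption)+
  have IW: "I \<subseteq> H <+>\<^bsub>L\<^esub> J"
  proof
    fix a assume a: "a \<in> I"
    show "a \<in> H <+>\<^bsub>L\<^esub> J"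
    proof (rule cartan_absorb[OF H(1) W(1-3)])
      show "a \<in> carrier L" using a I'(3) by blast
      show "h \<otimes> a \<in> H <+>\<^bsub>L\<^esub> J" if "h \<in> H" for h using MI[OF _ a] that H(2) W(4) by blast
    qed
  qed
  fix x assume "x \<in> M"
  then obtain h a where ha: "h \<in> H" "a \<in> I" "x = h \<oplus> a" using decompE[OF dec] by blast
  have "x \<in> H <+>\<^bsub>L\<^esub> J" unfolding ha(3) using ha W(3) IW by (intro subsp_add[OF W(1)]) auto
  then show "\<exists>h\<in>H. \<exists>a\<in>J. x = h \<oplus> a" unfolding set_add_def' by blast
qed

text \<open>A nilpotent \<open>H\<close> lies in the null component of each of its elements. For the
  decomposition, the \<open>I\<close>-part of an element of the null component lies there too, and
  the null component meets \<open>I\<close> in \<open>J\<close>.\<close>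

lemma nilmod_cartan:
  assumes H: "cartan H" "H \<subseteq> M" and M: "subalg M" and I: "mideal M I" and J: "mideal M J" "J \<subseteq> I"
    and dec: "decomp M H I" and h: "h \<in> H" "nilmod h I J = J"
  shows "H \<subseteq> nilmod h M J" "decomp (nilmod h M J) H J"
proof -
  note H' = cartanD[OF H(1)] and I' = midealD[OF I] and J' = midealD[OF J(1)]
  have hM: "h \<in> M" using h H by blast
  note N = subalgD[OF nilmod_subalg[OF M J(1) hM]]
  obtain n where n: "\<And>h x. h \<in> H \<Longrightarrow> x \<in> H \<Longrightarrow> lpow h n x = \<zero>"
    using nilpotent_lpow[OF H'(2)] by blast
  show HN: "H \<subseteq> nilmod h M J"
  proof
    fix x assume x: "x \<in> H"
    have "lpow h n x \<in> J" using n[OF h(1) x] subsp_zero[OF J'(1)] by simp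
    then show "x \<in> nilmod h M J" using x H(2) unfolding nilmod_def by blast
  qed
  show "decomp (nilmod h M J) H J"
    unfolding decomp_def
  proof
    fix x assume x: "x \<in> nilmod h M J"
    then have "x \<in> M" by (simp add: nilmod_def)
    then obtain y b where yb: "y \<in> H" "b \<in> I" "x = y \<oplus> b" using decompE[OF dec] by blast
    have "y \<oplus> b \<in> nilmod h M J" "y \<in> nilmod h M J" using x yb HN by auto
    then have "b \<in> nilmod h M J"
      using subsp_add_cancel_left[OF N(1), of y b] yb I'(3) by blast
    then have "b \<in> J" using nilmod_Int[OF I'(2), of h J] h(2) yb(2) by blast
    then show "\<exists>h\<in>H. \<exists>a\<in>J. x = h \<oplus> a" using yb by blast
  qed
qed

text \<open>Since \<open>h a\<close> is in \<open>h I\<close>, the Fitting argument on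
  \<open>h I\<close> gives \<open>h b\<close> with \<open>a - h b\<close> killed by a power of
  \<open>h\<close>; by assumption such an element of \<open>I\<close> is in
  \<open>J\<close>.\<close>

lemma nilmod_trivial_surj:
  assumes M: "subalg M" and I: "mideal M I" and J: "mideal M J" and h: "h \<in> M" "nilmod h I J = J"
    and a: "a \<in> I"
  obtains b where "b \<in> I" "a \<ominus> h \<otimes> b \<in> J"
proof -
  note M' = subalgD[OF M] and I' = midealD[OF I] and J' = midealD[OF J]
  have hc: "h \<in> carrier L" and ac: "a \<in> carrier L" using h M' a I' by auto
  have W: "subsp (lpow h 1 ` I)" by (intro subsp_image lpow_linop hc I')
  have st: "stable {h} (lpow h 1 ` I)"
    using I'(5)[OF h(1)] by (auto simp: stable_def lpow_Suc)
  have "lpow h 1 a \<in> lpow h 1 ` I" using a by (rule imageI)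
  then obtain w m where w: "w \<in> lpow h 1 ` I" "lpow h m (a \<ominus> w) = \<zero>"
    using fitting[OF hc W st ac] by blast
  then obtain b where b: "b \<in> I" "w = h \<otimes> b" by (auto simp: lpow_Suc)
  have "a \<ominus> h \<otimes> b \<in> I" using a b I'(5)[OF h(1)] by (intro subsp_diff[OF I'(1)])
  moreover have "lpow h m (a \<ominus> h \<otimes> b) \<in> J" using w b subsp_zero[OF J'(1)] by simp
  ultimately have "a \<ominus> h \<otimes> b \<in> J" using h(2) unfolding nilmod_def by blast
  then show thesis using b that by blast
qed

lemma automorphism_lpow:
  assumes "\<beta> \<in> algebra_automorphisms L" "h \<in> carrier L" "x \<in> carrier L"
  shows "\<beta> (lpow h k x) = lpow (\<beta> h) k (\<beta> x)"
  using assms by (induction k) (simp_all add: lpow_Suc automorphismD(6))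

lemma exp_left_mult_stable:
  assumes "b \<in> carrier L" "subsp W" "stable {b} W" "x \<in> W"
  shows "exp_left_mult L b x \<in> W"
proof -
  have "x \<in> carrier L" using subsp_in_carrier assms by blast
  then show ?thesis
    using lpow_stable[OF assms(3) _ assms(4), of b] assms
    by (simp add: exp_left_mult_eq lpow_def exp_op_in_subsp linop_left_mult)
qed

text \<open>Moving \<open>h\<close> by \<open>exp (L\<^sub>b)\<close> changes it by \<open>b h \<equiv> - h b\<close> modulo \<open>J\<close>, and
  \<open>b\<close> is chosen so that \<open>h b\<close> is the difference of the two elements.\<close>

lemma nilmod_conjugate:
  assumes M: "subalg M" and ch: "chief M I J" and sol: "solvable_in L I"
    and anti: "\<And>a m. a \<in> I \<Longrightarrow> m \<in> M \<Longrightarrow> m \<otimes> a \<oplus> a \<otimes> m \<in> J"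
    and h: "h \<in> M" "nilmod h I J = J" and k: "k \<in> M" "h \<ominus> k \<in> I"
  obtains \<beta> where "\<beta> \<in> I_star L" "\<beta> ` nilmod h M J = nilmod k M J" "\<beta> ` J \<subseteq> J"
proof -
  have I: "mideal M I" and J: "mideal M J" "J \<subset> I" using ch by (auto simp: chief_def)
  note M' = subalgD[OF M] and I' = midealD[OF I] and J' = midealD[OF J(1)]
  obtain b where b: "b \<in> I" "(h \<ominus> k) \<ominus> h \<otimes> b \<in> J"
    using nilmod_trivial_surj[OF M I J(1) h k(2)] .
  have bM: "b \<in> M" using b I' by blast
  have c: "h \<in> carrier L" "k \<in> carrier L" "b \<in> carrier L" using h k bM M' by auto
  define \<beta> where "\<beta> = exp_left_mult L b"
  define \<beta>' where "\<beta>' = exp_left_mult L (\<ominus> b)"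
  have aut: "\<beta> \<in> algebra_automorphisms L" "\<beta>' \<in> algebra_automorphisms L"
    unfolding \<beta>_def \<beta>'_def using c by (auto intro: exp_left_mult_automorphism)
  have inv: "\<beta>' (\<beta> x) = x" "\<beta> (\<beta>' x) = x" if "x \<in> carrier L" for x
    unfolding \<beta>_def \<beta>'_def
    using exp_left_mult_inverse[OF c(3) that] exp_left_mult_inverse[of "\<ominus> b" x] c that by auto
  have nbM: "\<ominus> b \<in> M" using bM subsp_neg[OF M'(1)] by blast
  have st: "stable {v} M" "stable {v} J" if "v \<in> M" for v
    using stable_subset[OF M'(2)] stable_subset[OF J'(4)] that by auto
  have \<beta>M: "\<beta> x \<in> M" "\<beta>' x \<in> M" if "x \<in> M" for x
    unfolding \<beta>_def \<beta>'_def using c that bM nbM by (auto intro!: exp_left_mult_stable M'(1) st)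
  have \<beta>J: "\<beta> x \<in> J" "\<beta>' x \<in> J" if "x \<in> J" for x
    unfolding \<beta>_def \<beta>'_def using c that bM nbM by (auto intro!: exp_left_mult_stable J'(1) st)
  have \<beta>h: "\<beta> h \<ominus> (h \<oplus> b \<otimes> h) \<in> J"
    unfolding \<beta>_def exp_left_mult_eq[OF c(1)]
  proof (rule exp_op_first_order[OF J'(1) linop_left_mult[OF c(3)] c(1)])
    fix r
    \<comment> \<open>From the second order on the exponential series stays in \<open>J\<close>,
      because \<open>b\<close> and \<open>b h\<close> are both in \<open>I\<close> and
      \<open>I/J\<close> is abelian.\<close>
    have "b \<otimes> h \<in> I" by (rule I'(6)[OF h(1) b(1)])
    then have "b \<otimes> (b \<otimes> h) \<in> J" by (rule chief_abelian[OF M ch sol b(1)])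
    then have "lpow b r (b \<otimes> (b \<otimes> h)) \<in> J" using lpow_stable[OF J'(4) bM] by blast
    then have "lpow b (r + 2) h \<in> J" by (simp add: lpow_Suc2)
    then show "((\<lambda>z. b \<otimes> z) ^^ (r + 2)) h \<in> J" by (simp add: lpow_def)
  qed
  \<comment> \<open>Three elements of \<open>J\<close> that telescope: the higher-order error, the
    symmetrised product, and the defect in the choice of \<open>b\<close>.\<close>
  have "(\<beta> h \<ominus> (h \<oplus> b \<otimes> h)) \<oplus> ((h \<otimes> b \<oplus> b \<otimes> h) \<oplus> ((h \<ominus> k) \<ominus> h \<otimes> b)) \<in> J"
    by (intro subsp_add[OF J'(1)] \<beta>h b anti h)
  also have "(\<beta> h \<ominus> (h \<oplus> b \<otimes> h)) \<oplus> ((h \<otimes> b \<oplus> b \<otimes> h) \<oplus> ((h \<ominus> k) \<ominus> h \<otimes> b)) = \<beta> h \<ominus> k"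
  proof (rule vec_eqI)
    fix \<phi> assume "lin \<phi>"
    then show "\<phi> ((\<beta> h \<ominus> (h \<oplus> b \<otimes> h)) \<oplus> ((h \<otimes> b \<oplus> b \<otimes> h) \<oplus> ((h \<ominus> k) \<ominus> h \<otimes> b))) = \<phi> (\<beta> h \<ominus> k)"
      using c automorphismD(3)[OF aut(1) c(1)] by (simp add: lin_simps)
  qed (use c automorphismD(3)[OF aut(1) c(1)] in auto)
  finally have diff: "\<beta> h \<ominus> k \<in> J" .
  have bhM: "\<beta> h \<in> M" using \<beta>M h by blast
  \<comment> \<open>\<open>\<beta> h - k\<close> lies in \<open>J\<close> and so sends all of
    \<open>M\<close> into \<open>J\<close>.\<close>
  have eq: "nilmod (\<beta> h) M J = nilmod k M J"
    using J'(6)[OF _ diff] by (intro nilmod_cong M' bhM k st J'(1)) auto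
  have "\<beta> ` nilmod h M J = nilmod (\<beta> h) M J"
  proof
    show "\<beta> ` nilmod h M J \<subseteq> nilmod (\<beta> h) M J"
    proof
      fix y assume "y \<in> \<beta> ` nilmod h M J"
      then obtain x n where x: "x \<in> M" "lpow h n x \<in> J" "y = \<beta> x" by (auto simp: nilmod_def)
      have "lpow (\<beta> h) n y \<in> J"
        using \<beta>J(1)[OF x(2)] automorphism_lpow[OF aut(1) c(1) M'(5)[OF x(1)]] x(3) by simp
      then show "y \<in> nilmod (\<beta> h) M J" using \<beta>M(1)[OF x(1)] x(3) unfolding nilmod_def by blast
    qed
    show "nilmod (\<beta> h) M J \<subseteq> \<beta> ` nilmod h M J"
    proof
      fix y assume "y \<in> nilmod (\<beta> h) M J"
      then obtain n where y: "y \<in> M" "lpow (\<beta> h) n y \<in> J" by (auto simp: nilmod_def)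
      have "lpow h n (\<beta>' y) \<in> J"
        using \<beta>J(2)[OF y(2)] automorphism_lpow[OF aut(2) M'(5)[OF bhM] M'(5)[OF y(1)], of n] inv(1)[OF c(1)]
        by simp
      then have "\<beta>' y \<in> nilmod h M J" using \<beta>M(2)[OF y(1)] unfolding nilmod_def by blast
      then show "y \<in> \<beta> ` nilmod h M J" using inv(2)[OF M'(5)[OF y(1)]] by force
    qed
  qed
  then show thesis using that[of \<beta>] I_star_exp[OF c(3)] \<beta>J(1) eq by (auto simp: \<beta>_def)
qed

lemma cartan_automorphism:
  "\<beta> \<in> algebra_automorphisms L \<Longrightarrow> cartan H \<Longrightarrow> cartan (\<beta> ` H)"
  by (rule leibniz_epi.cartan_image[OF automorphism_epi])

text \<open>\<open>K\<close> stays fixed while \<open>H\<close> may be replaced by its image under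
  an automorphism, so \<open>H\<close> is generalised along with \<open>I\<close> and
  \<open>M\<close>. The Cartan property refers to \<open>L\<close> throughout and is unaffected by
  shrinking \<open>M\<close>.\<close>

lemma cartan_conjugate_over_solvable:
  assumes "subalg M" "mideal M I" "solvable_in L I" "cartan H" "H \<subseteq> M" "decomp M H I"
    "cartan K" "K \<subseteq> M" "decomp M K I"
  shows "conjugate_in L H K"
  using assms
proof (induction "rank I" arbitrary: I M H rule: less_induct)
  case less
  note M = less.prems(1) and I = less.prems(2) and sol = less.prems(3)
    and H = less.prems(4,5) and Hd = less.prems(6) and K = less.prems(7,8) and Kd = less.prems(9)
  note M' = subalgD[OF M] and I' = midealD[OF I] and H' = cartanD[OF H(1)] and K' = cartanD[OF K(1)]
  show ?case
  proof (cases "I = {\<zero>}")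
    case True
    have "x \<in> H" if "x \<in> M" for x
      using decompE[OF Hd that] True H'(6) by (metis M.r_zero singletonD)
    moreover have "x \<in> K" if "x \<in> M" for x
      using decompE[OF Kd that] True K'(6) by (metis M.r_zero singletonD)
    ultimately have "H = K" using H(2) K(2) by blast
    then show ?thesis using conjugate_refl H'(5) by blast
  next
    case False
    then obtain J where ch: "chief M I J" using chief_exists[OF M I] by blast
    then have J: "mideal M J" "J \<subset> I" by (auto simp: chief_def)
    then have JI: "J \<subseteq> I" by blast
    note J' = midealD[OF J(1)]
    have rk: "rank J < rank I" by (intro rank_less J' I' J)
    have solJ: "solvable_in L J" by (rule solvable_mono[OF sol J'(1) JI I'(3)])
    obtain n where lcs: "lcs M n \<subseteq> I" using lcs_over_nilpotent[OF M I H'(1,2) H(2) Hd] .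
    show ?thesis
    proof (cases "\<forall>h\<in>M. nilmod h I J = I")
      case True
      then have MI: "m \<otimes> a \<in> J" if "m \<in> M" "a \<in> I" for m a
        using chief_nil(1)[OF M ch sol lcs _ that] by blast
      have "decomp M H J" by (rule cartan_decomp_refine[OF H M I J(1) JI MI Hd])
      moreover have "decomp M K J" by (rule cartan_decomp_refine[OF K M I J(1) JI MI Kd])
      ultimately show ?thesis using less.hyps[OF rk M J(1) solJ H] K by blast
    next
      case False
      then obtain x where x: "x \<in> M" "nilmod x I J = J" using chief_nilmod[OF M ch sol lcs] by blast
      \<comment> \<open>Elements congruent modulo \<open>I\<close> act alike on \<open>I/J\<close>,
        so the invertible action of \<open>x\<close> passes to representatives \<open>h\<close> in
        \<open>H\<close> and \<open>k\<close> in \<open>K\<close>.\<close>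
      obtain h a where h: "h \<in> H" "a \<in> I" "x = h \<oplus> a" using decompE[OF Hd x(1)] .
      obtain k b where k: "k \<in> K" "b \<in> I" "x = k \<oplus> b" using decompE[OF Kd x(1)] .
      have hkM: "h \<in> M" "k \<in> M" using h k H K by auto
      have c: "h \<in> carrier L" "a \<in> carrier L" "k \<in> carrier L" "b \<in> carrier L"
        using hkM M'(5) h(2) k(2) I'(3) by blast+
      have "x \<ominus> h = a" unfolding h(3) using c by (simp add: a_minus_def M.a_ac M.r_neg)
      then have xh: "x \<ominus> h \<in> I" using h(2) by simp
      have "x \<ominus> k = b" unfolding k(3) using c by (simp add: a_minus_def M.a_ac M.r_neg)
      then have xk: "x \<ominus> k \<in> I" using k(2) by simp
      have "h \<ominus> k = (x \<ominus> k) \<ominus> (x \<ominus> h)"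
        by (rule vec_eqI) (use c h(3) in \<open>auto simp: lin_simps\<close>)
      then have hk: "h \<ominus> k \<in> I" using subsp_diff[OF I'(1) xk xh] by simp
      have nh: "nilmod h I J = J" "nilmod k I J = J"
        using chief_nilmod_cong[OF M ch sol x(1) hkM(1) xh] chief_nilmod_cong[OF M ch sol x(1) hkM(2) xk] x
        by auto
      define N where "N = nilmod k M J"
      have N: "subalg N" unfolding N_def by (rule nilmod_subalg[OF M J(1) hkM(2)])
      have NM: "N \<subseteq> M" and JN: "J \<subseteq> N"
        unfolding N_def using nilmod_upper[OF J'(2)] by (auto simp: nilmod_def)
      have NJ: "mideal N J" by (rule mideal_subset[OF J(1) NM JN])
      have KN: "K \<subseteq> N" "decomp N K J"
        unfolding N_def by (rule nilmod_cartan[OF K M I J(1) JI Kd k(1) nh(2)])+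
      have HN: "H \<subseteq> nilmod h M J" "decomp (nilmod h M J) H J"
        by (rule nilmod_cartan[OF H M I J(1) JI Hd h(1) nh(1)])+
      from chief_right_action[OF M ch] show ?thesis
      proof
        \<comment> \<open>Here \<open>h - k\<close> sends \<open>M\<close> into \<open>J\<close>, so
          \<open>h\<close> and \<open>k\<close> have the same null component.\<close>
        assume IM: "\<forall>a\<in>I. \<forall>m\<in>M. a \<otimes> m \<in> J"
        have "stable {h} M" "stable {k} M" "stable {h} J"
          using stable_subset[OF M'(2)] stable_subset[OF J'(4)] hkM by auto
        then have "nilmod h M J = N"
          unfolding N_def using IM hk by (intro nilmod_cong c M' J'(1)) auto
        then show ?thesis using less.hyps[OF rk N NJ solJ H(1)] HN KN K(1) by simp
      next
        assume anti: "\<forall>a\<in>I. \<forall>m\<in>M. m \<otimes> a \<oplus> a \<otimes> m \<in> J"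
        obtain \<beta> where \<beta>: "\<beta> \<in> I_star L" "\<beta> ` nilmod h M J = N" "\<beta> ` J \<subseteq> J"
          unfolding N_def using nilmod_conjugate[OF M ch sol _ hkM(1) nh(1) hkM(2) hk] anti by blast
        note aut = I_star_automorphism[OF \<beta>(1)]
        \<comment> \<open>\<open>\<beta>\<close> maps the null component of \<open>h\<close> onto
          \<open>N\<close> and \<open>J\<close> into \<open>J\<close>, so it carries the
          decomposition along.\<close>
        have "decomp N (\<beta> ` H) J"
          unfolding decomp_def
        proof
          fix y assume "y \<in> N"
          then obtain u where u: "u \<in> nilmod h M J" "y = \<beta> u" using \<beta>(2) by blast
          obtain v j where v: "v \<in> H" "j \<in> J" "u = v \<oplus> j" using decompE[OF HN(2) u(1)] .
          have "y = \<beta> v \<oplus> \<beta> j"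
            unfolding u(2) v(3) using v H'(6) J'(3) by (intro automorphismD(4)[OF aut]) auto
          then show "\<exists>h\<in>\<beta> ` H. \<exists>a\<in>J. y = h \<oplus> a" using v \<beta>(3) by blast
        qed
        moreover have "\<beta> ` H \<subseteq> N" using \<beta>(2) HN(1) by blast
        ultimately have "conjugate_in L (\<beta> ` H) K"
          using less.hyps[OF rk N NJ solJ cartan_automorphism[OF aut H(1)]] K(1) KN by blast
        moreover have "conjugate_in L H (\<beta> ` H)" using \<beta>(1) unfolding conjugate_in_def by blast
        ultimately show ?thesis using conjugate_trans H'(5) by blast
      qed
    qed
  qed
qed

end

context leibniz_epi
begin

lemma preimage_subalg:
  assumes "B.subalg U" shows "A.subalg {x \<in> carrier L. \<pi> x \<in> U}"
  unfolding subalgebra_of_def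
  using subsp_preimage[OF B.subalgD(1)[OF assms]] B.subalgD(4)[OF assms] by (auto simp: hom_mult)

lemma preimage_decomp:
  assumes H: "H \<subseteq> carrier L" shows "A.decomp {x \<in> carrier L. \<pi> x \<in> \<pi> ` H} H ker"
  unfolding A.decomp_def
proof
  fix x assume "x \<in> {x \<in> carrier L. \<pi> x \<in> \<pi> ` H}"
  then obtain h where h: "h \<in> H" "\<pi> x = \<pi> h" and x: "x \<in> carrier L" by blast
  have hc: "h \<in> carrier L" using h H by blast
  have "x \<ominus>\<^bsub>L\<^esub> h \<in> ker"
    using x hc h hom_closed by (simp add: ker_def hom_diff) (simp add: a_minus_def B.M.r_neg)
  moreover have "x = h \<oplus>\<^bsub>L\<^esub> (x \<ominus>\<^bsub>L\<^esub> h)"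
    using A.diff_add_cancel[OF x hc] A.M.a_comm[of h "x \<ominus>\<^bsub>L\<^esub> h"] x hc by simp
  ultimately show "\<exists>h\<in>H. \<exists>a\<in>ker. x = h \<oplus>\<^bsub>L\<^esub> a" using h by blast
qed

text \<open>After applying a lift of the conjugating automorphism, both Cartan subalgebras have the
  same image. They then lie in its preimage \<open>M\<close> and supplement the solvable kernel
  there.\<close>

lemma conjugate_lift:
  assumes sol: "solvable_in L ker" and H: "A.cartan H" and K: "A.cartan K"
    and conj: "conjugate_in Q (\<pi> ` H) (\<pi> ` K)"
  shows "conjugate_in L H K"
proof -
  note H' = A.cartanD[OF H] and K' = A.cartanD[OF K]
  obtain \<gamma> where \<gamma>: "\<gamma> \<in> I_star Q" "\<gamma> ` \<pi> ` H = \<pi> ` K" using conj by (auto simp: conjugate_in_def)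
  obtain \<beta> where \<beta>: "\<beta> \<in> I_star L" "covers \<beta> \<gamma>" using I_star_lift[OF \<gamma>(1)] by blast
  have im: "\<pi> ` \<beta> ` H = \<pi> ` K" using covers_image[OF \<beta>(2) H'(5)] \<gamma>(2) by simp
  have bH: "A.cartan (\<beta> ` H)" by (rule A.cartan_automorphism[OF A.I_star_automorphism[OF \<beta>(1)] H])
  define M where "M = {x \<in> carrier L. \<pi> x \<in> \<pi> ` K}"
  have M: "A.subalg M" unfolding M_def by (intro preimage_subalg subalg_image K')
  have "\<zero>\<^bsub>Q\<^esub> \<in> \<pi> ` K" using A.subsp_zero[OF K'(3)] hom_zero by (metis imageI)
  then have kM: "ker \<subseteq> M" by (auto simp: M_def ker_def)
  have "A.decomp M (\<beta> ` H) ker"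
    using preimage_decomp[OF A.cartanD(5)[OF bH]] by (simp add: M_def im)
  moreover have "A.decomp M K ker" using preimage_decomp[OF K'(5)] by (simp add: M_def)
  moreover have "\<beta> ` H \<subseteq> M" "K \<subseteq> M"
    using im A.cartanD(5)[OF bH] K'(5) unfolding M_def by auto
  ultimately have "conjugate_in L (\<beta> ` H) K"
    using A.cartan_conjugate_over_solvable[OF M ker_mideal[OF M kM] sol bH] K by blast
  moreover have "conjugate_in L H (\<beta> ` H)" using \<beta>(1) unfolding conjugate_in_def by blast
  ultimately show ?thesis using A.conjugate_trans H'(5) by blast
qed

text \<open>The preimage \<open>M\<close> of \<open>C\<close> is nilpotent modulo the kernel, so the
  existence lemma gives an \<open>H\<close> that is self-normalizing in \<open>M\<close>; the Cartan
  property of \<open>C\<close> extends this to \<open>L\<close>.\<close>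

lemma cartan_lift:
  assumes sol: "solvable_in L ker" and C: "B.cartan C"
  shows "\<exists>H. A.cartan H \<and> \<pi> ` H = C"
proof -
  note C' = B.cartanD[OF C]
  define M where "M = {x \<in> carrier L. \<pi> x \<in> C}"
  have M: "A.subalg M" unfolding M_def by (rule preimage_subalg[OF C'(1)])
  have kM: "ker \<subseteq> M" using B.subsp_zero[OF C'(3)] by (auto simp: M_def ker_def)
  obtain n where n: "B.lcs C n = {\<zero>\<^bsub>Q\<^esub>}" using C'(2) by (auto simp: nilpotent_in_def)
  have "A.lcs M n \<subseteq> {x \<in> carrier L. \<pi> x \<in> B.lcs C n}"
  proof (rule A.lcs_least)
    show "A.subsp {x \<in> carrier L. \<pi> x \<in> B.lcs C k}" for k
      by (intro subsp_preimage B.lcs_subsp C')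
    show "u \<otimes>\<^bsub>L\<^esub> v \<in> {x \<in> carrier L. \<pi> x \<in> B.lcs C (Suc k)}"
      if "u \<in> M" "v \<in> {x \<in> carrier L. \<pi> x \<in> B.lcs C k}" for k u v
      using that B.lcs_mult[of "\<pi> u" C "\<pi> v" k] by (simp add: M_def hom_mult)
  qed (simp add: M_def)
  also have "\<dots> = ker" by (simp add: n ker_def)
  finally obtain H where H: "A.subalg H" "nilpotent_in L H" "H \<subseteq> M"
    and dec: "\<And>x. x \<in> M \<Longrightarrow> \<exists>h\<in>H. \<exists>a\<in>ker. x = h \<oplus>\<^bsub>L\<^esub> a"
    and norm: "\<And>x. x \<in> M \<Longrightarrow> (\<forall>h\<in>H. h \<otimes>\<^bsub>L\<^esub> x \<in> H \<and> x \<otimes>\<^bsub>L\<^esub> h \<in> H) \<Longrightarrow> x \<in> H"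
    using A.cartan_exists_over_solvable[OF M ker_mideal[OF M kM] sol] by blast
  note H' = A.subalgD[OF H(1)]
  have im: "\<pi> ` H = C"
  proof
    show "\<pi> ` H \<subseteq> C" using H(3) by (auto simp: M_def)
    show "C \<subseteq> \<pi> ` H"
    proof
      fix y assume y: "y \<in> C"
      then obtain x where x: "x \<in> carrier L" "y = \<pi> x" using C'(6) surj by blast
      then obtain h a where ha: "h \<in> H" "a \<in> ker" "x = h \<oplus>\<^bsub>L\<^esub> a" using dec[of x] y by (auto simp: M_def)
      then have "y = \<pi> h \<oplus>\<^bsub>Q\<^esub> \<zero>\<^bsub>Q\<^esub>" using x(2) H'(5) by (simp add: ker_def hom_add)
      then show "y \<in> \<pi> ` H" using ha H'(5) hom_closed by simp
    qed
  qed
  have "A.cartan H"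
  proof (rule A.cartanI[OF H(1,2)])
    fix x assume x: "x \<in> carrier L" "\<And>h. h \<in> H \<Longrightarrow> h \<otimes>\<^bsub>L\<^esub> x \<in> H" "\<And>h. h \<in> H \<Longrightarrow> x \<otimes>\<^bsub>L\<^esub> h \<in> H"
    \<comment> \<open>The image of an element normalizing \<open>H\<close> normalizes
      \<open>C\<close>, hence lies in \<open>C\<close>; this places \<open>x\<close> in
      \<open>M\<close>.\<close>
    have "\<pi> x \<in> C"
    proof (rule C'(7)[OF hom_closed[OF x(1)]])
      fix y assume "y \<in> C"
      then obtain h where h: "h \<in> H" "y = \<pi> h" using im by blast
      show "y \<otimes>\<^bsub>Q\<^esub> \<pi> x \<in> C" "\<pi> x \<otimes>\<^bsub>Q\<^esub> y \<in> C"
        using x(2,3)[OF h(1)] h x(1) H'(5) im hom_mult[symmetric] by auto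
    qed
    then show "x \<in> H" using norm x by (simp add: M_def)
  qed
  then show ?thesis using im by blast
qed

end

section \<open>The quotient by the radical\<close>

text \<open>All identities are read off on representatives. For finite dimension, the preimage of a
  subspace containing the image of \<open>B\<close> is a subspace containing \<open>B\<close>, hence
  everything.\<close>

lemma (in real_leibniz_algebra) real_leibniz_algebra_image:
  fixes Q :: "(real, 'c, 'n) module_scheme"
  assumes surj: "\<pi> ` carrier L = carrier Q" and zero: "\<pi> \<zero> = \<zero>\<^bsub>Q\<^esub>"
    and add: "\<And>x y. x \<in> carrier L \<Longrightarrow> y \<in> carrier L \<Longrightarrow> \<pi> (x \<oplus> y) = \<pi> x \<oplus>\<^bsub>Q\<^esub> \<pi> y"
    and scale: "\<And>a x. x \<in> carrier L \<Longrightarrow> \<pi> (a \<odot> x) = a \<odot>\<^bsub>Q\<^esub> \<pi> x"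
    and mult: "\<And>x y. x \<in> carrier L \<Longrightarrow> y \<in> carrier L \<Longrightarrow> \<pi> (x \<otimes> y) = \<pi> x \<otimes>\<^bsub>Q\<^esub> \<pi> y"
  shows "real_leibniz_algebra Q"
proof -
  note hom = add[symmetric] scale[symmetric] mult[symmetric] zero[symmetric]
  have cl: "\<pi> x \<in> carrier Q" if "x \<in> carrier L" for x using that surj by blast
  have Q: "P y" if "\<And>x. x \<in> carrier L \<Longrightarrow> P (\<pi> x)" "y \<in> carrier Q" for P y
    using that surj by (metis imageE)
  have group: "abelian_group Q"
  proof (rule abelian_groupI)
    fix x assume "x \<in> carrier Q"
    then obtain u where u: "u \<in> carrier L" "x = \<pi> u" using surj by blast
    show "\<exists>y\<in>carrier Q. y \<oplus>\<^bsub>Q\<^esub> x = \<zero>\<^bsub>Q\<^esub>"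
      using u cl[of "\<ominus> u"] by (intro bexI[of _ "\<pi> (\<ominus> u)"]) (simp_all add: hom M.l_neg)
    show "\<zero>\<^bsub>Q\<^esub> \<oplus>\<^bsub>Q\<^esub> x = x" using u by (simp add: hom)
    fix y assume "y \<in> carrier Q"
    then obtain v where v: "v \<in> carrier L" "y = \<pi> v" using surj by blast
    show "x \<oplus>\<^bsub>Q\<^esub> y \<in> carrier Q" using u v by (simp add: hom cl)
    show "x \<oplus>\<^bsub>Q\<^esub> y = y \<oplus>\<^bsub>Q\<^esub> x" using u v by (simp add: hom M.a_comm)
    fix z assume "z \<in> carrier Q"
    then obtain w where w: "w \<in> carrier L" "z = \<pi> w" using surj by blast
    show "x \<oplus>\<^bsub>Q\<^esub> y \<oplus>\<^bsub>Q\<^esub> z = x \<oplus>\<^bsub>Q\<^esub> (y \<oplus>\<^bsub>Q\<^esub> z)" using u v w by (simp add: hom M.a_assoc)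
  qed (metis M.zero_closed cl zero)
  have mod: "module real_ring Q"
  proof (rule moduleI[OF cring_from_type_algebra group])
    fix a b :: real and x assume "x \<in> carrier Q"
    then obtain u where u: "u \<in> carrier L" "x = \<pi> u" using surj by blast
    show "a \<odot>\<^bsub>Q\<^esub> x \<in> carrier Q" "\<one>\<^bsub>real_ring\<^esub> \<odot>\<^bsub>Q\<^esub> x = x" using u by (simp_all add: hom cl)
    show "(a \<oplus>\<^bsub>real_ring\<^esub> b) \<odot>\<^bsub>Q\<^esub> x = a \<odot>\<^bsub>Q\<^esub> x \<oplus>\<^bsub>Q\<^esub> b \<odot>\<^bsub>Q\<^esub> x"
      "(a \<otimes>\<^bsub>real_ring\<^esub> b) \<odot>\<^bsub>Q\<^esub> x = a \<odot>\<^bsub>Q\<^esub> (b \<odot>\<^bsub>Q\<^esub> x)"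
      using u by (simp_all add: hom scale_add scale_assoc)
    fix y assume "y \<in> carrier Q"
    then obtain v where v: "v \<in> carrier L" "y = \<pi> v" using surj by blast
    show "a \<odot>\<^bsub>Q\<^esub> (x \<oplus>\<^bsub>Q\<^esub> y) = a \<odot>\<^bsub>Q\<^esub> x \<oplus>\<^bsub>Q\<^esub> a \<odot>\<^bsub>Q\<^esub> y"
      using u v by (simp add: hom scale_add_right)
  qed
  interpret Q: module real_ring Q by (rule mod)
  obtain B where B: "finite B" "B \<subseteq> carrier L" "subsp hull B = carrier L"
    using finite_dimensional by blast
  have "(\<lambda>W. submodule W real_ring Q) hull (\<pi> ` B) = carrier Q"
  proof (rule hull_unique)
    show "\<pi> ` B \<subseteq> carrier Q" using B cl by auto
    show "submodule (carrier Q) real_ring Q" by (rule Q.carrier_is_submodule)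
    fix W assume W: "\<pi> ` B \<subseteq> W" "submodule W real_ring Q"
    note W' = Q.submoduleE[OF W(2)]
    have "subsp {x \<in> carrier L. \<pi> x \<in> W}"
    proof (rule subspI)
      obtain w where w: "w \<in> W" using W'(2) by auto
      then have "w \<in> \<pi> ` carrier L" using W'(1) surj by auto
      then obtain u where u: "u \<in> carrier L" "w = \<pi> u" by (rule imageE)
      then have "\<pi> (0 \<odot> u) \<in> W" unfolding scale[OF u(1)] using W'(4)[of 0 w] w by simp
      then show "\<zero> \<in> {x \<in> carrier L. \<pi> x \<in> W}" using u by simp
    qed (use W'(4,5) in \<open>auto simp: add scale\<close>)
    moreover have "B \<subseteq> {x \<in> carrier L. \<pi> x \<in> W}" using B(2) W(1) by blast
    ultimately have "subsp hull B \<subseteq> {x \<in> carrier L. \<pi> x \<in> W}" by (rule_tac hull_minimal)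
    then show "carrier Q \<subseteq> W" unfolding B(3) surj[symmetric] by blast
  qed
  then have fin: "\<exists>B. finite B \<and> B \<subseteq> carrier Q \<and> (\<lambda>W. submodule W real_ring Q) hull B = carrier Q"
    using B cl by (intro exI[of _ "\<pi> ` B"]) auto
  show ?thesis
  proof (rule real_leibniz_algebra.intro[OF mod], rule real_leibniz_algebra_axioms.intro[OF fin])
    fix x y assume "x \<in> carrier Q" "y \<in> carrier Q"
    then obtain u v where u: "u \<in> carrier L" "x = \<pi> u" and v: "v \<in> carrier L" "y = \<pi> v"
      using surj by (metis imageE)
    show "x \<otimes>\<^bsub>Q\<^esub> y \<in> carrier Q" using u v by (simp add: hom cl)
    show "(a \<odot>\<^bsub>Q\<^esub> x) \<otimes>\<^bsub>Q\<^esub> y = a \<odot>\<^bsub>Q\<^esub> (x \<otimes>\<^bsub>Q\<^esub> y)" "x \<otimes>\<^bsub>Q\<^esub> (a \<odot>\<^bsub>Q\<^esub> y) = a \<odot>\<^bsub>Q\<^esub> (x \<otimes>\<^bsub>Q\<^esub> y)" for a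
      using u v by (simp_all add: hom mult_smult_left mult_smult_right)
    fix z assume "z \<in> carrier Q"
    then obtain w where w: "w \<in> carrier L" "z = \<pi> w" using surj by (metis imageE)
    show "(x \<oplus>\<^bsub>Q\<^esub> y) \<otimes>\<^bsub>Q\<^esub> z = x \<otimes>\<^bsub>Q\<^esub> z \<oplus>\<^bsub>Q\<^esub> y \<otimes>\<^bsub>Q\<^esub> z"
      "x \<otimes>\<^bsub>Q\<^esub> (y \<oplus>\<^bsub>Q\<^esub> z) = x \<otimes>\<^bsub>Q\<^esub> y \<oplus>\<^bsub>Q\<^esub> x \<otimes>\<^bsub>Q\<^esub> z"
      using u v w by (simp_all add: hom mult_add_left mult_add_right)
    show "x \<otimes>\<^bsub>Q\<^esub> (y \<otimes>\<^bsub>Q\<^esub> z) = (x \<otimes>\<^bsub>Q\<^esub> y) \<otimes>\<^bsub>Q\<^esub> z \<oplus>\<^bsub>Q\<^esub> y \<otimes>\<^bsub>Q\<^esub> (x \<otimes>\<^bsub>Q\<^esub> z)"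
      using u v w left_leibniz[OF u(1) v(1) w(1)] by (simp add: hom)
  qed
qed

context real_leibniz_algebra
begin

lemma coset_mem: "R \<subseteq> carrier L \<Longrightarrow> x \<in> carrier L \<Longrightarrow> y \<in> R +> x \<longleftrightarrow> y \<in> carrier L \<and> y \<ominus> x \<in> R"
proof
  assume R: "R \<subseteq> carrier L" and x: "x \<in> carrier L"
  show "y \<in> carrier L \<and> y \<ominus> x \<in> R" if y: "y \<in> R +> x"
  proof -
    obtain r where r: "r \<in> R" "y = r \<oplus> x" using y by (auto simp: a_r_coset_def')
    then have "y \<ominus> x = r" using R x by (auto simp: a_minus_def M.a_assoc M.r_neg)
    then show ?thesis using r R x by auto
  qed
  show "y \<in> R +> x" if y: "y \<in> carrier L \<and> y \<ominus> x \<in> R"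
  proof -
    have "y = (y \<ominus> x) \<oplus> x" using diff_add_cancel y x by simp
    then show ?thesis using y by (auto simp: a_r_coset_def')
  qed
qed

lemma coset_eq_iff:
  assumes R: "subsp R" and x: "x \<in> carrier L" and y: "y \<in> carrier L"
  shows "R +> x = R +> y \<longleftrightarrow> x \<ominus> y \<in> R"
proof
  note mem = coset_mem[OF subsp_carrier[OF R]]
  have "x \<in> R +> x" using mem[OF x, of x] x subsp_zero[OF R] by (simp add: a_minus_def M.r_neg)
  then show "x \<ominus> y \<in> R" if "R +> x = R +> y" using that mem[OF y, of x] by blast
  assume xy: "x \<ominus> y \<in> R"
  have "z \<ominus> x \<in> R \<longleftrightarrow> z \<ominus> y \<in> R" if z: "z \<in> carrier L" for z
  proof -
    have "z \<ominus> y = (z \<ominus> x) \<oplus> (x \<ominus> y)" "z \<ominus> x = (z \<ominus> y) \<ominus> (x \<ominus> y)"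
      by (rule vec_eqI; use x y z in \<open>simp add: lin_simps\<close>)+
    then show ?thesis using subsp_add[OF R _ xy] subsp_diff[OF R _ xy] by metis
  qed
  then show "R +> x = R +> y" using mem[OF x] mem[OF y] by blast
qed

lemma quotient_epi:
  assumes R: "ideal_of L R"
  shows "leibniz_epi L (quotient_algebra L R) (\<lambda>x. R +> x)"
    and "leibniz_epi.ker L (quotient_algebra L R) (\<lambda>x. R +> x) = R"
proof -
  let ?Q = "quotient_algebra L R"
  have sR: "subsp R" and RL: "\<And>x r. x \<in> carrier L \<Longrightarrow> r \<in> R \<Longrightarrow> x \<otimes> r \<in> R"
    and RR: "\<And>x r. x \<in> carrier L \<Longrightarrow> r \<in> R \<Longrightarrow> r \<otimes> x \<in> R"
    using R by (auto simp: ideal_of_def)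
  note Rc = subsp_carrier[OF sR] and mem = coset_mem[OF subsp_carrier[OF sR]]
    and eq = coset_eq_iff[OF sR]
  have self: "x \<in> R +> x" if "x \<in> carrier L" for x
    using mem[OF that, of x] that subsp_zero[OF sR] by (simp add: a_minus_def M.r_neg)
  have surj: "(\<lambda>x. R +> x) ` carrier L = carrier ?Q"
    by (auto simp: quotient_algebra_def A_RCOSETS_def')
  have zero: "R +> \<zero> = \<zero>\<^bsub>?Q\<^esub>"
    using mem[OF M.zero_closed] Rc by (auto simp: quotient_algebra_def a_minus_def)
  have add: "R +> (x \<oplus> y) = (R +> x) \<oplus>\<^bsub>?Q\<^esub> (R +> y)" if xy: "x \<in> carrier L" "y \<in> carrier L" for x y
  proof -
    have "(R +> x) <+>\<^bsub>L\<^esub> (R +> y) = R +> (x \<oplus> y)"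
    proof
      show "(R +> x) <+>\<^bsub>L\<^esub> (R +> y) \<subseteq> R +> (x \<oplus> y)"
      proof
        fix z assume "z \<in> (R +> x) <+>\<^bsub>L\<^esub> (R +> y)"
        then obtain u v where uv: "u \<in> R +> x" "v \<in> R +> y" "z = u \<oplus> v" by (rule set_addE)
        then have uv': "u \<in> carrier L" "u \<ominus> x \<in> R" "v \<in> carrier L" "v \<ominus> y \<in> R"
          using mem xy by auto
        have "z \<ominus> (x \<oplus> y) = (u \<ominus> x) \<oplus> (v \<ominus> y)"
          by (rule vec_eqI; use xy uv' uv(3) in \<open>simp add: lin_simps\<close>)
        then show "z \<in> R +> (x \<oplus> y)" using mem xy uv' uv(3) subsp_add[OF sR] by simp
      qed
      show "R +> (x \<oplus> y) \<subseteq> (R +> x) <+>\<^bsub>L\<^esub> (R +> y)"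
      proof
        fix z assume "z \<in> R +> (x \<oplus> y)"
        then obtain r where r: "r \<in> R" "z = r \<oplus> (x \<oplus> y)" by (auto simp: a_r_coset_def')
        then have "z = (r \<oplus> x) \<oplus> y" using xy Rc by (simp add: subset_iff M.a_assoc)
        moreover have "r \<oplus> x \<in> R +> x" using r by (auto simp: a_r_coset_def')
        ultimately show "z \<in> (R +> x) <+>\<^bsub>L\<^esub> (R +> y)" using self[OF xy(2)] set_addI by blast
      qed
    qed
    then show ?thesis by (simp add: quotient_algebra_def)
  qed
  have scale: "R +> (a \<odot> x) = a \<odot>\<^bsub>?Q\<^esub> (R +> x)" if x: "x \<in> carrier L" for a x
  proof -
    \<comment> \<open>All representatives yield the same coset, so the union that defines the scalar
      multiple collapses to it.\<close>
    have *: "R +> (a \<odot> u) = R +> (a \<odot> x)" if "u \<in> R +> x" for u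
    proof -
      have u: "u \<in> carrier L" "u \<ominus> x \<in> R" using mem[OF x, THEN iffD1, OF that] by simp_all
      have "a \<odot> u \<ominus> a \<odot> x = a \<odot> (u \<ominus> x)"
        using x u by (simp add: a_minus_def neg_eq_scale scale_add_right scale_assoc)
      then have "a \<odot> u \<ominus> a \<odot> x \<in> R" using subsp_scale[OF sR u(2)] by simp
      then show ?thesis by (rule eq[OF scale_closed[OF u(1)] scale_closed[OF x], THEN iffD2])
    qed
    have "(\<Union>u\<in>R +> x. R +> (a \<odot> u)) = R +> (a \<odot> x)"
    proof (rule SUP_eq_const)
      show "R +> x \<noteq> {}" using self[OF x] by blast
    qed (rule *)
    then show ?thesis by (simp add: quotient_algebra_def)
  qed
  have mult: "R +> (x \<otimes> y) = (R +> x) \<otimes>\<^bsub>?Q\<^esub> (R +> y)" if xy: "x \<in> carrier L" "y \<in> carrier L" for x y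
  proof -
    \<comment> \<open>The difference is \<open>(u - x) v + x (v - y)\<close>, so both sides of the
      ideal property enter before the union in \<open>rcoset_mult\<close> collapses.\<close>
    have *: "R +> (u \<otimes> v) = R +> (x \<otimes> y)" if "u \<in> R +> x" "v \<in> R +> y" for u v
    proof -
      have uv: "u \<in> carrier L" "u \<ominus> x \<in> R" "v \<in> carrier L" "v \<ominus> y \<in> R"
        using mem[OF xy(1), THEN iffD1, OF that(1)] mem[OF xy(2), THEN iffD1, OF that(2)] by simp_all
      have "u \<otimes> v \<ominus> x \<otimes> y = (u \<ominus> x) \<otimes> v \<oplus> x \<otimes> (v \<ominus> y)"
        by (rule vec_eqI; use xy uv in \<open>simp add: lin_simps mult_diff_left mult_diff_right\<close>)
      also have "\<dots> \<in> R" using RL[OF xy(1) uv(4)] RR[OF uv(3) uv(2)] by (rule_tac subsp_add[OF sR])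
      finally show ?thesis
        by (rule eq[OF mult_closed[OF uv(1,3)] mult_closed[OF xy], THEN iffD2])
    qed
    have "(\<Union>u\<in>R +> x. \<Union>v\<in>R +> y. R +> (u \<otimes> v)) = R +> (x \<otimes> y)"
    proof (rule SUP_eq_const[OF _ SUP_eq_const])
      show "R +> x \<noteq> {}" "R +> y \<noteq> {}" using self[OF xy(1)] self[OF xy(2)] by blast+
    qed (rule *)
    then show ?thesis by (simp add: quotient_algebra_def rcoset_mult_def)
  qed
  have Q: "real_leibniz_algebra ?Q"
    by (rule real_leibniz_algebra_image[OF surj zero add scale mult])
  show epi: "leibniz_epi L ?Q (\<lambda>x. R +> x)"
    by (intro leibniz_epi.intro leibniz_epi_axioms.intro real_leibniz_algebra_axioms Q surj add scale mult)
  have "x \<in> R \<longleftrightarrow> R +> x = R +> \<zero>" if "x \<in> carrier L" for x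
  proof -
    have "x \<ominus> \<zero> = x" using that by (simp add: a_minus_def)
    then show ?thesis using eq[OF that M.zero_closed] by simp
  qed
  then show "leibniz_epi.ker L ?Q (\<lambda>x. R +> x) = R"
    using Rc zero unfolding leibniz_epi.ker_def[OF epi] by auto
qed

lemma image_in_quotient_eq:
  assumes R: "subsp R" and H: "subsp H"
  shows "image_in_quotient L R H = (\<lambda>x. R +> x) ` H"
proof -
  have "R +> (h \<oplus> r) = R +> h" if hr: "h \<in> H" "r \<in> R" for h r
  proof -
    have c: "h \<in> carrier L" "r \<in> carrier L" using that H R subsp_in_carrier by auto
    have "(h \<oplus> r) \<ominus> h = r" by (rule vec_eqI) (use c in \<open>auto simp: lin_simps\<close>)
    then show ?thesis using coset_eq_iff[OF R, of "h \<oplus> r" h] c hr by simp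
  qed
  moreover have "H \<subseteq> H <+>\<^bsub>L\<^esub> R" by (rule set_add_upper1[OF subsp_carrier[OF H] R])
  ultimately show ?thesis unfolding image_in_quotient_def by (auto elim!: set_addE)
qed

lemma cartan_conj_rel_equiv: "equiv {H. cartan H} (cartan_conj_rel L)"
proof (rule equivI)
  show "cartan_conj_rel L \<subseteq> {H. cartan H} \<times> {H. cartan H}"
    by (auto simp: cartan_conj_rel_def)
  show "refl_on {H. cartan H} (cartan_conj_rel L)"
    using conjugate_refl cartanD(5) by (auto simp: refl_on_def cartan_conj_rel_def)
  show "sym (cartan_conj_rel L)"
    using conjugate_sym cartanD(5) by (auto simp: sym_def cartan_conj_rel_def)
  show "trans (cartan_conj_rel L)"
    unfolding trans_def cartan_conj_rel_def using conjugate_trans cartanD(5) by blast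
qed

end

text \<open>One direction of \<open>rel\<close> makes the map on classes well defined, the other
  makes it injective. The union in \<open>\<Phi>\<close> avoids choosing representatives, since all
  of them give the same class.\<close>

lemma quotient_bij_betw:
  assumes r: "equiv A r" and s: "equiv B s" and f: "\<And>x. x \<in> A \<Longrightarrow> f x \<in> B"
    and rel: "\<And>x y. x \<in> A \<Longrightarrow> y \<in> A \<Longrightarrow> (x, y) \<in> r \<longleftrightarrow> (f x, f y) \<in> s"
    and surj: "\<And>b. b \<in> B \<Longrightarrow> \<exists>a\<in>A. f a = b"
  shows "\<exists>\<Phi>. bij_betw \<Phi> (A // r) (B // s) \<and> (\<forall>x\<in>A. \<Phi> (r `` {x}) = s `` {f x})"
proof -
  define \<Phi> where "\<Phi> c = (\<Union>x\<in>c. s `` {f x})" for c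
  have \<Phi>: "\<Phi> (r `` {x}) = s `` {f x}" if x: "x \<in> A" for x
  proof -
    have "s `` {f y} = s `` {f x}" if "y \<in> r `` {x}" for y
      using that x rel f equiv_class_eq[OF s] equiv_class_eq_iff[OF r] by (metis Image_singleton_iff)
    moreover have "x \<in> r `` {x}" by (rule equiv_class_self[OF r x])
    ultimately show ?thesis unfolding \<Phi>_def by blast
  qed
  have "bij_betw \<Phi> (A // r) (B // s)"
    unfolding bij_betw_def
  proof
    show "inj_on \<Phi> (A // r)"
    proof (rule inj_onI)
      fix c d assume "c \<in> A // r" "d \<in> A // r" and eq: "\<Phi> c = \<Phi> d"
      then obtain x y where xy: "x \<in> A" "c = r `` {x}" "y \<in> A" "d = r `` {y}" by (auto elim!: quotientE)
      then have "(f x, f y) \<in> s" using eq \<Phi> eq_equiv_class[OF _ s f] by metis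
      then have "(x, y) \<in> r" using rel[OF xy(1,3)] by blast
      then show "c = d" using xy equiv_class_eq[OF r] by blast
    qed
    show "\<Phi> ` (A // r) = B // s"
    proof
      show "\<Phi> ` (A // r) \<subseteq> B // s" using \<Phi> f by (auto elim!: quotientE intro!: quotientI)
      show "B // s \<subseteq> \<Phi> ` (A // r)"
      proof
        fix d assume "d \<in> B // s"
        then obtain b where b: "b \<in> B" "d = s `` {b}" by (auto elim!: quotientE)
        then obtain a where a: "a \<in> A" "f a = b" using surj by blast
        then have "d = \<Phi> (r `` {a})" using \<Phi> b by simp
        then show "d \<in> \<Phi> ` (A // r)" using quotientI[OF a(1), of r] by blast
      qed
    qed
  qed
  then show ?thesis using \<Phi> by blast
qed

theorem theorem6:
  fixes L :: "(real, 'a) module" and R :: "'a set"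
  assumes "real_leibniz_algebra L"
    and "is_radical L R"
  shows "(\<exists>\<Phi>. bij_betw \<Phi> (cartan_conj_classes L) (cartan_conj_classes (quotient_algebra L R)) \<and>
           (\<forall>H. cartan_subalgebra L H \<longrightarrow>
              \<Phi> (cartan_conj_rel L `` {H}) =
                cartan_conj_rel (quotient_algebra L R) `` {image_in_quotient L R H})) \<and>
         (\<forall>H\<^sub>1 H\<^sub>2. cartan_subalgebra L H\<^sub>1 \<and> cartan_subalgebra L H\<^sub>2 \<longrightarrow>
            (conjugate_in L H\<^sub>1 H\<^sub>2 \<longleftrightarrow>
             conjugate_in (quotient_algebra L R)
               (image_in_quotient L R H\<^sub>1) (image_in_quotient L R H\<^sub>2)))"
proof -
  have R: "ideal_of L R" "solvable_in L R" using assms(2) by (auto simp: is_radical_def)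
  define Q where "Q = quotient_algebra L R"
  define \<pi> where "\<pi> = (\<lambda>x. R +>\<^bsub>L\<^esub> x)"
  interpret leibniz_epi L Q \<pi>
    unfolding Q_def \<pi>_def by (rule real_leibniz_algebra.quotient_epi(1)[OF assms(1) R(1)])
  have ker: "ker = R"
    using real_leibniz_algebra.quotient_epi(2)[OF assms(1) R(1)] by (simp add: Q_def \<pi>_def)
  have sR: "A.subsp R" using R(1) by (simp add: ideal_of_def)
  have im: "image_in_quotient L R H = \<pi> ` H" if "A.cartan H" for H
    using A.image_in_quotient_eq[OF sR A.cartanD(3)[OF that]] by (simp add: \<pi>_def)
  \<comment> \<open>Automorphisms push down for one direction; the converse rests on the solvability
    of the kernel \<open>R\<close>.\<close>
  have conj: "conjugate_in L H K \<longleftrightarrow> conjugate_in Q (\<pi> ` H) (\<pi> ` K)" if "A.cartan H" "A.cartan K" for H K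
    using conjugate_image[OF A.cartanD(5)[OF that(1)]] conjugate_lift[OF _ that] R(2) ker by blast
  have "\<exists>\<Phi>. bij_betw \<Phi> ({H. A.cartan H} // cartan_conj_rel L) ({H. B.cartan H} // cartan_conj_rel Q) \<and>
      (\<forall>H\<in>{H. A.cartan H}. \<Phi> (cartan_conj_rel L `` {H}) = cartan_conj_rel Q `` {image_in_quotient L R H})"
  proof (rule quotient_bij_betw[OF A.cartan_conj_rel_equiv B.cartan_conj_rel_equiv])
    show "image_in_quotient L R H \<in> {H. B.cartan H}" if "H \<in> {H. A.cartan H}" for H
      using that im cartan_image by simp
    show "(H, K) \<in> cartan_conj_rel L \<longleftrightarrow>
        (image_in_quotient L R H, image_in_quotient L R K) \<in> cartan_conj_rel Q"
      if "H \<in> {H. A.cartan H}" "K \<in> {H. A.cartan H}" for H K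
      using that im cartan_image conj by (simp add: cartan_conj_rel_def)
    show "\<exists>H\<in>{H. A.cartan H}. image_in_quotient L R H = C" if "C \<in> {H. B.cartan H}" for C
      using cartan_lift[of C] that R(2) ker im by auto
  qed
  then show ?thesis using conj im by (simp add: cartan_conj_classes_def Q_def)
qed

end
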